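(* Let $(M,g)$ be a Lorentzian manifold with a Witt structure $TM=(V_{p_1}\oplus V_{p_1^*})\oplus V_{q_1}$, null frame $(\nu,\nu^* )$, dual forms $\sigma,\sigma^*$, $H=V_{q_1}$, and canonical Witt connection $\nabla$, as described in the context. A curve $c\in\mathcal{C}_H$ is a normal sub-Riemannian geodesic if and only if there exists $\lambda=(\lambda_1,\lambda_2)\in C^\infty(M,\mathbb{R}^2)$ such that, with $\lambda_i^c=\lambda_i\circ c$, $$\nabla_{\dot c}\dot c=\lambda_1^c\,\big(i(\dot c)d\sigma\big)_H^\sharp+\lambda_2^c\,\big(i(\dot c)d\sigma^*\big)_H^\sharp,$$ $$\begin{pmatrix}\dot{\lambda_1^c}\\ \dot{\lambda_2^c}\end{pmatrix}=\begin{pmatrix}(\mathcal{L}_\nu\sigma)(\dot c)&(\mathcal{L}_\nu\sigma^* )(\dot c)\\(\mathcal{L}_{\nu^*}\sigma)(\dot c)&(\mathcal{L}_{\nu^*}\sigma^* )(\dot c)\end{pmatrix}\begin{pmatrix}\lambda_1^c\\ \lambda_2^c\end{pmatrix}+\frac12\begin{pmatrix}(\mathcal{L}_\nu g)(\dot c,\dot c)\\(\mathcal{L}_{\nu^*}g)(\dot c,\dot c)\end{pmatrix}.$$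
   Context: **Setting.** $(M,g)$ is a Lorentzian manifold with a decomposition $TM=(V_{p_1}\oplus V_{p_1^*})\oplus V_{q_1}$, where $V_{p_1}\oplus V_{p_1^*}$ is $g$-orthogonal to $V_{q_1}$, $V_{p_1}$ and $V_{p_1^*}$ are trivial null line subbundles with $g|_{V_{p_1}\times V_{p_1^*}}$ non-degenerate, and $g|_{V_{q_1}}$ is positive definite. Fix global nowhere vanishing sections $\nu$ of $V_{p_1}$ and $\nu^*$ of $V_{p_1^*}$ with $g(\nu,\nu^* )=1$, and put $\sigma=g(\nu^*,\cdot)$, $\sigma^*=g(\nu,\cdot)$. Put $H=V_{q_1}=\mathrm{Ker}\,\sigma\cap\mathrm{Ker}\,\sigma^*$; $(M,H,g|_H)$ is the associated sub-Riemannian structure. **Canonical Witt connection.** $\nabla$ is the unique affine connection with $\nabla g=0$ whose torsion $T(X,Y)=\nabla_XY-\nabla_YX-[X,Y]$ is, for $X,Y\in V_{q_1}$, $T(X,Y)=d\sigma(X,Y)\nu+d\sigma^*(X,Y)\nu^*$, $T(\nu,X)=d\sigma^*(\nu,X)\nu^*-\frac12(\mathcal{L}_Xg)(\nu,\nu^* )\nu+\mathcal{T}_{V_{q_1}}(\nu,X)$, $T(\nu^*,X)=d\sigma(\nu^*,X)\nu-\frac12(\mathcal{L}_Xg)(\nu,\nu^* )\nu^*+\mathcal{T}_{V_{q_1}}(\nu^*,X)$, $T(\nu,\nu^* )=-[\nu,\nu^*]_{V_{q_1}}$, where $\mathcal{T}_{V_{q_1}}(\nu,X),\mathcal{T}_{V_{q_1}}(\nu^*,X)\in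 V_{q_1}$ are given by $g(\mathcal{T}_{V_{q_1}}(\nu,X),Y)=\frac12(\mathcal{L}_\nu g)(X,Y)$ and $g(\mathcal{T}_{V_{q_1}}(\nu^*,X),Y)=\frac12(\mathcal{L}_{\nu^*}g)(X,Y)$, and $[\cdot,\cdot]_{V_{q_1}}$ denotes the $V_{q_1}$-component. It preserves each of $V_{p_1},V_{p_1^*},V_{q_1}$. Convention: $d\alpha(X,Y)=X\alpha(Y)-Y\alpha(X)-\alpha([X,Y])$. **Normal geodesics.** For fixed $x,y\in M$, $\mathcal{C}$ is the set of smooth curves $c:[0,1]\to M$ with $c(0)=x$, $c(1)=y$, and $\mathcal{C}_H$ the subset of those with $\dot c(t)\in H_{c(t)}$ for all $t$. A normal sub-Riemannian geodesic is a critical point of the length $\int_0^1\sqrt{g(\dot c,\dot c)}\,dt$ on $\mathcal{C}_H$; up to reparameterization these are the critical points of the energy $\frac12\int_0^1g(\dot c,\dot c)\,dt$ on $\mathcal{C}_H$. They are taken in the following Lagrange multiplier form: for $\lambda=(\lambda_1,\lambda_2)\in C^\infty(M,\mathbb{R}^2)$ and $c\in\mathcal{C}$ put $$E^\lambda(c)=\frac12\int_0^1g(\dot c,\dot c)\,dt-\int_0^1(\lambda_1\sigma+\lambda_2\sigma^* )(\dot c)\,dt;$$ a curve $c\in\mathcal{C}_H$ is a normal sub-Riemannian geodesic if and only if there exists $\lambda\in C^\infty(M,\mathbb{R}^2)$ (the Lagrange multiplier) such that $c$ is a critical point of $E^\lambda$ on $\mathcal{C}$, i.e. $\frac{\partial}{\partial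 s}E^\lambda(c_s)|_{s=0}=0$ for every smooth variation $c_s$ of $c$ with fixed endpoints. **Notation.** $(i(\dot c)d\sigma)_H^\sharp$ is the vector field along $c$ with values in $H$ determined by $g\big((i(\dot c)d\sigma)_H^\sharp,Y\big)=d\sigma(\dot c,Y)$ for $Y\in H$; similarly for $\sigma^*$.
   Formalization: In the second displayed equation the term with (L_ν g)(ċ,ċ) and (L_ν* g)(ċ,ċ) is taken with factor −1/2 instead of +1/2, since with the stated conventions the printed plus sign makes the equivalence false. *)

theory Defs
  imports "HOL-Analysis.Analysis" "HOL-Library.Function_Algebras"
begin

section \<open>Smooth maps between open subsets of normed spaces\<close>

primrec Ck_on :: "nat \<Rightarrow> 'a::real_normed_vector set \<Rightarrow> ('a \<Rightarrow> 'b::real_normed_vector) \<Rightarrow> bool" where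
  "Ck_on 0 S f \<longleftrightarrow> continuous_on S f"
| "Ck_on (Suc k) S f \<longleftrightarrow>
     (\<forall>x\<in>S. f differentiable (at x)) \<and> (\<forall>v. Ck_on k S (\<lambda>x. frechet_derivative f (at x) v))"

text \<open>To be used for open \<open>S\<close> only.\<close>

definition smooth_on :: "'a::real_normed_vector set \<Rightarrow> ('a \<Rightarrow> 'b::real_normed_vector) \<Rightarrow> bool" where
  "smooth_on S f \<longleftrightarrow> (\<forall>k. Ck_on k S f)"


section \<open>Smooth manifolds and tangent vectors\<close>

text \<open>
  The manifold is the whole type \<open>'m\<close>; its smooth structure is given by an atlas \<open>A\<close>, which need
  not be maximal. A chart is a pair of its domain and its coordinate map; the values of the
  coordinate map outside the domain are irrelevant. The dimension of the manifold is
  \<open>DIM('e)\<close>.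
\<close>

type_synonym ('m, 'e) chart = "'m set \<times> ('m \<Rightarrow> 'e)"

definition cinv :: "('m, 'e) chart \<Rightarrow> 'e \<Rightarrow> 'm" where
  "cinv \<kappa> = inv_into (fst \<kappa>) (snd \<kappa>)"

definition smooth_atlas ::
  "('m::{t2_space, second_countable_topology}, 'e::euclidean_space) chart set \<Rightarrow> bool" where
  "smooth_atlas A \<longleftrightarrow>
     (\<Union>\<kappa>\<in>A. fst \<kappa>) = UNIV \<and>
     (\<forall>\<kappa>\<in>A. open (fst \<kappa>) \<and> open (snd \<kappa> ` fst \<kappa>) \<and>
        homeomorphism (fst \<kappa>) (snd \<kappa> ` fst \<kappa>) (snd \<kappa>) (cinv \<kappa>)) \<and>
     (\<forall>\<kappa>\<in>A. \<forall>\<kappa>'\<in>A. smooth_on (snd \<kappa> ` (fst \<kappa> \<inter> fst \<kappa>')) (snd \<kappa>' \<circ> cinv \<kappa>))"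

definition chart_at :: "('m, 'e) chart set \<Rightarrow> 'm \<Rightarrow> ('m, 'e) chart" where
  "chart_at A p = (SOME \<kappa>. \<kappa> \<in> A \<and> p \<in> fst \<kappa>)"

definition smooth_function ::
  "('m, 'e::euclidean_space) chart set \<Rightarrow> 'm set \<Rightarrow> ('m \<Rightarrow> 'b::real_normed_vector) \<Rightarrow> bool" where
  "smooth_function A W f \<longleftrightarrow> (\<forall>\<kappa>\<in>A. smooth_on (snd \<kappa> ` (W \<inter> fst \<kappa>)) (f \<circ> cinv \<kappa>))"

text \<open>
  A tangent vector at \<open>p\<close> is the family of its components in all charts around \<open>p\<close>, which
  transforms by the Jacobians of the coordinate changes; it is set to \<open>0\<close> at all other indices,
  so that the tangent space at \<open>p\<close> is a subspace of a function space of dimension \<open>DIM('e)\<close>.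
\<close>

type_synonym ('m, 'e) tangent = "('m, 'e) chart \<Rightarrow> 'e"

instantiation "fun" :: (type, real_vector) real_vector
begin

definition scaleR_fun_def: "scaleR a f = (\<lambda>x. a *\<^sub>R f x)"

instance
  by standard (simp_all add: scaleR_fun_def fun_eq_iff algebra_simps)

end

definition tangent_space ::
  "('m, 'e::euclidean_space) chart set \<Rightarrow> 'm \<Rightarrow> ('m, 'e) tangent set" where
  "tangent_space A p =
     {v. (\<forall>\<kappa>. \<not> (\<kappa> \<in> A \<and> p \<in> fst \<kappa>) \<longrightarrow> v \<kappa> = 0) \<and>
         (\<forall>\<kappa>\<in>A. \<forall>\<kappa>'\<in>A. p \<in> fst \<kappa> \<and> p \<in> fst \<kappa>' \<longrightarrow>
            v \<kappa>' = frechet_derivative (snd \<kappa>' \<circ> cinv \<kappa>) (at (snd \<kappa> p)) (v \<kappa>))}"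

text \<open>The tangent vector at \<open>p\<close> whose component in the chart \<open>\<kappa>\<close> is \<open>e\<close>.\<close>

definition coord_vec ::
  "('m, 'e::euclidean_space) chart set \<Rightarrow> ('m, 'e) chart \<Rightarrow> 'm \<Rightarrow> 'e \<Rightarrow> ('m, 'e) tangent" where
  "coord_vec A \<kappa> p e = (\<lambda>\<kappa>'. if \<kappa>' \<in> A \<and> p \<in> fst \<kappa>'
     then frechet_derivative (snd \<kappa>' \<circ> cinv \<kappa>) (at (snd \<kappa> p)) e else 0)"

definition dir_deriv ::
  "('m, 'e::euclidean_space) chart set \<Rightarrow> ('m \<Rightarrow> 'b::real_normed_vector) \<Rightarrow> 'm \<Rightarrow> ('m, 'e) tangent \<Rightarrow> 'b" where
  "dir_deriv A f p v =
     (let \<kappa> = chart_at A p in frechet_derivative (f \<circ> cinv \<kappa>) (at (snd \<kappa> p)) (v \<kappa>))"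

definition vector_fields ::
  "('m, 'e::euclidean_space) chart set \<Rightarrow> 'm set \<Rightarrow> ('m \<Rightarrow> ('m, 'e) tangent) set" where
  "vector_fields A W =
     {X. (\<forall>p\<in>W. X p \<in> tangent_space A p) \<and>
         (\<forall>\<kappa>\<in>A. smooth_on (snd \<kappa> ` (W \<inter> fst \<kappa>)) (\<lambda>x. X (cinv \<kappa> x) \<kappa>))}"

definition lie_bracket ::
  "('m, 'e::euclidean_space) chart set \<Rightarrow> ('m \<Rightarrow> ('m, 'e) tangent) \<Rightarrow> ('m \<Rightarrow> ('m, 'e) tangent) \<Rightarrow>
   'm \<Rightarrow> ('m, 'e) tangent" where
  "lie_bracket A X Y p = (\<lambda>\<kappa>. if \<kappa> \<in> A \<and> p \<in> fst \<kappa>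
     then frechet_derivative (\<lambda>x. Y (cinv \<kappa> x) \<kappa>) (at (snd \<kappa> p)) (X p \<kappa>)
        - frechet_derivative (\<lambda>x. X (cinv \<kappa> x) \<kappa>) (at (snd \<kappa> p)) (Y p \<kappa>)
     else 0)"

definition smooth_subbundle ::
  "('m::topological_space, 'e::euclidean_space) chart set \<Rightarrow> nat \<Rightarrow> ('m \<Rightarrow> ('m, 'e) tangent set) \<Rightarrow> bool" where
  "smooth_subbundle A r V \<longleftrightarrow>
     (\<forall>p. \<exists>W X. open W \<and> p \<in> W \<and> (\<forall>i<r. X i \<in> vector_fields A W) \<and>
        (\<forall>q\<in>W. inj_on (\<lambda>i. X i q) {..<r} \<and> independent ((\<lambda>i. X i q) ` {..<r}) \<and>
               span ((\<lambda>i. X i q) ` {..<r}) = V q))"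

definition sections ::
  "('m, 'e::euclidean_space) chart set \<Rightarrow> ('m \<Rightarrow> ('m, 'e) tangent set) \<Rightarrow> 'm set \<Rightarrow>
   ('m \<Rightarrow> ('m, 'e) tangent) set" where
  "sections A V W = {X \<in> vector_fields A W. \<forall>p\<in>W. X p \<in> V p}"


section \<open>Exterior derivative and Lie derivatives\<close>

type_synonym ('m, 'e) form = "'m \<Rightarrow> ('m, 'e) tangent \<Rightarrow> real"
type_synonym ('m, 'e) bilin = "'m \<Rightarrow> ('m, 'e) tangent \<Rightarrow> ('m, 'e) tangent \<Rightarrow> real"

definition ext_deriv ::
  "('m, 'e::euclidean_space) chart set \<Rightarrow> ('m, 'e) form \<Rightarrow>
   ('m \<Rightarrow> ('m, 'e) tangent) \<Rightarrow> ('m \<Rightarrow> ('m, 'e) tangent) \<Rightarrow> 'm \<Rightarrow> real" where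
  "ext_deriv A \<alpha> X Y p =
     dir_deriv A (\<lambda>q. \<alpha> q (Y q)) p (X p) - dir_deriv A (\<lambda>q. \<alpha> q (X q)) p (Y p)
     - \<alpha> p (lie_bracket A X Y p)"

definition lie_form ::
  "('m, 'e::euclidean_space) chart set \<Rightarrow> ('m \<Rightarrow> ('m, 'e) tangent) \<Rightarrow> ('m, 'e) form \<Rightarrow>
   ('m \<Rightarrow> ('m, 'e) tangent) \<Rightarrow> 'm \<Rightarrow> real" where
  "lie_form A X \<alpha> Y p =
     dir_deriv A (\<lambda>q. \<alpha> q (Y q)) p (X p) - \<alpha> p (lie_bracket A X Y p)"

definition lie_bilin ::
  "('m, 'e::euclidean_space) chart set \<Rightarrow> ('m \<Rightarrow> ('m, 'e) tangent) \<Rightarrow> ('m, 'e) bilin \<Rightarrow>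
   ('m \<Rightarrow> ('m, 'e) tangent) \<Rightarrow> ('m \<Rightarrow> ('m, 'e) tangent) \<Rightarrow> 'm \<Rightarrow> real" where
  "lie_bilin A X g Y Z p =
     dir_deriv A (\<lambda>q. g q (Y q) (Z q)) p (X p)
     - g p (lie_bracket A X Y p) (Z p) - g p (Y p) (lie_bracket A X Z p)"

text \<open>
  The three expressions above are tensorial in \<open>X, Y\<close>, in \<open>Y\<close> and in \<open>Y, Z\<close>, respectively. Their
  values on single tangent vectors are obtained by extending the vectors, around the point, to
  vector fields with constant components in some chart.
\<close>

definition const_ext ::
  "('m, 'e::euclidean_space) chart set \<Rightarrow> 'm \<Rightarrow> ('m, 'e) tangent \<Rightarrow> 'm \<Rightarrow> ('m, 'e) tangent" where
  "const_ext A p v = (let \<kappa> = chart_at A p in (\<lambda>q. coord_vec A \<kappa> q (v \<kappa>)))"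

definition ext_deriv_at where
  "ext_deriv_at A \<alpha> p v w = ext_deriv A \<alpha> (const_ext A p v) (const_ext A p w) p"

definition lie_form_at where
  "lie_form_at A X \<alpha> p v = lie_form A X \<alpha> (const_ext A p v) p"

definition lie_bilin_at where
  "lie_bilin_at A X g p v w = lie_bilin A X g (const_ext A p v) (const_ext A p w) p"


section \<open>Lorentzian metrics and affine connections\<close>

definition neg_def_on :: "('v::real_vector \<Rightarrow> 'v \<Rightarrow> real) \<Rightarrow> 'v set \<Rightarrow> bool" where
  "neg_def_on b S \<longleftrightarrow> (\<forall>v\<in>S. v \<noteq> 0 \<longrightarrow> b v v < 0)"

definition lorentzian ::
  "('m::topological_space, 'e::euclidean_space) chart set \<Rightarrow> ('m, 'e) bilin \<Rightarrow> bool" where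
  "lorentzian A g \<longleftrightarrow>
     (\<forall>p. \<forall>u\<in>tangent_space A p. \<forall>v\<in>tangent_space A p. \<forall>w\<in>tangent_space A p. \<forall>a.
        g p (u + v) w = g p u w + g p v w \<and> g p (a *\<^sub>R u) w = a * g p u w \<and> g p u w = g p w u) \<and>
     (\<forall>W. open W \<longrightarrow> (\<forall>X\<in>vector_fields A W. \<forall>Y\<in>vector_fields A W.
        smooth_function A W (\<lambda>q. g q (X q) (Y q)))) \<and>
     (\<forall>p. \<forall>v\<in>tangent_space A p. (\<forall>w\<in>tangent_space A p. g p v w = 0) \<longrightarrow> v = 0) \<and>
     (\<forall>p. (\<exists>S. subspace S \<and> S \<subseteq> tangent_space A p \<and> neg_def_on (g p) S \<and> dim S = 1) \<and>
          (\<forall>S. subspace S \<and> S \<subseteq> tangent_space A p \<and> neg_def_on (g p) S \<longrightarrow> dim S \<le> 1))"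

text \<open>
  An affine connection is taken as an operator on the vector fields over each open set, i.e. in
  its sheaf form. Since vector fields are total functions, linearity over functions that are
  smooth on \<open>W\<close> (such as the indicator of \<open>W\<close>) forces the values of \<open>D X Y\<close> on \<open>W\<close> to depend only
  on the restrictions of \<open>X\<close> and \<open>Y\<close> to \<open>W\<close>.
\<close>

definition affine_connection ::
  "('m::topological_space, 'e::euclidean_space) chart set \<Rightarrow>
   (('m \<Rightarrow> ('m, 'e) tangent) \<Rightarrow> ('m \<Rightarrow> ('m, 'e) tangent) \<Rightarrow> 'm \<Rightarrow> ('m, 'e) tangent) \<Rightarrow> bool" where
  "affine_connection A D \<longleftrightarrow>
     (\<forall>W. open W \<longrightarrow> (\<forall>X\<in>vector_fields A W. \<forall>X'\<in>vector_fields A W.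
        \<forall>Y\<in>vector_fields A W. \<forall>Y'\<in>vector_fields A W.
        \<forall>f. smooth_function A W f \<longrightarrow>
          D X Y \<in> vector_fields A W \<and>
          (\<forall>p\<in>W.
             D (\<lambda>q. X q + X' q) Y p = D X Y p + D X' Y p \<and>
             D (\<lambda>q. f q *\<^sub>R X q) Y p = f p *\<^sub>R D X Y p \<and>
             D X (\<lambda>q. Y q + Y' q) p = D X Y p + D X Y' p \<and>
             D X (\<lambda>q. f q *\<^sub>R Y q) p = f p *\<^sub>R D X Y p + dir_deriv A f p (X p) *\<^sub>R Y p)))"

definition torsion where
  "torsion A D X Y p = D X Y p - D Y X p - lie_bracket A X Y p"

definition metric_connection ::
  "('m::topological_space, 'e::euclidean_space) chart set \<Rightarrow> ('m, 'e) bilin \<Rightarrow>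
   (('m \<Rightarrow> ('m, 'e) tangent) \<Rightarrow> ('m \<Rightarrow> ('m, 'e) tangent) \<Rightarrow> 'm \<Rightarrow> ('m, 'e) tangent) \<Rightarrow> bool" where
  "metric_connection A g D \<longleftrightarrow>
     (\<forall>W. open W \<longrightarrow> (\<forall>X\<in>vector_fields A W. \<forall>Y\<in>vector_fields A W. \<forall>Z\<in>vector_fields A W.
        \<forall>p\<in>W. dir_deriv A (\<lambda>q. g q (Y q) (Z q)) p (X p)
               = g p (D X Y p) (Z p) + g p (Y p) (D X Z p)))"


section \<open>Witt structures and the canonical Witt connection\<close>

record ('m, 'e) witt =
  atlas :: "('m, 'e) chart set"
  wmetric :: "('m, 'e) bilin"
  Vp :: "'m \<Rightarrow> ('m, 'e) tangent set"
  Vps :: "'m \<Rightarrow> ('m, 'e) tangent set"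
  Vq :: "'m \<Rightarrow> ('m, 'e) tangent set"
  nu :: "'m \<Rightarrow> ('m, 'e) tangent"
  nus :: "'m \<Rightarrow> ('m, 'e) tangent"

definition lorentzian_witt ::
  "('m::{t2_space, second_countable_topology}, 'e::euclidean_space) witt \<Rightarrow> bool" where
  "lorentzian_witt M \<longleftrightarrow>
     smooth_atlas (atlas M) \<and> lorentzian (atlas M) (wmetric M) \<and>
     smooth_subbundle (atlas M) 1 (Vp M) \<and> smooth_subbundle (atlas M) 1 (Vps M) \<and>
     smooth_subbundle (atlas M) (DIM('e) - 2) (Vq M) \<and>
     (\<forall>p. \<forall>v\<in>tangent_space (atlas M) p.
        \<exists>!(a, b, w). a \<in> Vp M p \<and> b \<in> Vps M p \<and> w \<in> Vq M p \<and> v = a + b + w) \<and>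
     (\<forall>p. \<forall>a\<in>Vp M p. \<forall>b\<in>Vps M p. \<forall>w\<in>Vq M p. wmetric M p a w = 0 \<and> wmetric M p b w = 0) \<and>
     (\<forall>p. (\<forall>a\<in>Vp M p. wmetric M p a a = 0) \<and> (\<forall>b\<in>Vps M p. wmetric M p b b = 0)) \<and>
     (\<forall>p. (\<forall>a\<in>Vp M p. (\<forall>b\<in>Vps M p. wmetric M p a b = 0) \<longrightarrow> a = 0) \<and>
          (\<forall>b\<in>Vps M p. (\<forall>a\<in>Vp M p. wmetric M p a b = 0) \<longrightarrow> b = 0)) \<and>
     (\<forall>p. \<forall>w\<in>Vq M p. w \<noteq> 0 \<longrightarrow> wmetric M p w w > 0) \<and>
     nu M \<in> sections (atlas M) (Vp M) UNIV \<and> (\<forall>p. nu M p \<noteq> 0) \<and>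
     nus M \<in> sections (atlas M) (Vps M) UNIV \<and> (\<forall>p. nus M p \<noteq> 0) \<and>
     (\<forall>p. wmetric M p (nu M p) (nus M p) = 1)"

definition wsigma :: "('m, 'e) witt \<Rightarrow> ('m, 'e) form" where
  "wsigma M p v = wmetric M p (nus M p) v"

definition wsigmas :: "('m, 'e) witt \<Rightarrow> ('m, 'e) form" where
  "wsigmas M p v = wmetric M p (nu M p) v"

definition proj_Vq :: "('m, 'e::euclidean_space) witt \<Rightarrow> 'm \<Rightarrow> ('m, 'e) tangent \<Rightarrow> ('m, 'e) tangent" where
  "proj_Vq M p v = (THE w. w \<in> Vq M p \<and> (\<exists>a\<in>Vp M p. \<exists>b\<in>Vps M p. v = a + b + w))"

text \<open>
  The vector of \<open>H = Vq\<close> at \<open>p\<close> representing the restriction of \<open>\<beta>\<close> to \<open>H\<close> with respect to the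
  metric.
\<close>

definition sharp_H ::
  "('m, 'e::euclidean_space) witt \<Rightarrow> 'm \<Rightarrow> (('m, 'e) tangent \<Rightarrow> real) \<Rightarrow> ('m, 'e) tangent" where
  "sharp_H M p \<beta> = (THE w. w \<in> Vq M p \<and> (\<forall>y\<in>Vq M p. wmetric M p w y = \<beta> y))"

text \<open>
  The term \<open>sharp_H\<close> with \<open>lie_bilin\<close> for \<open>\<xi> = nu M\<close> or \<open>\<xi> = nus M\<close> is the \<open>Vq\<close>-component of the
  torsion \<open>T(\<xi>, X)\<close> for \<open>X\<close> in \<open>Vq\<close>.
\<close>

definition torsion_Vq where
  "torsion_Vq M \<xi> X p =
     sharp_H M p (\<lambda>y. 1/2 * lie_bilin (atlas M) \<xi> (wmetric M) X (const_ext (atlas M) p y) p)"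

definition canonical_witt_connection ::
  "('m::{t2_space, second_countable_topology}, 'e::euclidean_space) witt \<Rightarrow>
   (('m \<Rightarrow> ('m, 'e) tangent) \<Rightarrow> ('m \<Rightarrow> ('m, 'e) tangent) \<Rightarrow> 'm \<Rightarrow> ('m, 'e) tangent) \<Rightarrow> bool" where
  "canonical_witt_connection M D \<longleftrightarrow>
     affine_connection (atlas M) D \<and> metric_connection (atlas M) (wmetric M) D \<and>
     (\<forall>W. open W \<longrightarrow>
        (\<forall>X\<in>sections (atlas M) (Vq M) W. \<forall>Y\<in>sections (atlas M) (Vq M) W. \<forall>p\<in>W.
           torsion (atlas M) D X Y p =
             ext_deriv (atlas M) (wsigma M) X Y p *\<^sub>R nu M p
             + ext_deriv (atlas M) (wsigmas M) X Y p *\<^sub>R nus M p) \<and>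
        (\<forall>X\<in>sections (atlas M) (Vq M) W. \<forall>p\<in>W.
           torsion (atlas M) D (nu M) X p =
             ext_deriv (atlas M) (wsigmas M) (nu M) X p *\<^sub>R nus M p
             - (1/2 * lie_bilin (atlas M) X (wmetric M) (nu M) (nus M) p) *\<^sub>R nu M p
             + torsion_Vq M (nu M) X p \<and>
           torsion (atlas M) D (nus M) X p =
             ext_deriv (atlas M) (wsigma M) (nus M) X p *\<^sub>R nu M p
             - (1/2 * lie_bilin (atlas M) X (wmetric M) (nu M) (nus M) p) *\<^sub>R nus M p
             + torsion_Vq M (nus M) X p)) \<and>
     (\<forall>p. torsion (atlas M) D (nu M) (nus M) p
            = - proj_Vq M p (lie_bracket (atlas M) (nu M) (nus M) p))"


section \<open>Curves, energy and normal geodesics\<close>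

text \<open>
  A map from a (not necessarily open) subset of a Euclidean space is smooth if it extends to a
  smooth map on an open neighbourhood.
\<close>

definition smooth_map_on ::
  "('m::topological_space, 'e::euclidean_space) chart set \<Rightarrow> 'b::real_normed_vector set \<Rightarrow> ('b \<Rightarrow> 'm) \<Rightarrow> bool" where
  "smooth_map_on A S f \<longleftrightarrow>
     (\<exists>T F. open T \<and> S \<subseteq> T \<and> (\<forall>x\<in>S. F x = f x) \<and> continuous_on T F \<and>
        (\<forall>\<kappa>\<in>A. smooth_on (T \<inter> F -` fst \<kappa>) (snd \<kappa> \<circ> F)))"

text \<open>Only the restriction of \<open>c\<close> to \<open>{0..1}\<close> matters; derivatives are one-sided at the endpoints.\<close>

definition velocity ::
  "('m, 'e::euclidean_space) chart set \<Rightarrow> (real \<Rightarrow> 'm) \<Rightarrow> real \<Rightarrow> ('m, 'e) tangent" where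
  "velocity A c t = (\<lambda>\<kappa>. if \<kappa> \<in> A \<and> c t \<in> fst \<kappa>
     then vector_derivative (snd \<kappa> \<circ> c) (at t within {0..1}) else 0)"

text \<open>
  In coordinates, the covariant derivative of a vector field \<open>Z = Z\<^sup>k \<partial>\<^sub>k\<close> along a curve \<open>c\<close> with
  velocity \<open>u\<close> is \<open>(dZ\<^sup>k/dt) \<partial>\<^sub>k + Z\<^sup>k \<nabla>\<^sub>u \<partial>\<^sub>k\<close>.
\<close>

definition covariant_deriv ::
  "('m, 'e::euclidean_space) chart set \<Rightarrow>
   (('m \<Rightarrow> ('m, 'e) tangent) \<Rightarrow> ('m \<Rightarrow> ('m, 'e) tangent) \<Rightarrow> 'm \<Rightarrow> ('m, 'e) tangent) \<Rightarrow>
   (real \<Rightarrow> 'm) \<Rightarrow> (real \<Rightarrow> ('m, 'e) tangent) \<Rightarrow> real \<Rightarrow> ('m, 'e) tangent" where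
  "covariant_deriv A D c Z t = (let p = c t; \<kappa> = chart_at A p in
     coord_vec A \<kappa> p (vector_derivative (\<lambda>s. Z s \<kappa>) (at t within {0..1}))
     + D (const_ext A p (velocity A c t)) (const_ext A p (Z t)) p)"

definition curves ::
  "('m::topological_space, 'e::euclidean_space) witt \<Rightarrow> 'm \<Rightarrow> 'm \<Rightarrow> (real \<Rightarrow> 'm) set" where
  "curves M x y = {c. smooth_map_on (atlas M) {0..1} c \<and> c 0 = x \<and> c 1 = y}"

definition horizontal_curves ::
  "('m::topological_space, 'e::euclidean_space) witt \<Rightarrow> 'm \<Rightarrow> 'm \<Rightarrow> (real \<Rightarrow> 'm) set" where
  "horizontal_curves M x y =
     {c \<in> curves M x y. \<forall>t\<in>{0..1}. velocity (atlas M) c t \<in> Vq M (c t)}"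

definition energy ::
  "('m, 'e::euclidean_space) witt \<Rightarrow> ('m \<Rightarrow> real^2) \<Rightarrow> (real \<Rightarrow> 'm) \<Rightarrow> real" where
  "energy M L c =
     1/2 * integral {0..1} (\<lambda>t. wmetric M (c t) (velocity (atlas M) c t) (velocity (atlas M) c t))
     - integral {0..1} (\<lambda>t. L (c t) $ 1 * wsigma M (c t) (velocity (atlas M) c t)
                          + L (c t) $ 2 * wsigmas M (c t) (velocity (atlas M) c t))"

definition variation ::
  "('m::topological_space, 'e::euclidean_space) witt \<Rightarrow> 'm \<Rightarrow> 'm \<Rightarrow> (real \<Rightarrow> 'm) \<Rightarrow> (real \<times> real \<Rightarrow> 'm) \<Rightarrow> bool" where
  "variation M x y c F \<longleftrightarrow>
     (\<forall>t\<in>{0..1}. F (0, t) = c t) \<and>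
     (\<exists>\<epsilon>>0. smooth_map_on (atlas M) ({-\<epsilon><..<\<epsilon>} \<times> {0..1}) F \<and>
        (\<forall>s\<in>{-\<epsilon><..<\<epsilon>}. F (s, 0) = x \<and> F (s, 1) = y))"

text \<open>
  Sign conventions: for a horizontal curve and a variation field \<open>V\<close> vanishing at the endpoints, the
  first variation of \<open>energy M L\<close> is the integral of
  \<open>g(T(V, u), u) - g(V, \<nabla>\<^sub>u u) + d\<alpha>(u, V)\<close>, where \<open>u\<close> is the velocity and \<open>T\<close> the torsion of \<open>\<nabla>\<close>, with
  \<open>\<alpha> = L\<^sub>1 \<sigma> + L\<^sub>2 \<sigma>\<^sup>*\<close>. For \<open>V = \<nu>\<close> the integrand reads
  \<open>(1/2) (\<L>\<^sub>\<nu> g)(u, u) + dL\<^sub>1/dt - L\<^sub>1 (\<L>\<^sub>\<nu> \<sigma>)(u) - L\<^sub>2 (\<L>\<^sub>\<nu> \<sigma>\<^sup>*)(u)\<close>, so the metric term enters the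
  equation for \<open>dL\<^sub>1/dt\<close> with the factor \<open>-1/2\<close>; likewise for \<open>V = \<nu>\<^sup>*\<close> and \<open>dL\<^sub>2/dt\<close>.
\<close>

definition normal_geodesic ::
  "('m::topological_space, 'e::euclidean_space) witt \<Rightarrow> 'm \<Rightarrow> 'm \<Rightarrow> (real \<Rightarrow> 'm) \<Rightarrow> bool" where
  "normal_geodesic M x y c \<longleftrightarrow>
     c \<in> horizontal_curves M x y \<and>
     (\<exists>L::'m \<Rightarrow> real^2. smooth_function (atlas M) UNIV L \<and>
        (\<forall>F. variation M x y c F \<longrightarrow>
           ((\<lambda>s. energy M L (\<lambda>t. F (s, t))) has_real_derivative 0) (at 0)))"

end

theory Submission
  imports Defs
begin

text \<open>
  Let \<open>u\<close> be the velocity of the horizontal curve \<open>c\<close> and \<open>\<alpha> = \<lambda>\<^sub>1 \<sigma> + \<lambda>\<^sub>2 \<sigma>\<^sup>*\<close>. The curve is critical for the energy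
  with multiplier \<open>\<lambda>\<close>, which is the action of the Lagrangian \<open>1/2 g(v, v) - \<alpha>(v)\<close>, if and only if the
  Euler-Lagrange covector of this Lagrangian vanishes along \<open>c\<close>. A covector vanishes if and only if it
  vanishes on \<open>H\<close>, on \<open>\<nu>\<close> and on \<open>\<nu>\<^sup>*\<close>. Its value on \<open>w\<close> in \<open>H\<close> is \<open>g(\<nabla>\<^sub>u u, w) - d\<alpha>(u, w)\<close>, and on the two null
  directions it gives the equations for the derivatives of the multipliers. Hence, for each single
  multiplier, criticality is equivalent to the system of equations.

  \<^emph>\<open>First variation.\<close> For a family \<open>F(s, t)\<close> of curves put \<open>P = g(\<partial>\<^sub>tF, \<partial>\<^sub>sF) - \<alpha>(\<partial>\<^sub>sF)\<close>. At each point, \<open>\<partial>\<^sub>tP\<close> minus the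
  derivative in \<open>s\<close> of the Lagrangian is the Euler-Lagrange covector applied to \<open>\<partial>\<^sub>sF\<close>; this is a calculation in
  one chart (\<open>variation_density_euler_lagrange\<close>). Both functions are globally defined and \<open>P\<close> vanishes at fixed
  endpoints, so the fundamental theorem of calculus on the whole interval gives \<open>first_variation\<close>, although the
  curve may pass through many charts. Conversely, \<open>bump_variation\<close> moves the curve inside a single chart, and
  the fundamental lemma of the calculus of variations applies (\<open>critical_imp_euler_lagrange\<close>).

  \<^emph>\<open>Horizontal part.\<close> As \<open>\<nabla>\<close> is metric, the derivatives of \<open>g\<close> in the Euler-Lagrange covector can be written with
  Christoffel symbols, which leads to \<open>g(\<nabla>\<^sub>u u, w) + g(u, T(u, w)) - d\<alpha>(u, w)\<close>. The torsion of two vectors of \<open>H\<close> is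
  orthogonal to \<open>H\<close>, so the middle term vanishes (\<open>euler_lagrange_horizontal\<close>). To obtain the vector equation
  from its pairings with \<open>H\<close> one needs that \<open>\<nabla>\<^sub>u u\<close> lies in \<open>H\<close>. This holds because the \<open>H\<close>-component of \<open>T(\<nu>, X)\<close> is
  half of \<open>\<L>\<^sub>\<nu> g\<close>, and the same for \<open>\<nu>\<^sup>*\<close> (\<open>g_conn_frame\<close>, \<open>covariant_deriv_horizontal\<close>).

  \<^emph>\<open>Null part.\<close> For \<open>N = \<nu>\<close> or \<open>\<nu>\<^sup>*\<close> the functions \<open>g(u, N)\<close>, \<open>\<sigma>(N)\<close> and \<open>\<sigma>\<^sup>*(N)\<close> are constant along \<open>c\<close>. Their derivatives turn
  the coordinate expression into \<open>\<lambda>\<^sub>1 \<L>\<^sub>N\<sigma>(u) + \<lambda>\<^sub>2 \<L>\<^sub>N\<sigma>\<^sup>*(u) - 1/2 (\<L>\<^sub>N g)(u, u)\<close> minus the derivative of \<open>\<lambda>\<^sub>1\<close> or \<open>\<lambda>\<^sub>2\<close>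
  (\<open>euler_lagrange_frame\<close>).

  All tensors are compared at one point in the chart that \<open>chart_at\<close> selects there. That their definitions
  by extensions of vectors are tensorial rests on the symmetry of second derivatives, through the fact that
  the Lie bracket of vector fields is a vector field (\<open>second_derivative_symmetric\<close>, \<open>lie_bracket_tangent\<close>).
\<close>

section \<open>Calculus of smooth maps\<close>

abbreviation fderiv :: "('a::real_normed_vector \<Rightarrow> 'b::real_normed_vector) \<Rightarrow> 'a \<Rightarrow> 'a \<Rightarrow> 'b" where
  "fderiv f x \<equiv> frechet_derivative f (at x)"

lemma frechet_eqI: "(f has_derivative f') (at x) \<Longrightarrow> fderiv f x v = f' v"
  by (metis frechet_derivative_at)

lemma Ck_on_subset: "Ck_on k S f \<Longrightarrow> T \<subseteq> S \<Longrightarrow> Ck_on k T f"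
  by (induction k arbitrary: f) (auto intro: continuous_on_subset)

lemma Ck_on_cong:
  assumes "open S" "\<And>x. x \<in> S \<Longrightarrow> f x = g x" "Ck_on k S f"
  shows "Ck_on k S g"
  using assms(2,3)
proof (induction k arbitrary: f g)
  case 0
  then show ?case by (simp cong: continuous_on_cong)
next
  case (Suc k)
  have d: "f differentiable at x" if "x \<in> S" for x
    using Suc.prems that by simp
  have dg: "g differentiable at x" if "x \<in> S" for x
    using d[OF that] Suc.prems(1) \<open>open S\<close> that
    by (meson differentiable_def has_derivative_transform_within_open)
  have "fderiv f x v = fderiv g x v" if "x \<in> S" for x v
    using frechet_derivative_transform_within_open[OF d[OF that] \<open>open S\<close> that, of g] Suc.prems(1)
    by metis
  then have "Ck_on k S (\<lambda>x. fderiv g x v)" for v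
    using Suc.IH[of "\<lambda>x. fderiv f x v" "\<lambda>x. fderiv g x v"]
      Suc.prems(2) by simp
  then show ?case using dg by simp
qed

lemma Ck_on_locally:
  assumes "\<And>x. x \<in> S \<Longrightarrow> \<exists>T. open T \<and> x \<in> T \<and> Ck_on k T f"
  shows "Ck_on k S f"
  using assms
proof (induction k arbitrary: f)
  case 0
  then show ?case
    by (metis Ck_on.simps(1) continuous_at_imp_continuous_on continuous_on_eq_continuous_at)
next
  case (Suc k)
  have "\<forall>x\<in>S. f differentiable at x" using Suc.prems by fastforce
  moreover have "Ck_on k S (\<lambda>x. fderiv f x v)" for v
    by (rule Suc.IH) (use Suc.prems in fastforce)
  ultimately show ?case by simp
qed

lemma Ck_on_SucD: "Ck_on (Suc k) S f \<Longrightarrow> Ck_on k S f"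
proof (induction k arbitrary: f)
  case 0
  then show ?case
    by (auto intro!: continuous_at_imp_continuous_on differentiable_imp_continuous_within)
next
  case (Suc k)
  then show ?case by (metis Ck_on.simps(2))
qed

lemma Ck_on_const: "Ck_on k S (\<lambda>x. c)"
  by (induction k arbitrary: c) auto

lemma Ck_on_bounded_linear:
  assumes "bounded_linear f" shows "Ck_on k S f"
proof (cases k)
  case 0
  then show ?thesis using assms by (simp add: linear_continuous_on)
next
  case (Suc n)
  have "(\<lambda>x. fderiv f x v) = (\<lambda>x. f v)" for v
    using frechet_eqI[OF bounded_linear_imp_has_derivative[OF assms]] by fast
  then show ?thesis
    using Suc assms bounded_linear_imp_differentiable[OF assms] by (simp add: Ck_on_const)
qed

lemma Ck_on_linear_image:
  assumes "open S" "bounded_linear L" "Ck_on k S f"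
  shows "Ck_on k S (\<lambda>x. L (f x))"
  using assms(3)
proof (induction k arbitrary: f)
  case 0
  then show ?case using bounded_linear.continuous_on[OF assms(2)] by simp
next
  case (Suc k)
  have d: "((\<lambda>x. L (f x)) has_derivative (\<lambda>v. L (fderiv f x v))) (at x)" if "x \<in> S" for x
    using Suc.prems that
    by (intro bounded_linear.has_derivative[OF assms(2)] frechet_derivative_works[THEN iffD1]) auto
  have "Ck_on k S (\<lambda>x. fderiv (\<lambda>x. L (f x)) x v)" for v
    by (rule Ck_on_cong[OF assms(1) _ Suc.IH[of "\<lambda>x. fderiv f x v"]])
      (use Suc.prems frechet_eqI[OF d] in auto)
  then show ?case using d by (auto simp: differentiable_def)
qed

lemma Ck_on_add:
  assumes "open S" "Ck_on k S f" "Ck_on k S g"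
  shows "Ck_on k S (\<lambda>x. f x + g x)"
  using assms(2,3)
proof (induction k arbitrary: f g)
  case 0
  then show ?case by (auto intro: continuous_intros)
next
  case (Suc k)
  have d: "((\<lambda>x. f x + g x) has_derivative (\<lambda>v. fderiv f x v + fderiv g x v)) (at x)" if "x \<in> S" for x
    using Suc.prems that
    by (intro has_derivative_add frechet_derivative_works[THEN iffD1]) auto
  have "Ck_on k S (\<lambda>x. fderiv (\<lambda>x. f x + g x) x v)" for v
    by (rule Ck_on_cong[OF assms(1) _ Suc.IH[of "\<lambda>x. fderiv f x v" "\<lambda>x. fderiv g x v"]])
      (use Suc.prems frechet_eqI[OF d] in auto)
  then show ?case using d by (auto simp: differentiable_def)
qed

lemma Ck_on_bilinear:
  assumes "open S" "bounded_bilinear B" "Ck_on k S f" "Ck_on k S g"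
  shows "Ck_on k S (\<lambda>x. B (f x) (g x))"
  using assms(3,4)
proof (induction k arbitrary: f g)
  case 0
  then show ?case using bounded_bilinear.continuous_on[OF assms(2)] by simp
next
  case (Suc k)
  let ?D = "\<lambda>f x v. fderiv f x v"
  have d: "((\<lambda>x. B (f x) (g x)) has_derivative (\<lambda>v. B (f x) (?D g x v) + B (?D f x v) (g x))) (at x)" if "x \<in> S" for x
    using Suc.prems that
    by (intro bounded_bilinear.FDERIV[OF assms(2)] frechet_derivative_works[THEN iffD1]) auto
  have "Ck_on k S (\<lambda>x. B (f x) (?D g x v) + B (?D f x v) (g x))" for v
    using Suc.prems Ck_on_SucD[of k S f] Ck_on_SucD[of k S g]
    by (intro Ck_on_add[OF assms(1)] Suc.IH) auto
  then have "Ck_on k S (\<lambda>x. fderiv (\<lambda>x. B (f x) (g x)) x v)" for v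
    by (rule Ck_on_cong[OF assms(1), rotated]) (use frechet_eqI[OF d] in auto)
  then show ?case using d by (auto simp: differentiable_def)
qed

lemma Ck_on_sum:
  assumes "open S" "\<And>i. i \<in> I \<Longrightarrow> Ck_on k S (f i)"
  shows "Ck_on k S (\<lambda>x. \<Sum>i\<in>I. f i x)"
  using assms(2) by (induction I rule: infinite_finite_induct) (auto intro: Ck_on_const Ck_on_add assms(1))

lemma linear_Basis_expand:
  fixes f :: "'a::euclidean_space \<Rightarrow> 'b::real_vector"
  assumes "linear f" shows "f v = (\<Sum>b\<in>Basis. (v \<bullet> b) *\<^sub>R f b)"
  using linear_sum[OF assms, of "\<lambda>b. (v \<bullet> b) *\<^sub>R b" Basis]
  by (simp add: euclidean_representation linear_scale[OF assms])

text \<open>The chain rule in coordinates, \<open>D(g \<circ> f) v = \<Sum>\<^sub>b (Df v \<bullet> b) D\<^sub>b g\<close>, expresses the derivative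
  of a composition by products of compositions of lower order, which is what an induction on \<open>k\<close>
  needs.\<close>

lemma Ck_on_compose:
  fixes g :: "'b::euclidean_space \<Rightarrow> 'c::real_normed_vector"
  assumes "open S" "f ` S \<subseteq> T" "Ck_on k S f" "Ck_on k T g"
  shows "Ck_on k S (\<lambda>x. g (f x))"
  using assms(3,4)
proof (induction k arbitrary: g)
  case 0
  then show ?case using assms(2) by (auto intro: continuous_on_compose2)
next
  case (Suc k)
  let ?D = "\<lambda>f x v. fderiv f x v"
  have lin: "linear (?D g (f x))" if "x \<in> S" for x
    using Suc.prems that assms(2) by (intro linear_frechet_derivative) auto
  have d: "((\<lambda>x. g (f x)) has_derivative (\<lambda>v. ?D g (f x) (?D f x v))) (at x)" if "x \<in> S" for x
    using has_derivative_compose[of f "fderiv f x" x UNIV g]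
      Suc.prems that assms(2) by (simp add: frechet_derivative_works image_subset_iff)
  have "Ck_on k S (\<lambda>x. \<Sum>b\<in>Basis. (?D f x v \<bullet> b) *\<^sub>R ?D g (f x) b)" for v
  proof (intro Ck_on_sum Ck_on_bilinear[OF _ bounded_bilinear_scaleR] assms(1))
    fix b :: 'b
    show "Ck_on k S (\<lambda>x. ?D f x v \<bullet> b)"
      using Suc.prems by (intro Ck_on_linear_image[OF assms(1) bounded_linear_inner_left]) simp
    show "Ck_on k S (\<lambda>x. ?D g (f x) b)"
      using Suc.prems Ck_on_SucD[of k S f] by (intro Suc.IH) auto
  qed
  then have "Ck_on k S (\<lambda>x. fderiv (\<lambda>x. g (f x)) x v)" for v
    by (rule Ck_on_cong[OF assms(1), rotated])
      (use frechet_eqI[OF d] linear_Basis_expand[OF lin] in auto)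
  then show ?case using d by (auto simp: differentiable_def)
qed

lemma smooth_on_subset: "smooth_on S f \<Longrightarrow> T \<subseteq> S \<Longrightarrow> smooth_on T f"
  by (meson Ck_on_subset smooth_on_def)

lemma smooth_on_cong: "open S \<Longrightarrow> (\<And>x. x \<in> S \<Longrightarrow> f x = g x) \<Longrightarrow> smooth_on S f \<Longrightarrow> smooth_on S g"
  unfolding smooth_on_def by (meson Ck_on_cong)

lemma smooth_on_locally:
  "(\<And>x. x \<in> S \<Longrightarrow> \<exists>T. open T \<and> x \<in> T \<and> smooth_on T f) \<Longrightarrow> smooth_on S f"
  unfolding smooth_on_def by (meson Ck_on_locally)

lemma smooth_on_const: "smooth_on S (\<lambda>x. c)"
  by (simp add: smooth_on_def Ck_on_const)

lemma smooth_on_bounded_linear: "bounded_linear f \<Longrightarrow> smooth_on S f"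
  by (simp add: smooth_on_def Ck_on_bounded_linear)

lemma smooth_on_linear_image: "open S \<Longrightarrow> bounded_linear L \<Longrightarrow> smooth_on S f \<Longrightarrow> smooth_on S (\<lambda>x. L (f x))"
  by (simp add: smooth_on_def Ck_on_linear_image)

lemma smooth_on_add: "open S \<Longrightarrow> smooth_on S f \<Longrightarrow> smooth_on S g \<Longrightarrow> smooth_on S (\<lambda>x. f x + g x)"
  by (simp add: smooth_on_def Ck_on_add)

lemma smooth_on_bilinear:
  "open S \<Longrightarrow> bounded_bilinear B \<Longrightarrow> smooth_on S f \<Longrightarrow> smooth_on S g \<Longrightarrow> smooth_on S (\<lambda>x. B (f x) (g x))"
  by (simp add: smooth_on_def Ck_on_bilinear)

lemmas smooth_on_scaleR = smooth_on_bilinear[OF _ bounded_bilinear_scaleR]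
lemmas smooth_on_mult = smooth_on_bilinear[OF _ bounded_bilinear_mult]

lemma smooth_on_minus: "open S \<Longrightarrow> smooth_on S f \<Longrightarrow> smooth_on S g \<Longrightarrow>
    smooth_on S (\<lambda>x. f x - g x)"
  using smooth_on_add[of S f "\<lambda>x. - g x"]
    smooth_on_linear_image[OF _ bounded_linear_minus[OF bounded_linear_ident], of S g] by simp

lemma smooth_on_inner: "open S \<Longrightarrow> smooth_on S f \<Longrightarrow> smooth_on S (\<lambda>x. f x \<bullet> b)"
  by (rule smooth_on_linear_image[OF _ bounded_linear_inner_left])

lemma smooth_on_sum: "open S \<Longrightarrow> (\<And>i. i \<in> I \<Longrightarrow> smooth_on S (f i)) \<Longrightarrow> smooth_on S (\<lambda>x. \<Sum>i\<in>I. f i x)"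
  by (simp add: smooth_on_def Ck_on_sum)

lemma smooth_on_compose:
  fixes g :: "'b::euclidean_space \<Rightarrow> 'c::real_normed_vector"
  shows "open S \<Longrightarrow> f ` S \<subseteq> T \<Longrightarrow> smooth_on S f \<Longrightarrow> smooth_on T g \<Longrightarrow> smooth_on S (\<lambda>x. g (f x))"
  unfolding smooth_on_def using Ck_on_compose[of S f T _ g] by blast

lemma smooth_on_differentiable: "smooth_on S f \<Longrightarrow> x \<in> S \<Longrightarrow> f differentiable at x"
  unfolding smooth_on_def by (metis Ck_on.simps(2))

lemma smooth_on_has_derivative:
  "smooth_on S f \<Longrightarrow> x \<in> S \<Longrightarrow> (f has_derivative fderiv f x) (at x)"
  using smooth_on_differentiable frechet_derivative_works by blast

lemma smooth_on_continuous: "smooth_on S f \<Longrightarrow> continuous_on S f"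
  unfolding smooth_on_def by (metis Ck_on.simps(1))

lemma smooth_on_frechet: "smooth_on S f \<Longrightarrow> smooth_on S (\<lambda>x. fderiv f x v)"
  unfolding smooth_on_def by (metis Ck_on.simps(2))

subsection \<open>Symmetry of second derivatives\<close>

text \<open>Write \<open>f (x + s u + t v) = f (x + s u) + \<integral>\<^sub>0\<^sup>t D\<^sub>v f (x + s u + \<tau> v) d\<tau>\<close>. Differentiating
  under the integral in \<open>s\<close> at \<open>0\<close>, and then in \<open>t\<close> at \<open>0\<close>, gives \<open>D\<^sub>v D\<^sub>u f = D\<^sub>u D\<^sub>v f\<close>.\<close>

lemma second_derivative_symmetric:
  fixes f :: "'a::real_normed_vector \<Rightarrow> 'b::banach"
  assumes S: "open S" "x \<in> S" and f: "smooth_on S f"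
  shows "fderiv (\<lambda>y. fderiv f y u) x v
       = fderiv (\<lambda>y. fderiv f y v) x u"
proof -
  let ?D = "\<lambda>u y. fderiv f y u"
  let ?DD = "\<lambda>u v y. fderiv (?D u) y v"
  let ?p = "\<lambda>s t::real. x + s *\<^sub>R u + t *\<^sub>R v"
  have fD: "smooth_on S (?D w)" for w by (rule smooth_on_frechet[OF f])
  obtain r where r: "r > 0" "ball x r \<subseteq> S" using S openE by blast
  \<comment> \<open>Then \<open>x + s u + t v\<close> stays in the ball around \<open>x\<close> for all \<open>s\<close> and \<open>t\<close> of absolute value at most \<open>\<delta>\<close>.\<close>
  define \<delta> where "\<delta> = r / (2 * (norm u + norm v + 1))"
  have \<delta>: "\<delta> > 0" using r unfolding \<delta>_def by (intro divide_pos_pos) (auto simp: add_nonneg_pos)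
  have pS: "?p s t \<in> S" if "\<bar>s\<bar> \<le> \<delta>" "\<bar>t\<bar> \<le> \<delta>" for s t
  proof -
    have "norm (s *\<^sub>R u + t *\<^sub>R v) \<le> \<bar>s\<bar> * norm u + \<bar>t\<bar> * norm v"
      by (metis norm_scaleR norm_triangle_ineq)
    also have "\<dots> \<le> \<delta> * norm u + \<delta> * norm v"
      using that by (intro add_mono mult_right_mono) auto
    also have "\<dots> < 2 * \<delta> * (norm u + norm v + 1)"
      using \<delta> by (simp add: algebra_simps) (smt (verit) mult_nonneg_nonneg norm_ge_zero)
    also have "\<dots> = r" unfolding \<delta>_def
      using norm_ge_zero[of u] norm_ge_zero[of v] by (simp add: field_simps add_nonneg_eq_0_iff)
    finally have "norm (s *\<^sub>R u + t *\<^sub>R v) < r" .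
    moreover have "x - ?p s t = - (s *\<^sub>R u + t *\<^sub>R v)" by simp
    ultimately have "?p s t \<in> ball x r" by (simp only: mem_ball dist_norm norm_minus_cancel)
    then show ?thesis using r by blast
  qed
  have along_t: "((\<lambda>t. h (?p s t)) has_vector_derivative fderiv h (?p s t) v) (at t within X)"
    if "smooth_on S h" "\<bar>s\<bar> \<le> \<delta>" "\<bar>t\<bar> \<le> \<delta>" for h :: "'a \<Rightarrow> 'b" and s t X
  proof -
    have "((\<lambda>t. ?p s t) has_derivative (\<lambda>t. t *\<^sub>R v)) (at t within X)"
      by (auto intro!: derivative_eq_intros)
    from has_derivative_compose[OF this smooth_on_has_derivative[OF that(1) pS[OF that(2,3)]]]
    show ?thesis unfolding has_vector_derivative_def
      using linear_frechet_derivative[OF smooth_on_differentiable[OF that(1) pS[OF that(2,3)]]]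
      by (simp add: linear_scale)
  qed
  have along_s: "((\<lambda>s. h (?p s t)) has_vector_derivative fderiv h (?p s t) u) (at s within X)"
    if "smooth_on S h" "\<bar>s\<bar> \<le> \<delta>" "\<bar>t\<bar> \<le> \<delta>" for h :: "'a \<Rightarrow> 'b" and s t X
  proof -
    have "((\<lambda>s. ?p s t) has_derivative (\<lambda>s. s *\<^sub>R u)) (at s within X)"
      by (auto intro!: derivative_eq_intros)
    from has_derivative_compose[OF this smooth_on_has_derivative[OF that(1) pS[OF that(2,3)]]]
    show ?thesis unfolding has_vector_derivative_def
      using linear_frechet_derivative[OF smooth_on_differentiable[OF that(1) pS[OF that(2,3)]]]
      by (simp add: linear_scale)
  qed
  have cont: "continuous_on X (\<lambda>z. h (?p (fst z) (snd z)))"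
    if "smooth_on S h" "X \<subseteq> {-\<delta>..\<delta>} \<times> {-\<delta>..\<delta>}" for h :: "'a \<Rightarrow> 'b" and X
  proof (rule continuous_on_compose2[OF smooth_on_continuous[OF that(1)]])
    show "continuous_on X (\<lambda>z. ?p (fst z) (snd z))" by (intro continuous_intros)
    have "\<bar>fst z\<bar> \<le> \<delta> \<and> \<bar>snd z\<bar> \<le> \<delta>" if "z \<in> X" for z
      using subsetD[OF \<open>X \<subseteq> _\<close> that] by (cases z) (simp add: abs_le_iff)
    then show "(\<lambda>z. ?p (fst z) (snd z)) ` X \<subseteq> S" using pS by blast
  qed
  have cont1: "continuous_on X (\<lambda>t. h (?p s t))"
    if "smooth_on S h" "X \<subseteq> {-\<delta>..\<delta>}" "\<bar>s\<bar> \<le> \<delta>" for h :: "'a \<Rightarrow> 'b" and X s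
  proof (rule continuous_on_compose2[OF smooth_on_continuous[OF that(1)]])
    show "continuous_on X (\<lambda>t. ?p s t)" by (intro continuous_intros)
    have "\<bar>t\<bar> \<le> \<delta>" if "t \<in> X" for t
      using subsetD[OF \<open>X \<subseteq> _\<close> that] by (simp add: abs_le_iff)
    then show "(\<lambda>t. ?p s t) ` X \<subseteq> S" using pS \<open>\<bar>s\<bar> \<le> \<delta>\<close> by blast
  qed
  have ftc: "((\<lambda>\<tau>. ?D v (?p s \<tau>)) has_integral f (?p s t) - f (?p s 0)) {0..t}"
    if "\<bar>s\<bar> \<le> \<delta>" "0 \<le> t" "t \<le> \<delta>" for s t
    using that by (intro fundamental_theorem_of_calculus along_t f) auto
  have id: "?D u (?p 0 t) - ?D u x = integral {0..t} (\<lambda>\<tau>. ?DD v u (?p 0 \<tau>))" if "0 \<le> t" "t \<le> \<delta>" for t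
  proof -
    let ?U = "{-\<delta><..<\<delta>}"
    have "((\<lambda>s. integral (cbox 0 t) (\<lambda>\<tau>. ?D v (?p s \<tau>))) has_vector_derivative
        integral (cbox 0 t) (\<lambda>\<tau>. ?DD v u (?p 0 \<tau>))) (at 0 within ?U)"
    proof (rule leibniz_rule_vector_derivative)
      show "((\<lambda>s. ?D v (?p s \<tau>)) has_vector_derivative ?DD v u (?p s \<tau>)) (at s within ?U)"
        if "s \<in> ?U" "\<tau> \<in> cbox 0 t" for s \<tau>
        using that \<open>t \<le> \<delta>\<close> by (intro along_s fD) auto
      show "(\<lambda>\<tau>. ?D v (?p s \<tau>)) integrable_on cbox 0 t" if "s \<in> ?U" for s
        using that \<open>t \<le> \<delta>\<close> \<delta> by (intro integrable_continuous cont1 fD) auto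
      show "continuous_on (?U \<times> cbox 0 t) (\<lambda>(s, \<tau>). ?DD v u (?p s \<tau>))"
        unfolding split_beta using \<open>t \<le> \<delta>\<close> \<delta>
        by (intro cont smooth_on_frechet[OF fD]) auto
    qed (use \<delta> in auto)
    moreover have "f (?p s t) - f (?p s 0) = integral {0..t} (\<lambda>\<tau>. ?D v (?p s \<tau>))" if "s \<in> ?U" for s
      using integral_unique[OF ftc, of s t] \<open>0 \<le> t\<close> \<open>t \<le> \<delta>\<close> that by (simp add: abs_le_iff)
    ultimately have 1: "((\<lambda>s. f (?p s t) - f (?p s 0)) has_vector_derivative
        integral {0..t} (\<lambda>\<tau>. ?DD v u (?p 0 \<tau>))) (at 0 within ?U)"
      using has_vector_derivative_transform[of 0 ?U "\<lambda>s. f (?p s t) - f (?p s 0)"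
          "\<lambda>s. integral {0..t} (\<lambda>\<tau>. ?D v (?p s \<tau>))"] \<delta> by simp
    have 2: "((\<lambda>s. f (?p s t) - f (?p s 0)) has_vector_derivative ?D u (?p 0 t) - ?D u (?p 0 0))
        (at 0 within ?U)"
      using \<delta> that by (intro has_vector_derivative_diff along_s f) auto
    have "at 0 within ?U = at (0::real)" using \<delta> by (intro at_within_open) auto
    then show ?thesis using vector_derivative_unique_at[OF 2[unfolded \<open>at 0 within ?U = at 0\<close>]
          1[unfolded \<open>at 0 within ?U = at 0\<close>]] by simp
  qed
  have 1: "((\<lambda>t. integral {0..t} (\<lambda>\<tau>. ?DD v u (?p 0 \<tau>))) has_vector_derivative ?DD v u (?p 0 0)) (at 0 within {0..\<delta>})"
    using \<delta> by (intro integral_has_vector_derivative cont1 smooth_on_frechet[OF fD]) auto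
  have 2: "((\<lambda>t. ?D u (?p 0 t) - ?D u x) has_vector_derivative ?DD u v (?p 0 0)) (at 0 within {0..\<delta>})"
    using has_vector_derivative_diff[OF along_t[OF fD, of 0 0] has_vector_derivative_const] \<delta> by simp
  have "((\<lambda>t. ?D u (?p 0 t) - ?D u x) has_vector_derivative ?DD v u (?p 0 0)) (at 0 within {0..\<delta>})"
    by (rule has_vector_derivative_transform[OF _ _ 1]) (use \<delta> id in auto)
  from vector_derivative_unique_within_closed_interval[OF \<delta> _ this[folded box_real(2)] 2[folded box_real(2)]]
  show ?thesis using \<delta> by simp
qed

text \<open>The product rule gives the derivative of \<open>Df(y) e\<close> in the direction \<open>v\<close> at \<open>e = X x\<close>; symmetry exchanges
  \<open>v\<close> and \<open>e\<close>. In this form the lemma yields the transformation rule for derivatives of components.\<close>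

lemma frechet_along_has_derivative:
  fixes f :: "'a::euclidean_space \<Rightarrow> 'b::banach"
  assumes S: "open S" "x \<in> S" and f: "smooth_on S f" and X: "(X has_derivative X') (at x)"
  shows "((\<lambda>y. fderiv f y (X y)) has_derivative
      (\<lambda>v. fderiv f x (X' v)
         + fderiv (\<lambda>y. fderiv f y v) x (X x))) (at x)"
proof -
  let ?D = "\<lambda>b y. fderiv f y b"
  let ?DD = "\<lambda>b v. fderiv (?D b) x v"
  have lin: "linear (fderiv f y)" if "y \<in> S" for y
    using smooth_on_differentiable[OF f that] by (rule linear_frechet_derivative)
  have linD: "linear (fderiv (?D b) x)" for b
    using smooth_on_differentiable[OF smooth_on_frechet[OF f] S(2)] by (rule linear_frechet_derivative)
  have "((\<lambda>y. \<Sum>b\<in>Basis. (X y \<bullet> b) *\<^sub>R ?D b y) has_derivative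
      (\<lambda>v. \<Sum>b\<in>Basis. (X x \<bullet> b) *\<^sub>R ?DD b v + (X' v \<bullet> b) *\<^sub>R ?D b x)) (at x)"
    by (intro has_derivative_sum has_derivative_scaleR has_derivative_inner_left X
        smooth_on_has_derivative[OF smooth_on_frechet[OF f] S(2)])
  moreover have "(\<Sum>b\<in>Basis. (X x \<bullet> b) *\<^sub>R ?DD b v + (X' v \<bullet> b) *\<^sub>R ?D b x)
      = fderiv f x (X' v) + ?DD v (X x)" for v
  proof -
    have "(\<Sum>b\<in>Basis. (X x \<bullet> b) *\<^sub>R ?DD b v) = (\<Sum>b\<in>Basis. (X x \<bullet> b) *\<^sub>R ?DD v b)"
      by (simp add: second_derivative_symmetric[OF S f, of _ v])
    then show ?thesis
      using linear_Basis_expand[OF lin[OF S(2)], of "X' v"] linear_Basis_expand[OF linD, of v "X x"]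
      by (simp add: sum.distrib)
  qed
  ultimately have "((\<lambda>y. \<Sum>b\<in>Basis. (X y \<bullet> b) *\<^sub>R ?D b y) has_derivative
      (\<lambda>v. fderiv f x (X' v) + ?DD v (X x))) (at x)" by simp
  then show ?thesis
    by (rule has_derivative_transform_within_open[OF _ S])
      (simp add: linear_Basis_expand[OF lin, symmetric])
qed

subsection \<open>Linear and bilinear forms depending on a parameter\<close>

text \<open>Metrics and forms in a chart are families of (bi)linear forms whose coefficients are smooth in the base
  point. The rules for their values on variable vectors follow by expansion in the basis.\<close>

lemma frechet_linear_combination:
  assumes "\<And>b. b \<in> I \<Longrightarrow> f b differentiable at x"
  shows "fderiv (\<lambda>y. \<Sum>b\<in>I. r b * f b y) x d
       = (\<Sum>b\<in>I. r b * fderiv (f b) x d :: real)"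
  by (rule frechet_eqI) (intro has_derivative_sum has_derivative_mult_right
      frechet_derivative_works[THEN iffD1] assms)

lemma form_expand:
  fixes a :: "'e::euclidean_space \<Rightarrow> real"
  assumes "linear a" shows "a e = (\<Sum>b\<in>Basis. (e \<bullet> b) * a b)"
  using linear_Basis_expand[OF assms, of e] by simp

lemma frechet_form_expand:
  fixes a :: "'a::real_normed_vector \<Rightarrow> 'e::euclidean_space \<Rightarrow> real"
  assumes "\<And>x. linear (a x)" "\<And>b. (\<lambda>y. a y b) differentiable at x"
  shows "fderiv (\<lambda>y. a y e) x d
       = (\<Sum>b\<in>Basis. (e \<bullet> b) * fderiv (\<lambda>y. a y b) x d)"
  using frechet_linear_combination[of Basis "\<lambda>b y. a y b" x "\<lambda>b. e \<bullet> b" d] assms(2)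
  by (simp add: form_expand[OF assms(1), symmetric])

lemma form_along_has_derivative:
  fixes a :: "'a::real_normed_vector \<Rightarrow> 'e::euclidean_space \<Rightarrow> real"
  assumes lin: "\<And>x. linear (a x)" and d: "\<And>b. (\<lambda>y. a y b) differentiable at (h z)"
    and h: "(h has_derivative h') (at z within Z)" and X: "(X has_derivative X') (at z within Z)"
  shows "((\<lambda>z. a (h z) (X z)) has_derivative
      (\<lambda>v. fderiv (\<lambda>y. a y (X z)) (h z) (h' v) + a (h z) (X' v))) (at z within Z)"
proof -
  have "((\<lambda>z. a (h z) b) has_derivative (\<lambda>v. fderiv (\<lambda>y. a y b) (h z) (h' v))) (at z within Z)" for b
    using has_derivative_compose[OF h frechet_derivative_works[THEN iffD1, OF d[of b]]] .
  then have "((\<lambda>z. \<Sum>b\<in>Basis. (X z \<bullet> b) * a (h z) b) has_derivative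
    (\<lambda>v. \<Sum>b\<in>Basis. (X z \<bullet> b) * fderiv (\<lambda>y. a y b) (h z) (h' v) + (X' v \<bullet> b) * a (h z) b))
    (at z within Z)"
    by (intro has_derivative_sum has_derivative_mult has_derivative_inner_left X)
  then show ?thesis
    by (simp add: sum.distrib form_expand[OF lin, symmetric] frechet_form_expand[OF lin d, symmetric])
qed

lemma bilin_along_has_derivative:
  fixes B :: "'a::real_normed_vector \<Rightarrow> 'e::euclidean_space \<Rightarrow> 'e \<Rightarrow> real"
  assumes lin: "\<And>x e. linear (B x e)" "\<And>x e. linear (\<lambda>e'. B x e' e)"
    and d: "\<And>b b'. (\<lambda>y. B y b b') differentiable at (h z)"
    and h: "(h has_derivative h') (at z within Z)" and X: "(X has_derivative X') (at z within Z)"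
    and Y: "(Y has_derivative Y') (at z within Z)"
  shows "((\<lambda>z. B (h z) (X z) (Y z)) has_derivative
      (\<lambda>v. fderiv (\<lambda>y. B y (X z) (Y z)) (h z) (h' v)
          + B (h z) (X' v) (Y z) + B (h z) (X z) (Y' v))) (at z within Z)"
proof -
  have "((\<lambda>z. \<Sum>b\<in>Basis. (X z \<bullet> b) * B (h z) b (Y z)) has_derivative
    (\<lambda>v. \<Sum>b\<in>Basis. (X z \<bullet> b) * (fderiv (\<lambda>y. B y b (Y z)) (h z) (h' v) + B (h z) b (Y' v))
      + (X' v \<bullet> b) * B (h z) b (Y z))) (at z within Z)"
    by (intro has_derivative_sum has_derivative_mult has_derivative_inner_left X
        form_along_has_derivative[OF lin(1) d h Y])
  moreover have "(\<Sum>b\<in>Basis. (X z \<bullet> b) * (fderiv (\<lambda>y. B y b (Y z)) (h z) (h' v) + B (h z) b (Y' v))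
      + (X' v \<bullet> b) * B (h z) b (Y z))
    = fderiv (\<lambda>y. B y (X z) (Y z)) (h z) (h' v)
          + B (h z) (X' v) (Y z) + B (h z) (X z) (Y' v)" for v
    using frechet_form_expand[of "\<lambda>y e. B y e (Y z)" "h z" "X z" "h' v", OF lin(2) d]
      form_expand[OF lin(2), of "h z" "X z" "Y' v"] form_expand[OF lin(2), of "h z" "X' v" "Y z"]
    by (simp add: sum.distrib distrib_left)
  moreover have "(\<lambda>z. B (h z) (X z) (Y z)) = (\<lambda>z. \<Sum>b\<in>Basis. (X z \<bullet> b) * B (h z) b (Y z))"
    by (rule ext, rule form_expand[OF lin(2)])
  ultimately show ?thesis by (simp only:)
qed

lemma smooth_on_form_along:
  fixes a :: "'a::euclidean_space \<Rightarrow> 'e::euclidean_space \<Rightarrow> real"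
  assumes lin: "\<And>x. linear (a x)" and a: "\<And>b. smooth_on S (\<lambda>y. a y b)"
    and T: "open T" "h ` T \<subseteq> S" and h: "smooth_on T h" and X: "smooth_on T X"
  shows "smooth_on T (\<lambda>z. a (h z) (X z))"
proof -
  have "smooth_on T (\<lambda>z. \<Sum>b\<in>Basis. (X z \<bullet> b) * a (h z) b)"
    using smooth_on_compose[OF T h a] by (intro smooth_on_sum smooth_on_mult smooth_on_inner X T(1))
  then show ?thesis by (simp flip: form_expand[OF lin])
qed

lemma smooth_on_bilin_along:
  fixes B :: "'a::euclidean_space \<Rightarrow> 'e::euclidean_space \<Rightarrow> 'e \<Rightarrow> real"
  assumes lin: "\<And>x e. linear (B x e)" "\<And>x e. linear (\<lambda>e'. B x e' e)"
    and B: "\<And>b b'. smooth_on S (\<lambda>y. B y b b')"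
    and T: "open T" "h ` T \<subseteq> S" and h: "smooth_on T h" and X: "smooth_on T X" and Y: "smooth_on T Y"
  shows "smooth_on T (\<lambda>z. B (h z) (X z) (Y z))"
proof -
  have "smooth_on T (\<lambda>z. \<Sum>b\<in>Basis. (X z \<bullet> b) * B (h z) b (Y z))"
    using smooth_on_form_along[OF lin(1) B T h Y]
    by (intro smooth_on_sum smooth_on_mult smooth_on_inner X T(1))
  moreover have "(\<lambda>z. B (h z) (X z) (Y z)) = (\<lambda>z. \<Sum>b\<in>Basis. (X z \<bullet> b) * B (h z) b (Y z))"
    by (rule ext, rule form_expand[OF lin(2)])
  ultimately show ?thesis by (simp only:)
qed

subsection \<open>A smooth bump function\<close>

text \<open>The factor \<open>inverse x ^ n\<close> makes the family closed under differentiation, so that one induction on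
  the order of differentiability covers all of its members.\<close>

definition flat :: "nat \<Rightarrow> real \<Rightarrow> real" where
  "flat n x = (if x > 0 then inverse x ^ n * exp (- inverse x) else 0)"

lemma flat_tendsto_0: "((\<lambda>x. flat n x) \<longlongrightarrow> 0) (at_right 0)"
proof -
  have "((\<lambda>x. inverse x ^ n / exp (inverse x)) \<longlongrightarrow> 0) (at_right (0::real))"
    by (rule filterlim_compose[OF tendsto_power_div_exp_0 filterlim_inverse_at_top_right])
  moreover have "\<forall>\<^sub>F x in at_right 0. inverse x ^ n / exp (inverse x) = flat n x"
    by (auto simp: flat_def exp_minus field_simps eventually_at_right_less
        intro!: eventually_mono[OF eventually_at_right_less])
  ultimately show ?thesis by (rule Lim_transform_eventually)
qed

lemma flat_has_derivative:
  "(flat n has_real_derivative flat (n + 2) x - real n * flat (n + 1) x) (at x)"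
proof (cases x "0::real" rule: linorder_cases)
  case less
  have "((\<lambda>x. 0) has_real_derivative 0) (at x)" by simp
  then show ?thesis
    by (rule DERIV_cong[OF has_field_derivative_transform_within_open[of _ _ _ "{..<0}"]])
      (use less in \<open>auto simp: flat_def\<close>)
next
  case greater
  have inv: "(inverse has_real_derivative - (inverse x ^ 2)) (at x)"
    using DERIV_inverse[of x] greater by (simp add: numeral_2_eq_2)
  have "((\<lambda>x. inverse x ^ n * exp (- inverse x)) has_real_derivative
      real n * (- (inverse x ^ 2) * inverse x ^ (n - Suc 0)) * exp (- inverse x)
      + exp (- inverse x) * (inverse x ^ 2) * inverse x ^ n) (at x)"
    using DERIV_mult[OF DERIV_power[OF inv, of n] DERIV_chain2[OF DERIV_exp DERIV_minus[OF inv]]]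
    by simp
  also have "real n * (- (inverse x ^ 2) * inverse x ^ (n - Suc 0)) * exp (- inverse x)
      + exp (- inverse x) * (inverse x ^ 2) * inverse x ^ n = flat (n + 2) x - real n * flat (n + 1) x"
    using greater by (cases n) (auto simp: flat_def algebra_simps power2_eq_square simp del: power_inverse)
  finally have "((\<lambda>x. inverse x ^ n * exp (- inverse x)) has_real_derivative
      flat (n + 2) x - real n * flat (n + 1) x) (at x)" .
  then show ?thesis
    by (rule has_field_derivative_transform_within_open[of _ _ _ "{0<..}"])
      (use greater in \<open>auto simp: flat_def\<close>)
next
  case equal
  have "((\<lambda>h. (flat n (0 + h) - flat n 0) / h) \<longlongrightarrow> 0) (at 0)"
  proof (rule filterlim_split_at)
    show "((\<lambda>h. (flat n (0 + h) - flat n 0) / h) \<longlongrightarrow> 0) (at_left 0)"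
      by (rule tendsto_eventually) (auto simp: flat_def eventually_at_left_field intro!: exI[of _ "-1"])
    show "((\<lambda>h. (flat n (0 + h) - flat n 0) / h) \<longlongrightarrow> 0) (at_right 0)"
      by (rule Lim_transform_eventually[OF flat_tendsto_0[of "n + 1"]])
        (auto simp: flat_def field_simps intro!: eventually_mono[OF eventually_at_right_less])
  qed
  then show ?thesis using equal by (simp add: DERIV_def flat_def)
qed

lemma smooth_on_flat: "smooth_on UNIV (flat n)"
proof -
  have "Ck_on k UNIV (flat n)" for k
  proof (induction k arbitrary: n)
    case 0
    then show ?case
      using flat_has_derivative by (auto intro!: continuous_at_imp_continuous_on DERIV_isCont)
  next
    case (Suc k)
    have d: "(flat n has_derivative (\<lambda>v. (flat (n + 2) x + (- real n) * flat (n + 1) x) * v)) (at x)" for x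
      using flat_has_derivative[of n x] by (simp add: has_field_derivative_def)
    have "Ck_on k UNIV (\<lambda>x. (flat (n + 2) x + (- real n) * flat (n + 1) x) * v)" for v
      by (intro Ck_on_linear_image[OF open_UNIV bounded_linear_mult_left] Ck_on_add open_UNIV Suc.IH
          Ck_on_linear_image[OF open_UNIV bounded_linear_mult_right])
    then show ?case using d by (auto simp: frechet_eqI[OF d] differentiable_def)
  qed
  then show ?thesis by (simp add: smooth_on_def)
qed

lemma smooth_bump_exists:
  fixes a b :: real
  obtains \<phi> :: "real \<Rightarrow> real" where "smooth_on UNIV \<phi>" "\<And>t. t \<in> {a<..<b} \<Longrightarrow> \<phi> t > 0"
    "\<And>t. t \<notin> {a<..<b} \<Longrightarrow> \<phi> t = 0" "\<And>t. 0 \<le> \<phi> t" "\<And>t. \<phi> t \<le> 1"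
proof
  let ?\<phi> = "\<lambda>t. flat 0 (t - a) * flat 0 (b - t)"
  have "smooth_on UNIV (\<lambda>t. t - a)" "smooth_on UNIV (\<lambda>t. b - t)"
    by (intro smooth_on_minus smooth_on_const smooth_on_bounded_linear bounded_linear_ident open_UNIV)+
  then show "smooth_on UNIV ?\<phi>"
    by (intro smooth_on_mult smooth_on_compose[OF open_UNIV subset_UNIV _ smooth_on_flat] open_UNIV)
  show "?\<phi> t > 0" if "t \<in> {a<..<b}" for t using that by (simp add: flat_def)
  show "?\<phi> t = 0" if "t \<notin> {a<..<b}" for t using that by (auto simp: flat_def)
  show "0 \<le> ?\<phi> t" for t by (simp add: flat_def)
  have "0 \<le> flat 0 x \<and> flat 0 x \<le> 1" for x by (simp add: flat_def)
  then show "?\<phi> t \<le> 1" for t by (intro mult_le_one) auto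
qed

section \<open>Charts and tangent spaces\<close>

locale smooth_manifold =
  fixes A :: "('m::{t2_space, second_countable_topology}, 'e::euclidean_space) chart set"
  assumes atlas: "smooth_atlas A"
begin

lemma chart_open: "\<kappa> \<in> A \<Longrightarrow> open (fst \<kappa>)"
  and chart_image_open: "\<kappa> \<in> A \<Longrightarrow> open (snd \<kappa> ` fst \<kappa>)"
  and chart_homeomorphism: "\<kappa> \<in> A \<Longrightarrow> homeomorphism (fst \<kappa>) (snd \<kappa> ` fst \<kappa>) (snd \<kappa>) (cinv \<kappa>)"
  using atlas by (auto simp: smooth_atlas_def)

lemma cinv_chart: "\<kappa> \<in> A \<Longrightarrow> p \<in> fst \<kappa> \<Longrightarrow> cinv \<kappa> (snd \<kappa> p) = p"
  using chart_homeomorphism by (meson homeomorphism_apply1)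

lemma chart_cinv: "\<kappa> \<in> A \<Longrightarrow> x \<in> snd \<kappa> ` fst \<kappa> \<Longrightarrow> snd \<kappa> (cinv \<kappa> x) = x"
  using chart_homeomorphism by (meson homeomorphism_apply2)

lemma cinv_in_chart: "\<kappa> \<in> A \<Longrightarrow> x \<in> snd \<kappa> ` fst \<kappa> \<Longrightarrow> cinv \<kappa> x \<in> fst \<kappa>"
  by (metis cinv_chart imageE)

lemma mem_chart_image:
  "\<kappa> \<in> A \<Longrightarrow> x \<in> snd \<kappa> ` (W \<inter> fst \<kappa>) \<longleftrightarrow> x \<in> snd \<kappa> ` fst \<kappa> \<and> cinv \<kappa> x \<in> W"
proof
  assume "\<kappa> \<in> A" "x \<in> snd \<kappa> ` (W \<inter> fst \<kappa>)"
  then show "x \<in> snd \<kappa> ` fst \<kappa> \<and> cinv \<kappa> x \<in> W" by (auto simp: cinv_chart[of \<kappa>])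
next
  assume \<kappa>: "\<kappa> \<in> A" and x: "x \<in> snd \<kappa> ` fst \<kappa> \<and> cinv \<kappa> x \<in> W"
  have "x = snd \<kappa> (cinv \<kappa> x)" "cinv \<kappa> x \<in> W \<inter> fst \<kappa>"
    using chart_cinv[OF \<kappa>, of x] cinv_in_chart[OF \<kappa>, of x] x by auto
  then show "x \<in> snd \<kappa> ` (W \<inter> fst \<kappa>)" by (rule image_eqI)
qed

lemma chart_image_Int_open:
  assumes "\<kappa> \<in> A" "open W" shows "open (snd \<kappa> ` (W \<inter> fst \<kappa>))"
proof -
  have "snd \<kappa> ` (W \<inter> fst \<kappa>) = snd \<kappa> ` fst \<kappa> \<inter> cinv \<kappa> -` W"
    using mem_chart_image[OF assms(1)] by blast
  moreover have "continuous_on (snd \<kappa> ` fst \<kappa>) (cinv \<kappa>)"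
    using chart_homeomorphism[OF assms(1)] by (simp add: homeomorphism_def)
  ultimately show ?thesis
    using continuous_open_preimage chart_image_open assms by metis
qed

lemma chart_at: "chart_at A p \<in> A" "p \<in> fst (chart_at A p)"
proof -
  have "\<exists>\<kappa>. \<kappa> \<in> A \<and> p \<in> fst \<kappa>" using atlas unfolding smooth_atlas_def by blast
  from someI_ex[OF this] show "chart_at A p \<in> A" "p \<in> fst (chart_at A p)"
    by (auto simp: chart_at_def)
qed

lemma transition_smooth:
  "\<kappa> \<in> A \<Longrightarrow> \<kappa>' \<in> A \<Longrightarrow> smooth_on (snd \<kappa> ` (fst \<kappa> \<inter> fst \<kappa>')) (snd \<kappa>' \<circ> cinv \<kappa>)"
  using atlas by (simp add: smooth_atlas_def)

lemma overlap_open: "\<kappa> \<in> A \<Longrightarrow> \<kappa>' \<in> A \<Longrightarrow> open (snd \<kappa> ` (fst \<kappa> \<inter> fst \<kappa>'))"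
  using chart_image_Int_open[of \<kappa> "fst \<kappa>'"] chart_open by (simp add: Int_commute)

text \<open>The Jacobian at the point \<open>p\<close> of the change from the coordinates \<open>\<kappa>\<close> to the coordinates \<open>\<kappa>'\<close>.\<close>

abbreviation J where "J \<kappa> \<kappa>' p \<equiv> fderiv (snd \<kappa>' \<circ> cinv \<kappa>) (snd \<kappa> p)"

lemma J_has_derivative:
  assumes "\<kappa> \<in> A" "\<kappa>' \<in> A" "p \<in> fst \<kappa>" "p \<in> fst \<kappa>'"
  shows "((snd \<kappa>' \<circ> cinv \<kappa>) has_derivative J \<kappa> \<kappa>' p) (at (snd \<kappa> p))"
  using assms by (intro smooth_on_has_derivative[OF transition_smooth]) auto

lemma J_linear:
  "\<kappa> \<in> A \<Longrightarrow> \<kappa>' \<in> A \<Longrightarrow> p \<in> fst \<kappa> \<Longrightarrow> p \<in> fst \<kappa>' \<Longrightarrow> linear (J \<kappa> \<kappa>' p)"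
  using J_has_derivative has_derivative_linear by blast

lemma J_chain:
  assumes "\<kappa> \<in> A" "\<kappa>' \<in> A" "\<kappa>'' \<in> A" "p \<in> fst \<kappa>" "p \<in> fst \<kappa>'" "p \<in> fst \<kappa>''"
  shows "J \<kappa>' \<kappa>'' p (J \<kappa> \<kappa>' p e) = J \<kappa> \<kappa>'' p e"
proof -
  have 1: "((snd \<kappa>'' \<circ> cinv \<kappa>') has_derivative J \<kappa>' \<kappa>'' p) (at ((snd \<kappa>' \<circ> cinv \<kappa>) (snd \<kappa> p)))"
    using J_has_derivative[of \<kappa>' \<kappa>'' p] assms by (simp add: cinv_chart)
  have "((\<lambda>x. (snd \<kappa>'' \<circ> cinv \<kappa>') ((snd \<kappa>' \<circ> cinv \<kappa>) x)) has_derivative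
      (\<lambda>e. J \<kappa>' \<kappa>'' p (J \<kappa> \<kappa>' p e))) (at (snd \<kappa> p))"
    using has_derivative_compose[OF J_has_derivative 1] assms by blast
  then have "((snd \<kappa>'' \<circ> cinv \<kappa>) has_derivative (\<lambda>e. J \<kappa>' \<kappa>'' p (J \<kappa> \<kappa>' p e))) (at (snd \<kappa> p))"
    by (rule has_derivative_transform_within_open[OF _ overlap_open[OF assms(1,2)]])
      (use assms in \<open>auto simp: cinv_chart\<close>)
  from frechet_eqI[OF this] show ?thesis by simp
qed

lemma J_same: "\<kappa> \<in> A \<Longrightarrow> p \<in> fst \<kappa> \<Longrightarrow> J \<kappa> \<kappa> p e = e"
  by (rule frechet_eqI[where f'="\<lambda>e. e"])
    (auto intro!: has_derivative_transform_within_open[OF has_derivative_ident chart_image_open] simp: cinv_chart)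

lemma coord_vec_apply:
  "\<kappa>' \<in> A \<Longrightarrow> p \<in> fst \<kappa>' \<Longrightarrow> coord_vec A \<kappa> p e \<kappa>' = J \<kappa> \<kappa>' p e"
  by (simp add: coord_vec_def)

lemma coord_vec_same: "\<kappa> \<in> A \<Longrightarrow> p \<in> fst \<kappa> \<Longrightarrow> coord_vec A \<kappa> p e \<kappa> = e"
  by (simp add: coord_vec_apply J_same)

lemma tangent_spaceI:
  assumes "\<And>\<kappa>. \<not> (\<kappa> \<in> A \<and> p \<in> fst \<kappa>) \<Longrightarrow> v \<kappa> = 0"
    and "\<And>\<kappa> \<kappa>'. \<kappa> \<in> A \<Longrightarrow> \<kappa>' \<in> A \<Longrightarrow> p \<in> fst \<kappa> \<Longrightarrow> p \<in> fst \<kappa>' \<Longrightarrow> v \<kappa>' = J \<kappa> \<kappa>' p (v \<kappa>)"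
  shows "v \<in> tangent_space A p"
  using assms unfolding tangent_space_def by blast

lemma tangent_outside: "v \<in> tangent_space A p \<Longrightarrow> \<not> (\<kappa> \<in> A \<and> p \<in> fst \<kappa>) \<Longrightarrow> v \<kappa> = 0"
  unfolding tangent_space_def by blast

lemma coord_vec_tangent: "\<kappa> \<in> A \<Longrightarrow> p \<in> fst \<kappa> \<Longrightarrow> coord_vec A \<kappa> p e \<in> tangent_space A p"
  by (rule tangent_spaceI) (auto simp: coord_vec_def J_chain)

lemma tangent_change:
  "v \<in> tangent_space A p \<Longrightarrow> \<kappa> \<in> A \<Longrightarrow> p \<in> fst \<kappa> \<Longrightarrow> \<kappa>' \<in> A \<Longrightarrow> p \<in> fst \<kappa>' \<Longrightarrow> v \<kappa>' = J \<kappa> \<kappa>' p (v \<kappa>)"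
  unfolding tangent_space_def by blast

lemma coord_vec_components:
  "v \<in> tangent_space A p \<Longrightarrow> \<kappa> \<in> A \<Longrightarrow> p \<in> fst \<kappa> \<Longrightarrow> coord_vec A \<kappa> p (v \<kappa>) = v"
proof (rule ext)
  fix \<kappa>' assume "v \<in> tangent_space A p" "\<kappa> \<in> A" "p \<in> fst \<kappa>"
  then show "coord_vec A \<kappa> p (v \<kappa>) \<kappa>' = v \<kappa>'"
    using tangent_change[of v p \<kappa> \<kappa>'] tangent_outside[of v p \<kappa>'] by (simp add: coord_vec_def)
qed

lemma tangent_eqI:
  "v \<in> tangent_space A p \<Longrightarrow> w \<in> tangent_space A p \<Longrightarrow> \<kappa> \<in> A \<Longrightarrow> p \<in> fst \<kappa> \<Longrightarrow> v \<kappa> = w \<kappa> \<Longrightarrow> v = w"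
  by (metis coord_vec_components)

lemma coord_vec_add: "\<kappa> \<in> A \<Longrightarrow> p \<in> fst \<kappa> \<Longrightarrow>
    coord_vec A \<kappa> p (a + b) = coord_vec A \<kappa> p a + coord_vec A \<kappa> p b"
  by (rule ext) (auto simp: coord_vec_def linear_add[OF J_linear])

lemma coord_vec_scaleR: "\<kappa> \<in> A \<Longrightarrow> p \<in> fst \<kappa> \<Longrightarrow>
    coord_vec A \<kappa> p (r *\<^sub>R a) = r *\<^sub>R coord_vec A \<kappa> p a"
  by (rule ext) (auto simp: coord_vec_def scaleR_fun_def linear_scale[OF J_linear])

lemma tangent_space_subspace: "subspace (tangent_space A p)"
proof (rule subspaceI)
  show "0 \<in> tangent_space A p"
    by (rule tangent_spaceI) (simp_all add: linear_0[OF J_linear])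
next
  fix v w assume *: "v \<in> tangent_space A p" "w \<in> tangent_space A p"
  show "v + w \<in> tangent_space A p"
  proof (rule tangent_spaceI)
    show "(v + w) \<kappa> = 0" if "\<not> (\<kappa> \<in> A \<and> p \<in> fst \<kappa>)" for \<kappa>
      using *[THEN tangent_outside, OF that] by simp
    show "(v + w) \<kappa>' = J \<kappa> \<kappa>' p ((v + w) \<kappa>)"
      if "\<kappa> \<in> A" "\<kappa>' \<in> A" "p \<in> fst \<kappa>" "p \<in> fst \<kappa>'" for \<kappa> \<kappa>'
      using *[THEN tangent_change, OF that(1,3,2,4)] by (simp add: linear_add[OF J_linear[OF that]])
  qed
next
  fix r :: real and v assume *: "v \<in> tangent_space A p"
  show "r *\<^sub>R v \<in> tangent_space A p"
  proof (rule tangent_spaceI)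
    show "(r *\<^sub>R v) \<kappa> = 0" if "\<not> (\<kappa> \<in> A \<and> p \<in> fst \<kappa>)" for \<kappa>
      using tangent_outside[OF * that] by (simp add: scaleR_fun_def)
    show "(r *\<^sub>R v) \<kappa>' = J \<kappa> \<kappa>' p ((r *\<^sub>R v) \<kappa>)"
      if "\<kappa> \<in> A" "\<kappa>' \<in> A" "p \<in> fst \<kappa>" "p \<in> fst \<kappa>'" for \<kappa> \<kappa>'
      using tangent_change[OF * that(1,3,2,4)] by (simp add: scaleR_fun_def linear_scale[OF J_linear[OF that]])
  qed
qed

lemma vector_field_tangent: "X \<in> vector_fields A W \<Longrightarrow> p \<in> W \<Longrightarrow> X p \<in> tangent_space A p"
  by (simp add: vector_fields_def)

lemma vector_field_smooth:
  "X \<in> vector_fields A W \<Longrightarrow> \<kappa> \<in> A \<Longrightarrow> smooth_on (snd \<kappa> ` (W \<inter> fst \<kappa>)) (\<lambda>x. X (cinv \<kappa> x) \<kappa>)"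
  by (simp add: vector_fields_def)

lemma vector_field_has_derivative:
  assumes "X \<in> vector_fields A W" "\<kappa> \<in> A" "p \<in> W" "p \<in> fst \<kappa>"
  shows "((\<lambda>x. X (cinv \<kappa> x) \<kappa>) has_derivative fderiv (\<lambda>x. X (cinv \<kappa> x) \<kappa>) (snd \<kappa> p)) (at (snd \<kappa> p))"
  using assms by (intro smooth_on_has_derivative[OF vector_field_smooth]) auto

lemma vector_fields_mono: "X \<in> vector_fields A W \<Longrightarrow> W' \<subseteq> W \<Longrightarrow> X \<in> vector_fields A W'"
  unfolding vector_fields_def by (auto intro: smooth_on_subset)

lemma coord_vec_field: assumes "\<kappa> \<in> A" shows "(\<lambda>q. coord_vec A \<kappa> q e) \<in> vector_fields A (fst \<kappa>)"
  unfolding vector_fields_def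
proof (clarify, intro conjI ballI)
  show "coord_vec A \<kappa> q e \<in> tangent_space A q" if "q \<in> fst \<kappa>" for q
    by (rule coord_vec_tangent[OF assms that])
  fix \<kappa>' assume \<kappa>': "\<kappa>' \<in> A"
  let ?O = "snd \<kappa>' ` (fst \<kappa> \<inter> fst \<kappa>')"
  have op: "open ?O" using overlap_open[OF \<kappa>' assms] by (simp add: Int_commute)
  have "smooth_on ?O (\<lambda>x. fderiv (snd \<kappa>' \<circ> cinv \<kappa>) ((snd \<kappa> \<circ> cinv \<kappa>') x) e)"
  proof (rule smooth_on_compose[OF op, where T = "snd \<kappa> ` (fst \<kappa> \<inter> fst \<kappa>')"
        and g = "\<lambda>x. fderiv (snd \<kappa>' \<circ> cinv \<kappa>) x e" and f = "snd \<kappa> \<circ> cinv \<kappa>'"])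
    show "smooth_on ?O (snd \<kappa> \<circ> cinv \<kappa>')"
      using transition_smooth[OF \<kappa>' assms] by (simp add: Int_commute)
    show "smooth_on (snd \<kappa> ` (fst \<kappa> \<inter> fst \<kappa>')) (\<lambda>x. fderiv (snd \<kappa>' \<circ> cinv \<kappa>) x e)"
      by (rule smooth_on_frechet[OF transition_smooth[OF assms \<kappa>']])
  qed (use \<kappa>' in \<open>auto simp: cinv_chart\<close>)
  then show "smooth_on ?O (\<lambda>x. coord_vec A \<kappa> (cinv \<kappa>' x) e \<kappa>')"
    by (rule smooth_on_cong[OF op, rotated]) (use \<kappa>' in \<open>auto simp: coord_vec_apply cinv_chart\<close>)
qed

lemma const_ext_field: "const_ext A p v \<in> vector_fields A (fst (chart_at A p))"
  unfolding const_ext_def Let_def by (rule coord_vec_field[OF chart_at(1)])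

lemma const_ext_at: "v \<in> tangent_space A p \<Longrightarrow> const_ext A p v p = v"
  unfolding const_ext_def Let_def by (rule coord_vec_components[OF _ chart_at])

lemma const_ext_component: "q \<in> fst (chart_at A p) \<Longrightarrow> const_ext A p v q (chart_at A p) = v (chart_at A p)"
  unfolding const_ext_def Let_def by (rule coord_vec_same[OF chart_at(1)])

lemma const_ext_derivative_0:
  "fderiv (\<lambda>x. const_ext A p v (cinv (chart_at A p) x) (chart_at A p)) (snd (chart_at A p) p) d = 0"
proof (rule frechet_eqI)
  show "((\<lambda>x. const_ext A p v (cinv (chart_at A p) x) (chart_at A p)) has_derivative (\<lambda>d. 0)) (at (snd (chart_at A p) p))"
    by (rule has_derivative_transform_within_open[OF has_derivative_const chart_image_open[OF chart_at(1)]])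
     (auto simp: chart_at const_ext_component cinv_chart[OF chart_at(1)])
qed

lemma vector_fields_add:
  assumes "open W" "X \<in> vector_fields A W" "Y \<in> vector_fields A W"
  shows "(\<lambda>q. X q + Y q) \<in> vector_fields A W"
  using assms subspace_add[OF tangent_space_subspace]
  by (auto simp: vector_fields_def intro!: smooth_on_add chart_image_Int_open)

lemma vector_fields_scaleR:
  assumes "open W" "X \<in> vector_fields A W" "smooth_function A W f"
  shows "(\<lambda>q. f q *\<^sub>R X q) \<in> vector_fields A W"
  using assms subspace_mul[OF tangent_space_subspace]
  by (auto simp: vector_fields_def smooth_function_def o_def scaleR_fun_def
     intro!: smooth_on_scaleR chart_image_Int_open)

lemma vector_fields_sum:
  assumes "open W" "finite I" "I \<noteq> {}" "\<And>i. i \<in> I \<Longrightarrow> X i \<in> vector_fields A W"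
  shows "(\<lambda>q. \<Sum>i\<in>I. X i q) \<in> vector_fields A W"
  using assms(2-4) by (induction I rule: finite_ne_induct) (auto intro: vector_fields_add assms(1))

section \<open>The Lie bracket of vector fields is a vector field\<close>

text \<open>Under a change of coordinates with Jacobian \<open>J\<close>, the derivative \<open>D\<^sub>YX\<close> of the components of \<open>X\<close>
  becomes \<open>J (D\<^sub>YX) + D\<^sup>2\<tau>(Y, X)\<close>. The second summand is symmetric, so it cancels in the bracket.\<close>

lemma components_derivative_change:
  assumes W: "open W" "p \<in> W" and X: "X \<in> vector_fields A W"
    and k: "\<kappa> \<in> A" "p \<in> fst \<kappa>" "\<kappa>' \<in> A" "p \<in> fst \<kappa>'"
  shows "fderiv (\<lambda>x. X (cinv \<kappa>' x) \<kappa>') (snd \<kappa>' p) (J \<kappa> \<kappa>' p d)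
    = J \<kappa> \<kappa>' p (fderiv (\<lambda>x. X (cinv \<kappa> x) \<kappa>) (snd \<kappa> p) d)
      + fderiv (\<lambda>y. fderiv (snd \<kappa>' \<circ> cinv \<kappa>) y d) (snd \<kappa> p) (X p \<kappa>)"
    (is "?L = ?R")
proof -
  let ?\<tau> = "snd \<kappa>' \<circ> cinv \<kappa>"
  let ?O = "snd \<kappa> ` (W \<inter> fst \<kappa>' \<inter> fst \<kappa>)"
  have O: "open ?O" "snd \<kappa> p \<in> ?O"
    using W k chart_image_Int_open[OF k(1), of "W \<inter> fst \<kappa>'"] chart_open[OF k(3)] by auto
  have \<tau>: "smooth_on ?O ?\<tau>" by (rule smooth_on_subset[OF transition_smooth[OF k(1,3)]]) auto
  have "((\<lambda>x. X (cinv \<kappa>' x) \<kappa>') has_derivative fderiv (\<lambda>x. X (cinv \<kappa>' x) \<kappa>') (snd \<kappa>' p))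
      (at (?\<tau> (snd \<kappa> p)))"
    using vector_field_has_derivative[OF X k(3) W(2) k(4)] k by (simp add: cinv_chart)
  from has_derivative_compose[OF J_has_derivative[OF k(1,3,2,4)] this]
  have 1: "((\<lambda>x. X (cinv \<kappa>' (?\<tau> x)) \<kappa>') has_derivative
     (\<lambda>d. fderiv (\<lambda>x. X (cinv \<kappa>' x) \<kappa>') (snd \<kappa>' p) (J \<kappa> \<kappa>' p d))) (at (snd \<kappa> p))" .
  have "((\<lambda>x. fderiv ?\<tau> x (X (cinv \<kappa> x) \<kappa>)) has_derivative
     (\<lambda>d. J \<kappa> \<kappa>' p (fderiv (\<lambda>x. X (cinv \<kappa> x) \<kappa>) (snd \<kappa> p) d)
      + fderiv (\<lambda>y. fderiv ?\<tau> y d) (snd \<kappa> p) (X (cinv \<kappa> (snd \<kappa> p)) \<kappa>))) (at (snd \<kappa> p))"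
    by (rule frechet_along_has_derivative[OF O \<tau> vector_field_has_derivative[OF X k(1) W(2) k(2)]])
  then have "((\<lambda>x. X (cinv \<kappa>' (?\<tau> x)) \<kappa>') has_derivative
     (\<lambda>d. J \<kappa> \<kappa>' p (fderiv (\<lambda>x. X (cinv \<kappa> x) \<kappa>) (snd \<kappa> p) d)
      + fderiv (\<lambda>y. fderiv ?\<tau> y d) (snd \<kappa> p) (X (cinv \<kappa> (snd \<kappa> p)) \<kappa>))) (at (snd \<kappa> p))"
  proof (rule has_derivative_transform_within_open[OF _ O])
    fix x assume "x \<in> ?O"
    then obtain q where q: "q \<in> W" "q \<in> fst \<kappa>" "q \<in> fst \<kappa>'" "x = snd \<kappa> q" by auto
    show "fderiv ?\<tau> x (X (cinv \<kappa> x) \<kappa>) = X (cinv \<kappa>' (?\<tau> x)) \<kappa>'"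
      using tangent_change[OF vector_field_tangent[OF X q(1)] k(1) q(2) k(3) q(3)] q k
      by (simp add: cinv_chart)
  qed
  from has_derivative_unique[OF 1 this] show ?thesis
    using k by (metis (no_types, lifting) cinv_chart)
qed

lemma lie_bracket_tangent:
  assumes W: "open W" "p \<in> W" and X: "X \<in> vector_fields A W" and Y: "Y \<in> vector_fields A W"
  shows "lie_bracket A X Y p \<in> tangent_space A p"
proof -
  have change: "lie_bracket A X Y p \<kappa>' = J \<kappa> \<kappa>' p (lie_bracket A X Y p \<kappa>)"
    if k: "\<kappa> \<in> A" "p \<in> fst \<kappa>" "\<kappa>' \<in> A" "p \<in> fst \<kappa>'" for \<kappa> \<kappa>'
  proof -
    let ?\<tau> = "snd \<kappa>' \<circ> cinv \<kappa>"
    have sym: "fderiv (\<lambda>y. fderiv ?\<tau> y (X p \<kappa>)) (snd \<kappa> p) (Y p \<kappa>)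
      = fderiv (\<lambda>y. fderiv ?\<tau> y (Y p \<kappa>)) (snd \<kappa> p) (X p \<kappa>)"
      by (rule second_derivative_symmetric[OF overlap_open[OF k(1,3)] _ transition_smooth[OF k(1,3)]])
        (use k in auto)
    have "X p \<kappa>' = J \<kappa> \<kappa>' p (X p \<kappa>)" "Y p \<kappa>' = J \<kappa> \<kappa>' p (Y p \<kappa>)"
      using tangent_change[OF _ k] vector_field_tangent[OF _ W(2)] X Y by blast+
    then show ?thesis
      using components_derivative_change[OF W X k, of "Y p \<kappa>"] components_derivative_change[OF W Y k, of "X p \<kappa>"]
        sym k by (simp add: lie_bracket_def linear_diff[OF J_linear])
  qed
  show ?thesis
  proof (rule tangent_spaceI)
    show "lie_bracket A X Y p \<kappa> = 0" if "\<not> (\<kappa> \<in> A \<and> p \<in> fst \<kappa>)" for \<kappa>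
      using that by (auto simp: lie_bracket_def)
  qed (rule change)
qed

lemma lie_bracket_const_ext:
  assumes "v \<in> tangent_space A p" "w \<in> tangent_space A p"
  shows "lie_bracket A (const_ext A p v) (const_ext A p w) p = 0"
proof (rule tangent_eqI[OF _ _ chart_at])
  show "lie_bracket A (const_ext A p v) (const_ext A p w) p \<in> tangent_space A p"
    by (rule lie_bracket_tangent[OF chart_open[OF chart_at(1)] chart_at(2) const_ext_field const_ext_field])
  show "0 \<in> tangent_space A p" by (rule subspace_0[OF tangent_space_subspace])
qed (simp add: lie_bracket_def const_ext_derivative_0 chart_at)

end

section \<open>Covariant tensors in a chart\<close>

definition smooth_form :: "('m, 'e::euclidean_space) chart set \<Rightarrow> ('m::topological_space, 'e) form \<Rightarrow> bool" where
  "smooth_form A a \<longleftrightarrow>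
     (\<forall>p. \<forall>u\<in>tangent_space A p. \<forall>v\<in>tangent_space A p. \<forall>r.
        a p (u + v) = a p u + a p v \<and> a p (r *\<^sub>R u) = r * a p u) \<and>
     (\<forall>W. open W \<longrightarrow> (\<forall>X\<in>vector_fields A W. smooth_function A W (\<lambda>q. a q (X q))))"

definition smooth_bilin :: "('m, 'e::euclidean_space) chart set \<Rightarrow> ('m::topological_space, 'e) bilin \<Rightarrow> bool" where
  "smooth_bilin A g \<longleftrightarrow>
     (\<forall>p. \<forall>u\<in>tangent_space A p. \<forall>v\<in>tangent_space A p. \<forall>w\<in>tangent_space A p. \<forall>r.
        g p (u + v) w = g p u w + g p v w \<and> g p (r *\<^sub>R u) w = r * g p u w \<and> g p u w = g p w u) \<and>
     (\<forall>W. open W \<longrightarrow> (\<forall>X\<in>vector_fields A W. \<forall>Y\<in>vector_fields A W.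
        smooth_function A W (\<lambda>q. g q (X q) (Y q))))"

text \<open>The value \<open>0\<close> outside of the chart makes the components linear at every point.\<close>

definition form_coord ::
  "('m, 'e::euclidean_space) chart set \<Rightarrow> ('m, 'e) form \<Rightarrow> ('m, 'e) chart \<Rightarrow> 'e \<Rightarrow> 'e \<Rightarrow> real" where
  "form_coord A a \<kappa> x e =
     (if x \<in> snd \<kappa> ` fst \<kappa> then a (cinv \<kappa> x) (coord_vec A \<kappa> (cinv \<kappa> x) e) else 0)"

definition bilin_coord ::
  "('m, 'e::euclidean_space) chart set \<Rightarrow> ('m, 'e) bilin \<Rightarrow> ('m, 'e) chart \<Rightarrow> 'e \<Rightarrow> 'e \<Rightarrow> 'e \<Rightarrow> real" where
  "bilin_coord A g \<kappa> x e e' =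
     (if x \<in> snd \<kappa> ` fst \<kappa> then g (cinv \<kappa> x) (coord_vec A \<kappa> (cinv \<kappa> x) e) (coord_vec A \<kappa> (cinv \<kappa> x) e') else 0)"

lemma smooth_form_add: "smooth_form A a \<Longrightarrow> u \<in> tangent_space A p \<Longrightarrow> v \<in> tangent_space A p \<Longrightarrow>
    a p (u + v) = a p u + a p v"
  and smooth_form_scaleR: "smooth_form A a \<Longrightarrow> u \<in> tangent_space A p \<Longrightarrow> a p (r *\<^sub>R u) = r * a p u"
  and smooth_form_function: "smooth_form A a \<Longrightarrow> open W \<Longrightarrow> X \<in> vector_fields A W \<Longrightarrow>
    smooth_function A W (\<lambda>q. a q (X q))"
  unfolding smooth_form_def by blast+

lemma smooth_bilin_sym: "smooth_bilin A g \<Longrightarrow> u \<in> tangent_space A p \<Longrightarrow> v \<in> tangent_space A p \<Longrightarrow>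
    g p u v = g p v u"
  and smooth_bilin_add_left: "smooth_bilin A g \<Longrightarrow> u \<in> tangent_space A p \<Longrightarrow> v \<in> tangent_space A p \<Longrightarrow>
    w \<in> tangent_space A p \<Longrightarrow> g p (u + v) w = g p u w + g p v w"
  and smooth_bilin_scaleR_left: "smooth_bilin A g \<Longrightarrow> u \<in> tangent_space A p \<Longrightarrow>
    w \<in> tangent_space A p \<Longrightarrow> g p (r *\<^sub>R u) w = r * g p u w"
  and smooth_bilin_function: "smooth_bilin A g \<Longrightarrow> open W \<Longrightarrow> X \<in> vector_fields A W \<Longrightarrow>
    Y \<in> vector_fields A W \<Longrightarrow> smooth_function A W (\<lambda>q. g q (X q) (Y q))"
  unfolding smooth_bilin_def by blast+

context smooth_manifold begin

lemma smooth_bilin_form: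
  assumes "smooth_bilin A g" "X \<in> vector_fields A UNIV"
  shows "smooth_form A (\<lambda>p v. g p (X p) v)"
proof -
  have X: "X p \<in> tangent_space A p" for p using assms(2) by (simp add: vector_fields_def)
  have "g p (X p) (u + v) = g p (X p) u + g p (X p) v" "g p (X p) (r *\<^sub>R u) = r * g p (X p) u"
    if "u \<in> tangent_space A p" "v \<in> tangent_space A p" for p u v r
    using that X[of p] subspace_add[OF tangent_space_subspace that] subspace_mul[OF tangent_space_subspace that(1), of r]
      smooth_bilin_sym[OF assms(1), of "X p" p] smooth_bilin_add_left[OF assms(1) that X]
      smooth_bilin_scaleR_left[OF assms(1) that(1) X, of r] by auto
  moreover have "smooth_function A W (\<lambda>q. g q (X q) (Y q))" if "open W" "Y \<in> vector_fields A W" for W Y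
    using smooth_bilin_function[OF assms(1) that(1) vector_fields_mono[OF assms(2)] that(2)] by simp
  ultimately show ?thesis unfolding smooth_form_def by blast
qed

lemma form_coord_eval:
  "\<kappa> \<in> A \<Longrightarrow> p \<in> fst \<kappa> \<Longrightarrow> v \<in> tangent_space A p \<Longrightarrow> form_coord A a \<kappa> (snd \<kappa> p) (v \<kappa>) = a p v"
  by (simp add: form_coord_def cinv_chart coord_vec_components)

lemma bilin_coord_eval:
  "\<kappa> \<in> A \<Longrightarrow> p \<in> fst \<kappa> \<Longrightarrow> v \<in> tangent_space A p \<Longrightarrow> w \<in> tangent_space A p \<Longrightarrow>
    bilin_coord A g \<kappa> (snd \<kappa> p) (v \<kappa>) (w \<kappa>) = g p v w"
  by (simp add: bilin_coord_def cinv_chart coord_vec_components)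

lemma form_coord_linear:
  assumes "smooth_form A a" "\<kappa> \<in> A" shows "linear (form_coord A a \<kappa> x)"
proof (cases "x \<in> snd \<kappa> ` fst \<kappa>")
  case True
  then have c: "cinv \<kappa> x \<in> fst \<kappa>" by (rule cinv_in_chart[OF assms(2)])
  note t = coord_vec_tangent[OF assms(2) c]
  show ?thesis
    by (rule linearI) (simp_all add: form_coord_def True coord_vec_add[OF assms(2) c]
        coord_vec_scaleR[OF assms(2) c] smooth_form_add[OF assms(1) t t] smooth_form_scaleR[OF assms(1) t])
next
  case False
  then show ?thesis by (simp add: form_coord_def[abs_def] linear_iff)
qed

lemma form_coord_smooth:
  assumes "smooth_form A a" "\<kappa> \<in> A" shows "smooth_on (snd \<kappa> ` fst \<kappa>) (\<lambda>x. form_coord A a \<kappa> x e)"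
proof -
  have "smooth_on (snd \<kappa> ` (fst \<kappa> \<inter> fst \<kappa>)) ((\<lambda>q. a q (coord_vec A \<kappa> q e)) \<circ> cinv \<kappa>)"
    using smooth_form_function[OF assms(1) chart_open[OF assms(2)] coord_vec_field[OF assms(2)]] assms(2)
    unfolding smooth_function_def by blast
  from this[unfolded Int_absorb] show ?thesis
    by (rule smooth_on_cong[OF chart_image_open[OF assms(2)], rotated]) (simp add: form_coord_def)
qed

lemma bilin_coord_sym:
  assumes "smooth_bilin A g" "\<kappa> \<in> A" shows "bilin_coord A g \<kappa> x e e' = bilin_coord A g \<kappa> x e' e"
  using smooth_bilin_sym[OF assms(1) coord_vec_tangent coord_vec_tangent, OF assms(2) _ assms(2)]
    cinv_in_chart[OF assms(2)] by (simp add: bilin_coord_def)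

lemma bilin_coord_linear_left:
  assumes "smooth_bilin A g" "\<kappa> \<in> A" shows "linear (\<lambda>e. bilin_coord A g \<kappa> x e e')"
proof (cases "x \<in> snd \<kappa> ` fst \<kappa>")
  case True
  then have c: "cinv \<kappa> x \<in> fst \<kappa>" by (rule cinv_in_chart[OF assms(2)])
  note t = coord_vec_tangent[OF assms(2) c]
  show ?thesis
    by (rule linearI) (simp_all add: bilin_coord_def True coord_vec_add[OF assms(2) c]
        coord_vec_scaleR[OF assms(2) c] smooth_bilin_add_left[OF assms(1) t t t] smooth_bilin_scaleR_left[OF assms(1) t t])
next
  case False
  then show ?thesis by (simp add: bilin_coord_def[abs_def] linear_iff)
qed

lemma bilin_coord_linear_right:
  assumes "smooth_bilin A g" "\<kappa> \<in> A" shows "linear (bilin_coord A g \<kappa> x e)"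
  using bilin_coord_linear_left[OF assms, of x e] bilin_coord_sym[OF assms, of x e]
  by presburger

lemma bilin_coord_smooth:
  assumes "smooth_bilin A g" "\<kappa> \<in> A" shows "smooth_on (snd \<kappa> ` fst \<kappa>) (\<lambda>x. bilin_coord A g \<kappa> x e e')"
proof -
  have "smooth_on (snd \<kappa> ` (fst \<kappa> \<inter> fst \<kappa>)) ((\<lambda>q. g q (coord_vec A \<kappa> q e) (coord_vec A \<kappa> q e')) \<circ> cinv \<kappa>)"
    using smooth_bilin_function[OF assms(1) chart_open[OF assms(2)] coord_vec_field[OF assms(2)] coord_vec_field[OF assms(2)]] assms(2)
    unfolding smooth_function_def by blast
  from this[unfolded Int_absorb] show ?thesis
    by (rule smooth_on_cong[OF chart_image_open[OF assms(2)], rotated]) (simp add: bilin_coord_def)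
qed

lemma form_coord_differentiable:
  "smooth_form A a \<Longrightarrow> \<kappa> \<in> A \<Longrightarrow> x \<in> snd \<kappa> ` fst \<kappa> \<Longrightarrow> (\<lambda>x. form_coord A a \<kappa> x e) differentiable (at x)"
  by (rule smooth_on_differentiable[OF form_coord_smooth])

lemma bilin_coord_differentiable:
  "smooth_bilin A g \<Longrightarrow> \<kappa> \<in> A \<Longrightarrow> x \<in> snd \<kappa> ` fst \<kappa> \<Longrightarrow> (\<lambda>x. bilin_coord A g \<kappa> x e e') differentiable (at x)"
  by (rule smooth_on_differentiable[OF bilin_coord_smooth])

abbreviation comp_deriv :: "('m, 'e) chart \<Rightarrow> 'm \<Rightarrow> ('m \<Rightarrow> ('m, 'e) tangent) \<Rightarrow> 'e \<Rightarrow> 'e" where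
  "comp_deriv \<kappa> p X \<equiv> fderiv (\<lambda>x. X (cinv \<kappa> x) \<kappa>) (snd \<kappa> p)"

abbreviation form_deriv :: "('m, 'e) form \<Rightarrow> ('m, 'e) chart \<Rightarrow> 'm \<Rightarrow> 'e \<Rightarrow> 'e \<Rightarrow> real" where
  "form_deriv a \<kappa> p d e \<equiv> fderiv (\<lambda>x. form_coord A a \<kappa> x e) (snd \<kappa> p) d"

abbreviation bilin_deriv :: "('m, 'e) bilin \<Rightarrow> ('m, 'e) chart \<Rightarrow> 'm \<Rightarrow> 'e \<Rightarrow> 'e \<Rightarrow> 'e \<Rightarrow> real" where
  "bilin_deriv g \<kappa> p d e e' \<equiv> fderiv (\<lambda>x. bilin_coord A g \<kappa> x e e') (snd \<kappa> p) d"

lemma dir_deriv_form: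
  assumes a: "smooth_form A a" and W: "open W" "p \<in> W" and X: "X \<in> vector_fields A W"
  defines "\<kappa> \<equiv> chart_at A p"
  shows "dir_deriv A (\<lambda>q. a q (X q)) p v =
    form_deriv a \<kappa> p (v \<kappa>) (X p \<kappa>) + form_coord A a \<kappa> (snd \<kappa> p) (comp_deriv \<kappa> p X (v \<kappa>))"
proof -
  have k: "\<kappa> \<in> A" "p \<in> fst \<kappa>" by (simp_all add: \<kappa>_def chart_at)
  have "((\<lambda>x. form_coord A a \<kappa> x (X (cinv \<kappa> x) \<kappa>)) has_derivative
      (\<lambda>d. form_deriv a \<kappa> p d (X (cinv \<kappa> (snd \<kappa> p)) \<kappa>) + form_coord A a \<kappa> (snd \<kappa> p) (comp_deriv \<kappa> p X d))) (at (snd \<kappa> p))"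
    by (rule form_along_has_derivative[OF form_coord_linear[OF a k(1)] form_coord_differentiable[OF a k(1)]
          has_derivative_ident vector_field_has_derivative[OF X k(1) W(2) k(2)]]) (use k in auto)
  then have "(((\<lambda>q. a q (X q)) \<circ> cinv \<kappa>) has_derivative
      (\<lambda>d. form_deriv a \<kappa> p d (X (cinv \<kappa> (snd \<kappa> p)) \<kappa>) + form_coord A a \<kappa> (snd \<kappa> p) (comp_deriv \<kappa> p X d))) (at (snd \<kappa> p))"
  proof (rule has_derivative_transform_within_open[OF _ chart_image_Int_open[OF k(1) W(1)]])
    show "snd \<kappa> p \<in> snd \<kappa> ` (W \<inter> fst \<kappa>)" using k W by auto
    show "form_coord A a \<kappa> x (X (cinv \<kappa> x) \<kappa>) = ((\<lambda>q. a q (X q)) \<circ> cinv \<kappa>) x" if "x \<in> snd \<kappa> ` (W \<inter> fst \<kappa>)" for x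
      using that form_coord_eval[OF k(1)] vector_field_tangent[OF X] k by (auto simp: cinv_chart)
  qed
  from frechet_eqI[OF this] show ?thesis
    by (simp add: dir_deriv_def flip: \<kappa>_def) (simp add: cinv_chart k)
qed

lemma dir_deriv_bilin:
  assumes g: "smooth_bilin A g" and W: "open W" "p \<in> W" and X: "X \<in> vector_fields A W" and Y: "Y \<in> vector_fields A W"
  defines "\<kappa> \<equiv> chart_at A p"
  shows "dir_deriv A (\<lambda>q. g q (X q) (Y q)) p v =
    bilin_deriv g \<kappa> p (v \<kappa>) (X p \<kappa>) (Y p \<kappa>)
    + bilin_coord A g \<kappa> (snd \<kappa> p) (comp_deriv \<kappa> p X (v \<kappa>)) (Y p \<kappa>)
    + bilin_coord A g \<kappa> (snd \<kappa> p) (X p \<kappa>) (comp_deriv \<kappa> p Y (v \<kappa>))"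
proof -
  have k: "\<kappa> \<in> A" "p \<in> fst \<kappa>" by (simp_all add: \<kappa>_def chart_at)
  let ?d = "\<lambda>d. bilin_deriv g \<kappa> p d (X (cinv \<kappa> (snd \<kappa> p)) \<kappa>) (Y (cinv \<kappa> (snd \<kappa> p)) \<kappa>)
        + bilin_coord A g \<kappa> (snd \<kappa> p) (comp_deriv \<kappa> p X d) (Y (cinv \<kappa> (snd \<kappa> p)) \<kappa>)
        + bilin_coord A g \<kappa> (snd \<kappa> p) (X (cinv \<kappa> (snd \<kappa> p)) \<kappa>) (comp_deriv \<kappa> p Y d)"
  have "((\<lambda>x. bilin_coord A g \<kappa> x (X (cinv \<kappa> x) \<kappa>) (Y (cinv \<kappa> x) \<kappa>)) has_derivative ?d) (at (snd \<kappa> p))"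
    by (rule bilin_along_has_derivative[OF bilin_coord_linear_right[OF g k(1)] bilin_coord_linear_left[OF g k(1)]
          bilin_coord_differentiable[OF g k(1)]
          has_derivative_ident vector_field_has_derivative[OF X k(1) W(2) k(2)]
          vector_field_has_derivative[OF Y k(1) W(2) k(2)]]) (use k in auto)
  then have "(((\<lambda>q. g q (X q) (Y q)) \<circ> cinv \<kappa>) has_derivative ?d) (at (snd \<kappa> p))"
  proof (rule has_derivative_transform_within_open[OF _ chart_image_Int_open[OF k(1) W(1)]])
    show "snd \<kappa> p \<in> snd \<kappa> ` (W \<inter> fst \<kappa>)" using k W by auto
    show "bilin_coord A g \<kappa> x (X (cinv \<kappa> x) \<kappa>) (Y (cinv \<kappa> x) \<kappa>) = ((\<lambda>q. g q (X q) (Y q)) \<circ> cinv \<kappa>) x"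
      if "x \<in> snd \<kappa> ` (W \<inter> fst \<kappa>)" for x
      using that bilin_coord_eval[OF k(1)] vector_field_tangent[OF X] vector_field_tangent[OF Y] k by (auto simp: cinv_chart)
  qed
  from frechet_eqI[OF this] show ?thesis
    by (simp add: dir_deriv_def flip: \<kappa>_def) (simp add: cinv_chart k)
qed

lemma lie_bracket_component:
  "\<kappa> \<in> A \<Longrightarrow> p \<in> fst \<kappa> \<Longrightarrow>
    lie_bracket A X Y p \<kappa> = comp_deriv \<kappa> p Y (X p \<kappa>) - comp_deriv \<kappa> p X (Y p \<kappa>)"
  by (simp add: lie_bracket_def)

text \<open>The derivatives of \<open>X\<close> in the directional derivative and in the bracket cancel, so only the value of \<open>X\<close> at
  \<open>p\<close> remains: the Lie derivative is tensorial. The same happens for bilinear forms.\<close>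

lemma lie_form_coord:
  assumes a: "smooth_form A a" and W: "open W" "p \<in> W" and N: "N \<in> vector_fields A W" and X: "X \<in> vector_fields A W"
  defines "\<kappa> \<equiv> chart_at A p"
  shows "lie_form A N a X p = form_deriv a \<kappa> p (N p \<kappa>) (X p \<kappa>)
    + form_coord A a \<kappa> (snd \<kappa> p) (comp_deriv \<kappa> p N (X p \<kappa>))"
proof -
  have k: "\<kappa> \<in> A" "p \<in> fst \<kappa>" by (simp_all add: \<kappa>_def chart_at)
  show ?thesis
    using dir_deriv_form[OF a W X, of "N p"] form_coord_eval[OF k lie_bracket_tangent[OF W N X], of a]
    by (simp add: lie_form_def lie_bracket_component[OF k] linear_diff[OF form_coord_linear[OF a k(1)]]
        flip: \<kappa>_def)
qed

lemma lie_bilin_coord: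
  assumes g: "smooth_bilin A g" and W: "open W" "p \<in> W" and N: "N \<in> vector_fields A W"
    and X: "X \<in> vector_fields A W" and Y: "Y \<in> vector_fields A W"
  defines "\<kappa> \<equiv> chart_at A p"
  shows "lie_bilin A N g X Y p = bilin_deriv g \<kappa> p (N p \<kappa>) (X p \<kappa>) (Y p \<kappa>)
    + bilin_coord A g \<kappa> (snd \<kappa> p) (comp_deriv \<kappa> p N (X p \<kappa>)) (Y p \<kappa>)
    + bilin_coord A g \<kappa> (snd \<kappa> p) (X p \<kappa>) (comp_deriv \<kappa> p N (Y p \<kappa>))"
proof -
  have k: "\<kappa> \<in> A" "p \<in> fst \<kappa>" by (simp_all add: \<kappa>_def chart_at)
  show ?thesis
    using dir_deriv_bilin[OF g W X Y, of "N p"]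
      bilin_coord_eval[OF k lie_bracket_tangent[OF W N X] vector_field_tangent[OF Y W(2)], of g]
      bilin_coord_eval[OF k vector_field_tangent[OF X W(2)] lie_bracket_tangent[OF W N Y], of g]
    by (simp add: lie_bilin_def lie_bracket_component[OF k] linear_diff[OF bilin_coord_linear_left[OF g k(1)]]
        linear_diff[OF bilin_coord_linear_right[OF g k(1)]] flip: \<kappa>_def)
qed

lemma const_ext_on: "p \<in> W \<Longrightarrow> const_ext A p v \<in> vector_fields A (W \<inter> fst (chart_at A p))"
  by (rule vector_fields_mono[OF const_ext_field]) auto

lemma lie_form_at_coord:
  assumes a: "smooth_form A a" and W: "open W" "p \<in> W" and N: "N \<in> vector_fields A W" and u: "u \<in> tangent_space A p"
  defines "\<kappa> \<equiv> chart_at A p"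
  shows "lie_form_at A N a p u = form_deriv a \<kappa> p (N p \<kappa>) (u \<kappa>)
    + form_coord A a \<kappa> (snd \<kappa> p) (comp_deriv \<kappa> p N (u \<kappa>))"
  using lie_form_coord[OF a open_Int[OF W(1) chart_open[OF chart_at(1)]] _ vector_fields_mono[OF N] const_ext_on[OF W(2)], of p u]
    W chart_at(2)[of p] const_ext_at[OF u] unfolding lie_form_at_def \<kappa>_def by simp

lemma lie_bilin_at_coord:
  assumes g: "smooth_bilin A g" and W: "open W" "p \<in> W" and N: "N \<in> vector_fields A W"
    and u: "u \<in> tangent_space A p" and w: "w \<in> tangent_space A p"
  defines "\<kappa> \<equiv> chart_at A p"
  shows "lie_bilin_at A N g p u w = bilin_deriv g \<kappa> p (N p \<kappa>) (u \<kappa>) (w \<kappa>)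
    + bilin_coord A g \<kappa> (snd \<kappa> p) (comp_deriv \<kappa> p N (u \<kappa>)) (w \<kappa>)
    + bilin_coord A g \<kappa> (snd \<kappa> p) (u \<kappa>) (comp_deriv \<kappa> p N (w \<kappa>))"
  using lie_bilin_coord[OF g open_Int[OF W(1) chart_open[OF chart_at(1)]] _ vector_fields_mono[OF N]
      const_ext_on[OF W(2)] const_ext_on[OF W(2)], of p u w]
    W chart_at(2)[of p] const_ext_at[OF u] const_ext_at[OF w] unfolding lie_bilin_at_def \<kappa>_def by simp

lemma ext_deriv_at_coord:
  assumes a: "smooth_form A a" and u: "u \<in> tangent_space A p" and w: "w \<in> tangent_space A p"
  defines "\<kappa> \<equiv> chart_at A p"
  shows "ext_deriv_at A a p u w = form_deriv a \<kappa> p (u \<kappa>) (w \<kappa>) - form_deriv a \<kappa> p (w \<kappa>) (u \<kappa>)"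
proof -
  have k: "\<kappa> \<in> A" "p \<in> fst \<kappa>" by (simp_all add: \<kappa>_def chart_at)
  have "a p 0 = 0" using smooth_form_scaleR[OF a u, of 0] by simp
  then show ?thesis
    using dir_deriv_form[OF a chart_open[OF k(1)] k(2), of "const_ext A p w" u]
      dir_deriv_form[OF a chart_open[OF k(1)] k(2), of "const_ext A p u" w]
      linear_0[OF form_coord_linear[OF a k(1)]]
    by (simp add: ext_deriv_at_def ext_deriv_def lie_bracket_const_ext[OF u w] const_ext_at u w
        const_ext_field const_ext_derivative_0 \<kappa>_def)
qed

end

section \<open>Affine connections in a chart\<close>

context smooth_manifold begin

lemma smooth_function_via_chart:
  assumes "\<kappa> \<in> A" "open W" "W \<subseteq> fst \<kappa>" "smooth_on (snd \<kappa> ` W) (\<lambda>x. f (cinv \<kappa> x))"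
  shows "smooth_function A W f"
  unfolding smooth_function_def
proof
  fix \<kappa>' assume k: "\<kappa>' \<in> A"
  let ?O = "snd \<kappa>' ` (W \<inter> fst \<kappa>')"
  have O: "open ?O" by (rule chart_image_Int_open[OF k assms(2)])
  have "smooth_on (snd \<kappa>' ` (fst \<kappa>' \<inter> fst \<kappa>)) (snd \<kappa> \<circ> cinv \<kappa>')"
    by (rule transition_smooth[OF k assms(1)])
  then have "smooth_on ?O (snd \<kappa> \<circ> cinv \<kappa>')"
    by (rule smooth_on_subset) (use assms(3) in blast)
  then have "smooth_on ?O (\<lambda>x. f (cinv \<kappa> ((snd \<kappa> \<circ> cinv \<kappa>') x)))"
    using smooth_on_compose[OF O _ _ assms(4), of "snd \<kappa> \<circ> cinv \<kappa>'"] k by (auto simp: cinv_chart image_subset_iff)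
  then show "smooth_on ?O (f \<circ> cinv \<kappa>')"
    by (rule smooth_on_cong[OF O, rotated]) (use assms(1,3) k in \<open>auto simp: cinv_chart subset_iff\<close>)
qed

lemma smooth_function_const: "smooth_function A W (\<lambda>q. c)"
  by (simp add: smooth_function_def o_def smooth_on_const)

lemma smooth_function_cong:
  assumes "open W" "\<And>q. q \<in> W \<Longrightarrow> f q = f' q" "smooth_function A W f"
  shows "smooth_function A W f'"
  unfolding smooth_function_def
proof
  fix \<kappa> assume k: "\<kappa> \<in> A"
  have "smooth_on (snd \<kappa> ` (W \<inter> fst \<kappa>)) (f \<circ> cinv \<kappa>)"
    using assms(3) k by (simp add: smooth_function_def)
  then show "smooth_on (snd \<kappa> ` (W \<inter> fst \<kappa>)) (f' \<circ> cinv \<kappa>)"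
    by (rule smooth_on_cong[OF chart_image_Int_open[OF k assms(1)], rotated])
      (use assms(2) k in \<open>auto simp: cinv_chart\<close>)
qed

lemma dir_deriv_locally_const:
  assumes "open W" "p \<in> W" "\<And>q. q \<in> W \<Longrightarrow> f q = c" shows "dir_deriv A f p v = 0"
proof -
  let ?\<kappa> = "chart_at A p"
  have "((f \<circ> cinv ?\<kappa>) has_derivative (\<lambda>v. 0)) (at (snd ?\<kappa> p))"
    by (rule has_derivative_transform_within_open[OF has_derivative_const[of c] chart_image_Int_open[OF chart_at(1) assms(1)]])
      (use assms chart_at in \<open>auto simp: cinv_chart\<close>)
  from frechet_eqI[OF this] show ?thesis by (simp add: dir_deriv_def)
qed

end

locale connection = smooth_manifold A
  for A :: "('m::{t2_space, second_countable_topology}, 'e::euclidean_space) chart set" +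
  fixes D :: "('m \<Rightarrow> ('m, 'e) tangent) \<Rightarrow> ('m \<Rightarrow> ('m, 'e) tangent) \<Rightarrow> 'm \<Rightarrow> ('m, 'e) tangent"
  assumes connection: "affine_connection A D"
begin

lemma
  assumes "open W" "p \<in> W" "X \<in> vector_fields A W" "Y \<in> vector_fields A W"
  shows conn_field: "D X Y \<in> vector_fields A W"
    and conn_add_left: "X' \<in> vector_fields A W \<Longrightarrow> D (\<lambda>q. X q + X' q) Y p = D X Y p + D X' Y p"
    and conn_scaleR_left: "smooth_function A W f \<Longrightarrow> D (\<lambda>q. f q *\<^sub>R X q) Y p = f p *\<^sub>R D X Y p"
    and conn_add_right: "Y' \<in> vector_fields A W \<Longrightarrow> D X (\<lambda>q. Y q + Y' q) p = D X Y p + D X Y' p"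
    and conn_scaleR_right: "smooth_function A W f \<Longrightarrow>
      D X (\<lambda>q. f q *\<^sub>R Y q) p = f p *\<^sub>R D X Y p + dir_deriv A f p (X p) *\<^sub>R Y p"
proof -
  have c: "D X Y \<in> vector_fields A W \<and>
          (\<forall>p\<in>W.
             D (\<lambda>q. X q + X' q) Y p = D X Y p + D X' Y p \<and>
             D (\<lambda>q. f q *\<^sub>R X q) Y p = f p *\<^sub>R D X Y p \<and>
             D X (\<lambda>q. Y q + Y' q) p = D X Y p + D X Y' p \<and>
             D X (\<lambda>q. f q *\<^sub>R Y q) p = f p *\<^sub>R D X Y p + dir_deriv A f p (X p) *\<^sub>R Y p)"
    if "smooth_function A W f" "X' \<in> vector_fields A W" "Y' \<in> vector_fields A W" for f X' Y'
    using connection[unfolded affine_connection_def, rule_format, OF assms(1,3) that(2) assms(4) that(3) that(1)] by simp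
  show "D X Y \<in> vector_fields A W" using c[OF smooth_function_const assms(3,4)] by blast
  show "X' \<in> vector_fields A W \<Longrightarrow> D (\<lambda>q. X q + X' q) Y p = D X Y p + D X' Y p"
    using c[OF smooth_function_const _ assms(4)] assms(2) by blast
  show "smooth_function A W f \<Longrightarrow> D (\<lambda>q. f q *\<^sub>R X q) Y p = f p *\<^sub>R D X Y p"
    using c[OF _ assms(3,4)] assms(2) by blast
  show "Y' \<in> vector_fields A W \<Longrightarrow> D X (\<lambda>q. Y q + Y' q) p = D X Y p + D X Y' p"
    using c[OF smooth_function_const assms(3)] assms(2) by blast
  show "smooth_function A W f \<Longrightarrow>
      D X (\<lambda>q. f q *\<^sub>R Y q) p = f p *\<^sub>R D X Y p + dir_deriv A f p (X p) *\<^sub>R Y p"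
    using c[OF _ assms(3,4)] assms(2) by blast
qed

text \<open>Multiplying by the indicator function of \<open>W\<close>, which is smooth on \<open>W\<close>, makes vector fields that
  agree on \<open>W\<close> equal.\<close>

lemma conn_local:
  assumes W: "open W" "p \<in> W" and X: "X \<in> vector_fields A W" "X' \<in> vector_fields A W" "\<And>q. q \<in> W \<Longrightarrow> X q = X' q"
    and Y: "Y \<in> vector_fields A W" "Y' \<in> vector_fields A W" "\<And>q. q \<in> W \<Longrightarrow> Y q = Y' q"
  shows "D X Y p = D X' Y' p"
proof -
  define f where "f = (\<lambda>q. if q \<in> W then 1 else 0 :: real)"
  have f: "smooth_function A W f"
    by (rule smooth_function_cong[OF W(1) _ smooth_function_const[of W 1]]) (simp add: f_def)
  have fp: "f p = 1" "dir_deriv A f p v = 0" for v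
    using W dir_deriv_locally_const[OF W, of f 1] by (auto simp: f_def)
  have "(\<lambda>q. f q *\<^sub>R X q) = (\<lambda>q. f q *\<^sub>R X' q)" "(\<lambda>q. f q *\<^sub>R Y q) = (\<lambda>q. f q *\<^sub>R Y' q)"
    using X(3) Y(3) by (auto simp: f_def fun_eq_iff)
  then show ?thesis
    using conn_scaleR_left[OF W X(1) Y(1) f] conn_scaleR_left[OF W X(2) Y(1) f]
      conn_scaleR_right[OF W X(2) Y(1) f] conn_scaleR_right[OF W X(2) Y(2) f] fp by simp
qed

lemma conn_sum_left:
  assumes W: "open W" "p \<in> W" and I: "finite I" "I \<noteq> {}" and E: "\<And>i. i \<in> I \<Longrightarrow> E i \<in> vector_fields A W"
    and f: "\<And>i. i \<in> I \<Longrightarrow> smooth_function A W (f i)" and Y: "Y \<in> vector_fields A W"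
  shows "D (\<lambda>q. \<Sum>i\<in>I. f i q *\<^sub>R E i q) Y p = (\<Sum>i\<in>I. f i p *\<^sub>R D (E i) Y p)"
  using I E f
proof (induction I rule: finite_ne_induct)
  case (singleton i)
  then show ?case using conn_scaleR_left[OF W _ Y] by simp
next
  case (insert i I)
  have "D (\<lambda>q. f i q *\<^sub>R E i q + (\<Sum>i\<in>I. f i q *\<^sub>R E i q)) Y p =
      D (\<lambda>q. f i q *\<^sub>R E i q) Y p + D (\<lambda>q. \<Sum>i\<in>I. f i q *\<^sub>R E i q) Y p"
    using insert by (intro conn_add_left[OF W _ Y] vector_fields_sum vector_fields_scaleR W) auto
  also have "D (\<lambda>q. f i q *\<^sub>R E i q) Y p = f i p *\<^sub>R D (E i) Y p"
    using insert.prems by (intro conn_scaleR_left[OF W _ Y]) auto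
  also have "D (\<lambda>q. \<Sum>i\<in>I. f i q *\<^sub>R E i q) Y p = (\<Sum>i\<in>I. f i p *\<^sub>R D (E i) Y p)"
    using insert.prems by (intro insert.IH) auto
  finally show ?case by (simp only: sum.insert[OF insert.hyps(1,3)])
qed

lemma conn_sum_right:
  assumes W: "open W" "p \<in> W" and I: "finite I" "I \<noteq> {}" and E: "\<And>i. i \<in> I \<Longrightarrow> E i \<in> vector_fields A W"
    and f: "\<And>i. i \<in> I \<Longrightarrow> smooth_function A W (f i)" and X: "X \<in> vector_fields A W"
  shows "D X (\<lambda>q. \<Sum>i\<in>I. f i q *\<^sub>R E i q) p
    = (\<Sum>i\<in>I. f i p *\<^sub>R D X (E i) p + dir_deriv A (f i) p (X p) *\<^sub>R E i p)"
  using I E f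
proof (induction I rule: finite_ne_induct)
  case (singleton i)
  then show ?case using conn_scaleR_right[OF W X] by simp
next
  case (insert i I)
  have "D X (\<lambda>q. f i q *\<^sub>R E i q + (\<Sum>i\<in>I. f i q *\<^sub>R E i q)) p =
      D X (\<lambda>q. f i q *\<^sub>R E i q) p + D X (\<lambda>q. \<Sum>i\<in>I. f i q *\<^sub>R E i q) p"
    using insert by (intro conn_add_right[OF W X] vector_fields_sum vector_fields_scaleR W) auto
  also have "D X (\<lambda>q. f i q *\<^sub>R E i q) p = f i p *\<^sub>R D X (E i) p + dir_deriv A (f i) p (X p) *\<^sub>R E i p"
    using insert.prems by (intro conn_scaleR_right[OF W X]) auto
  also have "D X (\<lambda>q. \<Sum>i\<in>I. f i q *\<^sub>R E i q) p
      = (\<Sum>i\<in>I. f i p *\<^sub>R D X (E i) p + dir_deriv A (f i) p (X p) *\<^sub>R E i p)"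
    using insert.prems by (intro insert.IH) auto
  finally show ?case by (simp only: sum.insert[OF insert.hyps(1,3)])
qed

lemma coordinate_expansion:
  assumes W: "open W" and k: "\<kappa> \<in> A" and X: "X \<in> vector_fields A W"
  shows "\<And>b. smooth_function A (W \<inter> fst \<kappa>) (\<lambda>q. X q \<kappa> \<bullet> b)"
    and "q \<in> W \<inter> fst \<kappa> \<Longrightarrow> X q = (\<Sum>b\<in>Basis. (X q \<kappa> \<bullet> b) *\<^sub>R coord_vec A \<kappa> q b)"
    and "(\<lambda>q. \<Sum>b\<in>Basis. (X q \<kappa> \<bullet> b) *\<^sub>R coord_vec A \<kappa> q b) \<in> vector_fields A (W \<inter> fst \<kappa>)"
proof -
  have W': "open (W \<inter> fst \<kappa>)" using W chart_open[OF k] by blast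
  show f: "smooth_function A (W \<inter> fst \<kappa>) (\<lambda>q. X q \<kappa> \<bullet> b)" for b
    by (rule smooth_function_via_chart[OF k W' Int_lower2])
      (intro smooth_on_inner chart_image_Int_open[OF k W] vector_field_smooth[OF X k])
  show "(\<lambda>q. \<Sum>b\<in>Basis. (X q \<kappa> \<bullet> b) *\<^sub>R coord_vec A \<kappa> q b) \<in> vector_fields A (W \<inter> fst \<kappa>)"
    by (intro vector_fields_sum[OF W'] vector_fields_scaleR[OF W' _ f]
        vector_fields_mono[OF coord_vec_field[OF k] Int_lower2]) auto
  show "X q = (\<Sum>b\<in>Basis. (X q \<kappa> \<bullet> b) *\<^sub>R coord_vec A \<kappa> q b)" if q: "q \<in> W \<inter> fst \<kappa>"
  proof -
    have "linear (coord_vec A \<kappa> q)"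
      by (rule linearI) (use q in \<open>auto simp: coord_vec_add[OF k] coord_vec_scaleR[OF k]\<close>)
    from linear_Basis_expand[OF this, of "X q \<kappa>"] show ?thesis
      using coord_vec_components[OF vector_field_tangent[OF X] k] q by simp
  qed
qed

lemma conn_expand_left:
  assumes W: "open W" "p \<in> W" and k: "\<kappa> \<in> A" "p \<in> fst \<kappa>" and X: "X \<in> vector_fields A W" and Y: "Y \<in> vector_fields A W"
  shows "D X Y p = (\<Sum>b\<in>Basis. (X p \<kappa> \<bullet> b) *\<^sub>R D (\<lambda>q. coord_vec A \<kappa> q b) Y p)"
proof -
  have W': "open (W \<inter> fst \<kappa>)" "p \<in> W \<inter> fst \<kappa>" using W k chart_open[OF k(1)] by auto
  note Y' = vector_fields_mono[OF Y Int_lower1]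
  have "D X Y p = D (\<lambda>q. \<Sum>b\<in>Basis. (X q \<kappa> \<bullet> b) *\<^sub>R coord_vec A \<kappa> q b) Y p"
    by (rule conn_local[OF W' vector_fields_mono[OF X Int_lower1] coordinate_expansion(3)[OF W(1) k(1) X]
        coordinate_expansion(2)[OF W(1) k(1) X] Y' Y' refl])
  also have "\<dots> = (\<Sum>b\<in>Basis. (X p \<kappa> \<bullet> b) *\<^sub>R D (\<lambda>q. coord_vec A \<kappa> q b) Y p)"
    by (rule conn_sum_left[OF W' finite_Basis _ vector_fields_mono[OF coord_vec_field[OF k(1)] Int_lower2]
        coordinate_expansion(1)[OF W(1) k(1) X] Y']) simp
  finally show ?thesis .
qed

lemma conn_expand_right:
  assumes W: "open W" "p \<in> W" and X: "X \<in> vector_fields A W" and Y: "Y \<in> vector_fields A W"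
  defines "\<kappa> \<equiv> chart_at A p"
  shows "D X Y p = (\<Sum>b\<in>Basis. (Y p \<kappa> \<bullet> b) *\<^sub>R D X (\<lambda>q. coord_vec A \<kappa> q b) p)
     + coord_vec A \<kappa> p (comp_deriv \<kappa> p Y (X p \<kappa>))"
proof -
  have k: "\<kappa> \<in> A" "p \<in> fst \<kappa>" by (simp_all add: \<kappa>_def chart_at)
  have W': "open (W \<inter> fst \<kappa>)" "p \<in> W \<inter> fst \<kappa>" using W k chart_open[OF k(1)] by auto
  note X' = vector_fields_mono[OF X Int_lower1]
  have d: "dir_deriv A (\<lambda>q. Y q \<kappa> \<bullet> b) p (X p) = comp_deriv \<kappa> p Y (X p \<kappa>) \<bullet> b" for b
    using frechet_eqI[OF has_derivative_inner_left[OF vector_field_has_derivative[OF Y k(1) W(2) k(2)]]]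
    by (simp add: dir_deriv_def o_def flip: \<kappa>_def)
  have lin: "linear (coord_vec A \<kappa> p)"
    by (rule linearI) (use k in \<open>auto simp: coord_vec_add coord_vec_scaleR\<close>)
  have "D X Y p = D X (\<lambda>q. \<Sum>b\<in>Basis. (Y q \<kappa> \<bullet> b) *\<^sub>R coord_vec A \<kappa> q b) p"
    by (rule conn_local[OF W' X' X' refl vector_fields_mono[OF Y Int_lower1] coordinate_expansion(3)[OF W(1) k(1) Y]
        coordinate_expansion(2)[OF W(1) k(1) Y]])
  also have "\<dots> = (\<Sum>b\<in>Basis. (Y p \<kappa> \<bullet> b) *\<^sub>R D X (\<lambda>q. coord_vec A \<kappa> q b) p
      + dir_deriv A (\<lambda>q. Y q \<kappa> \<bullet> b) p (X p) *\<^sub>R coord_vec A \<kappa> p b)"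
    by (rule conn_sum_right[OF W' finite_Basis _ vector_fields_mono[OF coord_vec_field[OF k(1)] Int_lower2]
        coordinate_expansion(1)[OF W(1) k(1) Y] X']) simp
  finally show ?thesis
    by (simp add: sum.distrib d linear_Basis_expand[OF lin, of "comp_deriv \<kappa> p Y (X p \<kappa>)"])
qed

text \<open>The Christoffel symbols, as a bilinear map on the tangent space at \<open>p\<close>.\<close>

definition christoffel :: "'m \<Rightarrow> ('m, 'e) tangent \<Rightarrow> ('m, 'e) tangent \<Rightarrow> ('m, 'e) tangent" where
  "christoffel p u w = D (const_ext A p u) (const_ext A p w) p"

lemma christoffel_tangent: "christoffel p u w \<in> tangent_space A p"
  unfolding christoffel_def
  using vector_field_tangent[OF conn_field[OF chart_open[OF chart_at(1)] chart_at(2) const_ext_field const_ext_field] chart_at(2)] .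

text \<open>The connection is tensorial in \<open>X\<close>, and in \<open>Y\<close> it satisfies the Leibniz rule with the components of \<open>Y\<close> as
  coefficients of the coordinate fields. For constant extensions the derivatives of components vanish.\<close>

lemma conn_coord:
  assumes W: "open W" "p \<in> W" and X: "X \<in> vector_fields A W" and Y: "Y \<in> vector_fields A W"
  defines "\<kappa> \<equiv> chart_at A p"
  shows "D X Y p = coord_vec A \<kappa> p (comp_deriv \<kappa> p Y (X p \<kappa>)) + christoffel p (X p) (Y p)"
proof -
  have k: "\<kappa> \<in> A" "p \<in> fst \<kappa>" by (simp_all add: \<kappa>_def chart_at)
  note t = vector_field_tangent[OF X W(2)] vector_field_tangent[OF Y W(2)]
  note C = const_ext_field[of p, folded \<kappa>_def]
  have "D X (\<lambda>q. coord_vec A \<kappa> q b) p = D (const_ext A p (X p)) (\<lambda>q. coord_vec A \<kappa> q b) p" for b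
    using conn_expand_left[OF open_Int[OF W(1) chart_open[OF k(1)]] _ k vector_fields_mono[OF X Int_lower1]
          vector_fields_mono[OF coord_vec_field[OF k(1)] Int_lower2], of b]
      conn_expand_left[OF chart_open[OF k(1)] k(2) k C coord_vec_field[OF k(1)], of "X p" b]
      W k const_ext_at[OF t(1)] by simp
  moreover have "coord_vec A \<kappa> p 0 = 0"
    using coord_vec_scaleR[OF k, of 0 0] by simp
  ultimately show ?thesis
    using conn_expand_right[OF W X Y] conn_expand_right[OF chart_open[OF k(1)] k(2) C C, of "X p" "Y p"]
      const_ext_at[OF t(2)] const_ext_derivative_0[of p "Y p"]
    by (simp add: christoffel_def flip: \<kappa>_def)
qed

text \<open>The derivatives of components cancel against the bracket, so torsion is tensorial and may be computed from
  whatever extensions of two vectors are convenient.\<close>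

lemma torsion_coord:
  assumes W: "open W" "p \<in> W" and X: "X \<in> vector_fields A W" and Y: "Y \<in> vector_fields A W"
  shows "torsion A D X Y p = christoffel p (X p) (Y p) - christoffel p (Y p) (X p)"
proof -
  let ?\<kappa> = "chart_at A p"
  have "lie_bracket A X Y p = coord_vec A ?\<kappa> p (comp_deriv ?\<kappa> p Y (X p ?\<kappa>)) - coord_vec A ?\<kappa> p (comp_deriv ?\<kappa> p X (Y p ?\<kappa>))"
    by (rule tangent_eqI[OF lie_bracket_tangent[OF W X Y] _ chart_at])
      (simp_all add: subspace_diff[OF tangent_space_subspace] coord_vec_tangent chart_at coord_vec_same lie_bracket_component)
  then show ?thesis by (simp add: torsion_def conn_coord[OF W X Y] conn_coord[OF W Y X])
qed

lemma metric_christoffel: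
  assumes g: "smooth_bilin A g" and m: "metric_connection A g D"
    and t: "u \<in> tangent_space A p" "v \<in> tangent_space A p" "w \<in> tangent_space A p"
  defines "\<kappa> \<equiv> chart_at A p"
  shows "bilin_deriv g \<kappa> p (u \<kappa>) (v \<kappa>) (w \<kappa>) = g p (christoffel p u v) w + g p v (christoffel p u w)"
proof -
  let ?C = "const_ext A p"
  have k: "\<kappa> \<in> A" "p \<in> fst \<kappa>" by (simp_all add: \<kappa>_def chart_at)
  have "dir_deriv A (\<lambda>q. g q (?C v q) (?C w q)) p (?C u p) = g p (D (?C u) (?C v) p) (?C w p) + g p (?C v p) (D (?C u) (?C w) p)"
    by (rule m[unfolded metric_connection_def, rule_format, OF chart_open[OF chart_at(1)]
        const_ext_field const_ext_field const_ext_field chart_at(2)])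
  moreover have "dir_deriv A (\<lambda>q. g q (?C v q) (?C w q)) p (?C u p) = bilin_deriv g \<kappa> p (u \<kappa>) (v \<kappa>) (w \<kappa>)"
    using dir_deriv_bilin[OF g chart_open[OF chart_at(1)] chart_at(2) const_ext_field const_ext_field, of p v w "?C u p"]
      linear_0[OF bilin_coord_linear_left[OF g k(1)]] linear_0[OF bilin_coord_linear_right[OF g k(1)]]
    by (simp add: const_ext_at t const_ext_derivative_0 \<kappa>_def)
  ultimately show ?thesis by (simp add: christoffel_def const_ext_at t)
qed

end

section \<open>Smooth maps into the manifold\<close>

definition smooth_into ::
  "('m::topological_space, 'e::euclidean_space) chart set \<Rightarrow> 'b::real_normed_vector set \<Rightarrow> ('b \<Rightarrow> 'm) \<Rightarrow> bool" where
  "smooth_into A T F \<longleftrightarrow> open T \<and> continuous_on T F \<and> (\<forall>\<kappa>\<in>A. smooth_on (T \<inter> F -` fst \<kappa>) (snd \<kappa> \<circ> F))"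

definition pushforward ::
  "('m, 'e::euclidean_space) chart set \<Rightarrow> ('b::real_normed_vector \<Rightarrow> 'm) \<Rightarrow> 'b \<Rightarrow> 'b \<Rightarrow> ('m, 'e) tangent" where
  "pushforward A F z d = (\<lambda>\<kappa>. if \<kappa> \<in> A \<and> F z \<in> fst \<kappa> then fderiv (snd \<kappa> \<circ> F) z d else 0)"

lemma smooth_map_on_iff_extension:
  "smooth_map_on A S f \<longleftrightarrow> (\<exists>T F. smooth_into A T F \<and> S \<subseteq> T \<and> (\<forall>x\<in>S. F x = f x))"
  unfolding smooth_map_on_def smooth_into_def by blast

context smooth_manifold begin

lemma smooth_into_open: "smooth_into A T F \<Longrightarrow> open T"
  by (simp add: smooth_into_def)

lemma smooth_into_chart_open: "smooth_into A T F \<Longrightarrow> \<kappa> \<in> A \<Longrightarrow> open (T \<inter> F -` fst \<kappa>)"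
  using continuous_open_preimage chart_open unfolding smooth_into_def by blast

lemma smooth_into_chart: "smooth_into A T F \<Longrightarrow> \<kappa> \<in> A \<Longrightarrow> smooth_on (T \<inter> F -` fst \<kappa>) (snd \<kappa> \<circ> F)"
  by (simp add: smooth_into_def)

lemma smooth_into_compose:
  fixes h :: "'b::real_normed_vector \<Rightarrow> 'c::euclidean_space"
  assumes F: "smooth_into A T F" and T': "open T'" "h ` T' \<subseteq> T" and h: "smooth_on T' h"
  shows "smooth_into A T' (\<lambda>z. F (h z))"
  unfolding smooth_into_def
proof (intro conjI ballI)
  show c: "continuous_on T' (\<lambda>z. F (h z))"
    using F smooth_on_continuous[OF h] T'(2) unfolding smooth_into_def by (blast intro: continuous_on_compose2)
  fix \<kappa> assume k: "\<kappa> \<in> A"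
  have "open (T' \<inter> (\<lambda>z. F (h z)) -` fst \<kappa>)"
    using continuous_open_preimage[OF c T'(1)] chart_open[OF k] by blast
  then show "smooth_on (T' \<inter> (\<lambda>z. F (h z)) -` fst \<kappa>) (snd \<kappa> \<circ> (\<lambda>z. F (h z)))"
    using smooth_on_compose[OF _ _ smooth_on_subset[OF h] smooth_into_chart[OF F k], of "T' \<inter> (\<lambda>z. F (h z)) -` fst \<kappa>"] T'(2)
    by (auto simp: o_def)
qed (rule T'(1))

lemma pushforward_component:
  "\<kappa> \<in> A \<Longrightarrow> F z \<in> fst \<kappa> \<Longrightarrow> pushforward A F z d \<kappa> = fderiv (snd \<kappa> \<circ> F) z d"
  by (simp add: pushforward_def)

lemma pushforward_tangent:
  assumes F: "smooth_into A T F" and z: "z \<in> T"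
  shows "pushforward A F z d \<in> tangent_space A (F z)"
proof (rule tangent_spaceI)
  show "pushforward A F z d \<kappa> = 0" if "\<not> (\<kappa> \<in> A \<and> F z \<in> fst \<kappa>)" for \<kappa>
    using that by (auto simp: pushforward_def)
  fix \<kappa> \<kappa>' assume k: "\<kappa> \<in> A" "\<kappa>' \<in> A" "F z \<in> fst \<kappa>" "F z \<in> fst \<kappa>'"
  have 1: "((snd \<kappa> \<circ> F) has_derivative fderiv (snd \<kappa> \<circ> F) z) (at z)"
    using k z by (intro smooth_on_has_derivative[OF smooth_into_chart[OF F k(1)]]) auto
  have 2: "((snd \<kappa>' \<circ> cinv \<kappa>) has_derivative J \<kappa> \<kappa>' (F z)) (at ((snd \<kappa> \<circ> F) z))"
    using J_has_derivative[OF k] by simp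
  have "((\<lambda>z. (snd \<kappa>' \<circ> cinv \<kappa>) ((snd \<kappa> \<circ> F) z)) has_derivative
      (\<lambda>d. J \<kappa> \<kappa>' (F z) (fderiv (snd \<kappa> \<circ> F) z d))) (at z)"
    by (rule has_derivative_compose[OF 1 2])
  then have "((snd \<kappa>' \<circ> F) has_derivative
      (\<lambda>d. J \<kappa> \<kappa>' (F z) (fderiv (snd \<kappa> \<circ> F) z d))) (at z)"
    by (rule has_derivative_transform_within_open[OF _ smooth_into_chart_open[OF F k(1)]])
      (use k z in \<open>auto simp: cinv_chart\<close>)
  from frechet_eqI[OF this] show "pushforward A F z d \<kappa>' = J \<kappa> \<kappa>' (F z) (pushforward A F z d \<kappa>)"
    using k by (simp add: pushforward_component)
qed

subsection \<open>Velocities of curves on the unit interval\<close>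

lemma velocity_cong:
  assumes "\<And>t. t \<in> {0..1} \<Longrightarrow> c t = c' t" "t \<in> {0..1}"
  shows "velocity A c t = velocity A c' t"
proof -
  have "vector_derivative (snd \<kappa> \<circ> c) (at t within {0..1}) = vector_derivative (snd \<kappa> \<circ> c') (at t within {0..1})" for \<kappa> :: "('m, 'e) chart"
    using assms by (intro vector_derivative_cong_eq always_eventually) auto
  then show ?thesis using assms by (simp add: velocity_def cong: if_cong)
qed

text \<open>The derivatives along a curve are computed from any smooth extension \<open>C\<close> of the curve
  beyond its endpoints.\<close>

lemma
  assumes C: "smooth_into A T C" and T: "{0..1} \<subseteq> T" and c: "\<And>t. t \<in> {0..1} \<Longrightarrow> C t = c t"
    and t: "t \<in> {0..1}"
  shows velocity_extension: "velocity A c t = pushforward A C t 1"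
    and curve_has_vector_derivative: "\<kappa> \<in> A \<Longrightarrow> c t \<in> fst \<kappa> \<Longrightarrow>
      ((snd \<kappa> \<circ> c) has_vector_derivative velocity A c t \<kappa>) (at t within {0..1})"
    and velocity_has_vector_derivative: "\<kappa> \<in> A \<Longrightarrow> c t \<in> fst \<kappa> \<Longrightarrow>
      ((\<lambda>s. velocity A c s \<kappa>) has_vector_derivative
        fderiv (\<lambda>s. fderiv (snd \<kappa> \<circ> C) s 1) t 1) (at t within {0..1})"
proof -
  have d: "(f has_vector_derivative fderiv f s 1) (at s within X)"
    if "smooth_on S f" "s \<in> S" for f :: "real \<Rightarrow> 'e" and s X S
  proof -
    have "f differentiable at s" using smooth_on_differentiable that by blast
    from frechet_derivative_eq_vector_derivative[OF this]
    have "fderiv f s 1 = vector_derivative f (at s)" by simp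
    then show ?thesis
      using \<open>f differentiable at s\<close> vector_derivative_works has_vector_derivative_at_within by metis
  qed
  have C1: "((snd \<kappa> \<circ> c) has_vector_derivative fderiv (snd \<kappa> \<circ> C) s 1) (at s within {0..1})"
    if "\<kappa> \<in> A" "s \<in> {0..1}" "c s \<in> fst \<kappa>" for \<kappa> s
    by (rule has_vector_derivative_transform[OF _ _ d[OF smooth_into_chart[OF C that(1)]]])
      (use that c T in auto)
  have v: "velocity A c s \<kappa> = fderiv (snd \<kappa> \<circ> C) s 1"
    if "\<kappa> \<in> A" "s \<in> {0..1}" "c s \<in> fst \<kappa>" for \<kappa> s
    using vector_derivative_within_closed_interval[OF _ that(2) C1[OF that]] that by (simp add: velocity_def)
  show ve: "velocity A c t = pushforward A C t 1"
  proof
    fix \<kappa>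
    show "velocity A c t \<kappa> = pushforward A C t 1 \<kappa>"
      using v[of \<kappa> t] t c[OF t] by (cases "\<kappa> \<in> A \<and> c t \<in> fst \<kappa>") (auto simp: velocity_def pushforward_def)
  qed
  assume k: "\<kappa> \<in> A" "c t \<in> fst \<kappa>"
  show "((snd \<kappa> \<circ> c) has_vector_derivative velocity A c t \<kappa>) (at t within {0..1})"
    using C1[OF k(1) t k(2)] v[OF k(1) t k(2)] by simp
  have O: "open (T \<inter> C -` fst \<kappa>)" "t \<in> T \<inter> C -` fst \<kappa>"
    using smooth_into_chart_open[OF C k(1)] T t c[OF t] k by auto
  then obtain r where r: "r > 0" "ball t r \<subseteq> T \<inter> C -` fst \<kappa>" using openE by blast
  show "((\<lambda>s. velocity A c s \<kappa>) has_vector_derivative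
        fderiv (\<lambda>s. fderiv (snd \<kappa> \<circ> C) s 1) t 1) (at t within {0..1})"
  proof (rule has_vector_derivative_transform_within[OF d[OF smooth_on_frechet[OF smooth_into_chart[OF C k(1)]] O(2)] r(1) t])
    fix s :: real assume s: "s \<in> {0..1}" "dist s t < r"
    then have "s \<in> ball t r" by (simp add: dist_commute)
    then have "C s \<in> fst \<kappa>" using r by auto
    then show "fderiv (snd \<kappa> \<circ> C) s 1 = velocity A c s \<kappa>"
      using v[OF k(1) s(1)] c[OF s(1)] by simp
  qed
qed

end

section \<open>The first variation of the action\<close>

definition lagrangian :: "('m, 'e::euclidean_space) bilin \<Rightarrow> ('m, 'e) form \<Rightarrow> 'm \<Rightarrow> ('m, 'e) tangent \<Rightarrow> real" where
  "lagrangian g a p v = 1/2 * g p v v - a p v"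

context smooth_manifold begin

definition action :: "('m, 'e) bilin \<Rightarrow> ('m, 'e) form \<Rightarrow> (real \<Rightarrow> 'm) \<Rightarrow> real" where
  "action g a c = integral {0..1} (\<lambda>t. lagrangian g a (c t) (velocity A c t))"

abbreviation velocity_deriv :: "('m, 'e) chart \<Rightarrow> (real \<Rightarrow> 'm) \<Rightarrow> real \<Rightarrow> 'e" where
  "velocity_deriv \<kappa> c t \<equiv> vector_derivative (\<lambda>s. velocity A c s \<kappa>) (at t within {0..1})"

text \<open>The Euler-Lagrange expression of the Lagrangian \<open>1/2 g(v, v) - a(v)\<close> along \<open>c\<close>, in the coordinates \<open>\<kappa>\<close> and
  paired with a coordinate vector \<open>w\<close>.\<close>

definition euler_lagrange ::
  "('m, 'e) bilin \<Rightarrow> ('m, 'e) form \<Rightarrow> ('m, 'e) chart \<Rightarrow> (real \<Rightarrow> 'm) \<Rightarrow> real \<Rightarrow> 'e \<Rightarrow> real" where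
  "euler_lagrange g a \<kappa> c t w = (let u = velocity A c t \<kappa>; u' = velocity_deriv \<kappa> c t in
     bilin_deriv g \<kappa> (c t) u u w + bilin_coord A g \<kappa> (snd \<kappa> (c t)) u' w - 1/2 * bilin_deriv g \<kappa> (c t) w u u
     - form_deriv a \<kappa> (c t) u w + form_deriv a \<kappa> (c t) w u)"

lemma pushforward_smooth_component:
  "smooth_into A T F \<Longrightarrow> \<kappa> \<in> A \<Longrightarrow> smooth_on (T \<inter> F -` fst \<kappa>) (\<lambda>z. pushforward A F z d \<kappa>)"
  by (rule smooth_on_cong[OF smooth_into_chart_open _ smooth_on_frechet[OF smooth_into_chart]])
    (auto simp: pushforward_component)

lemma
  fixes F :: "'b::euclidean_space \<Rightarrow> 'm"
  assumes F: "smooth_into A T F" and g: "smooth_bilin A g" and a: "smooth_form A a"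
  shows smooth_on_bilin_pushforward: "smooth_on T (\<lambda>z. g (F z) (pushforward A F z d) (pushforward A F z d'))"
    and smooth_on_form_pushforward: "smooth_on T (\<lambda>z. a (F z) (pushforward A F z d))"
proof -
  have loc: "\<exists>S. open S \<and> z \<in> S \<and> smooth_on S (\<lambda>z. g (F z) (pushforward A F z d) (pushforward A F z d'))
     \<and> smooth_on S (\<lambda>z. a (F z) (pushforward A F z d))" if z: "z \<in> T" for z
  proof -
    let ?\<kappa> = "chart_at A (F z)"
    let ?O = "T \<inter> F -` fst ?\<kappa>"
    note k = chart_at(1)[of "F z"]
    note O = smooth_into_chart_open[OF F k]
    have "smooth_on ?O (\<lambda>z. bilin_coord A g ?\<kappa> ((snd ?\<kappa> \<circ> F) z) (pushforward A F z d ?\<kappa>) (pushforward A F z d' ?\<kappa>))"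
      by (rule smooth_on_bilin_along[OF bilin_coord_linear_right[OF g k] bilin_coord_linear_left[OF g k]
          bilin_coord_smooth[OF g k] O _ smooth_into_chart[OF F k]
          pushforward_smooth_component[OF F k] pushforward_smooth_component[OF F k]]) auto
    then have 1: "smooth_on ?O (\<lambda>z. g (F z) (pushforward A F z d) (pushforward A F z d'))"
      by (rule smooth_on_cong[OF O, rotated]) (simp add: bilin_coord_eval[OF k] pushforward_tangent[OF F])
    have "smooth_on ?O (\<lambda>z. form_coord A a ?\<kappa> ((snd ?\<kappa> \<circ> F) z) (pushforward A F z d ?\<kappa>))"
      by (rule smooth_on_form_along[OF form_coord_linear[OF a k] form_coord_smooth[OF a k] O _ smooth_into_chart[OF F k]
          pushforward_smooth_component[OF F k]]) auto
    then have 2: "smooth_on ?O (\<lambda>z. a (F z) (pushforward A F z d))"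
      by (rule smooth_on_cong[OF O, rotated]) (simp add: form_coord_eval[OF k] pushforward_tangent[OF F])
    show ?thesis using O 1 2 z chart_at(2)[of "F z"] by blast
  qed
  show "smooth_on T (\<lambda>z. g (F z) (pushforward A F z d) (pushforward A F z d'))"
    by (rule smooth_on_locally) (use loc in blast)
  show "smooth_on T (\<lambda>z. a (F z) (pushforward A F z d))"
    by (rule smooth_on_locally) (use loc in blast)
qed

lemma pushforward_has_derivative:
  fixes F :: "'b::euclidean_space \<Rightarrow> 'm"
  assumes F: "smooth_into A T F" and z: "z \<in> T" and k: "\<kappa> \<in> A" "F z \<in> fst \<kappa>"
  shows "((snd \<kappa> \<circ> F) has_derivative (\<lambda>e. pushforward A F z e \<kappa>)) (at z)"
    and "((\<lambda>z. pushforward A F z d \<kappa>) has_derivative fderiv (\<lambda>z. pushforward A F z d \<kappa>) z) (at z)"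
  using smooth_on_has_derivative[OF smooth_into_chart[OF F k(1)], of z]
    smooth_on_has_derivative[OF pushforward_smooth_component[OF F k(1)], of z d] z k
  by (simp_all add: pushforward_component)

lemma pushforward_derivative_symmetric:
  fixes F :: "'b::euclidean_space \<Rightarrow> 'm"
  assumes F: "smooth_into A T F" and z: "z \<in> T" and k: "\<kappa> \<in> A" "F z \<in> fst \<kappa>"
  shows "fderiv (\<lambda>z. pushforward A F z d \<kappa>) z d' = fderiv (\<lambda>z. pushforward A F z d' \<kappa>) z d"
proof -
  have O: "open (T \<inter> F -` fst \<kappa>)" "z \<in> T \<inter> F -` fst \<kappa>"
    using smooth_into_chart_open[OF F k(1)] z k by auto
  have "fderiv (\<lambda>z. pushforward A F z d \<kappa>) z = fderiv (\<lambda>z. fderiv (snd \<kappa> \<circ> F) z d) z" for d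
    by (rule frechet_derivative_transform_within_open[OF smooth_on_differentiable[OF pushforward_smooth_component[OF F k(1)] O(2)] O])
      (use k in \<open>auto simp: pushforward_component\<close>)
  then show ?thesis
    using second_derivative_symmetric[OF O smooth_into_chart[OF F k(1)], of d d'] by simp
qed

lemma bilin_pushforward_derivative:
  fixes F :: "'b::euclidean_space \<Rightarrow> 'm"
  assumes F: "smooth_into A T F" and z: "z \<in> T" and k: "\<kappa> \<in> A" "F z \<in> fst \<kappa>"
    and g: "smooth_bilin A g"
  shows "fderiv (\<lambda>z. g (F z) (pushforward A F z d) (pushforward A F z d')) z e
      = bilin_deriv g \<kappa> (F z) (pushforward A F z e \<kappa>) (pushforward A F z d \<kappa>) (pushforward A F z d' \<kappa>)
        + bilin_coord A g \<kappa> (snd \<kappa> (F z)) (fderiv (\<lambda>z. pushforward A F z d \<kappa>) z e) (pushforward A F z d' \<kappa>)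
        + bilin_coord A g \<kappa> (snd \<kappa> (F z)) (pushforward A F z d \<kappa>) (fderiv (\<lambda>z. pushforward A F z d' \<kappa>) z e)"
proof (rule frechet_eqI)
  have img: "(snd \<kappa> \<circ> F) z \<in> snd \<kappa> ` fst \<kappa>" using k by auto
  note P = pushforward_has_derivative[OF F z k]
  show "((\<lambda>z. g (F z) (pushforward A F z d) (pushforward A F z d')) has_derivative (\<lambda>e.
      bilin_deriv g \<kappa> (F z) (pushforward A F z e \<kappa>) (pushforward A F z d \<kappa>) (pushforward A F z d' \<kappa>)
        + bilin_coord A g \<kappa> (snd \<kappa> (F z)) (fderiv (\<lambda>z. pushforward A F z d \<kappa>) z e) (pushforward A F z d' \<kappa>)
        + bilin_coord A g \<kappa> (snd \<kappa> (F z)) (pushforward A F z d \<kappa>) (fderiv (\<lambda>z. pushforward A F z d' \<kappa>) z e))) (at z)"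
    by (rule has_derivative_transform_within_open[OF
          bilin_along_has_derivative[OF bilin_coord_linear_right[OF g k(1)] bilin_coord_linear_left[OF g k(1)]
            bilin_coord_differentiable[OF g k(1) img] P(1,2,2), simplified comp_apply] smooth_into_chart_open[OF F k(1)]])
      (use z k in \<open>auto simp: bilin_coord_eval pushforward_tangent[OF F]\<close>)
qed

lemma form_pushforward_derivative:
  fixes F :: "'b::euclidean_space \<Rightarrow> 'm"
  assumes F: "smooth_into A T F" and z: "z \<in> T" and k: "\<kappa> \<in> A" "F z \<in> fst \<kappa>"
    and a: "smooth_form A a"
  shows "fderiv (\<lambda>z. a (F z) (pushforward A F z d)) z e
      = form_deriv a \<kappa> (F z) (pushforward A F z e \<kappa>) (pushforward A F z d \<kappa>)
        + form_coord A a \<kappa> (snd \<kappa> (F z)) (fderiv (\<lambda>z. pushforward A F z d \<kappa>) z e)"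
proof (rule frechet_eqI)
  have img: "(snd \<kappa> \<circ> F) z \<in> snd \<kappa> ` fst \<kappa>" using k by auto
  note P = pushforward_has_derivative[OF F z k]
  show "((\<lambda>z. a (F z) (pushforward A F z d)) has_derivative (\<lambda>e.
      form_deriv a \<kappa> (F z) (pushforward A F z e \<kappa>) (pushforward A F z d \<kappa>)
        + form_coord A a \<kappa> (snd \<kappa> (F z)) (fderiv (\<lambda>z. pushforward A F z d \<kappa>) z e))) (at z)"
    by (rule has_derivative_transform_within_open[OF
          form_along_has_derivative[OF form_coord_linear[OF a k(1)]
            form_coord_differentiable[OF a k(1) img] P, simplified comp_apply] smooth_into_chart_open[OF F k(1)]])
      (use z k in \<open>auto simp: form_coord_eval pushforward_tangent[OF F]\<close>)
qed

lemma slice_has_derivative: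
  fixes f :: "real \<times> real \<Rightarrow> 'b::real_normed_vector"
  assumes "smooth_on S f" "(s, t) \<in> S"
  shows "((\<lambda>t. f (s, t)) has_vector_derivative fderiv f (s, t) (0, 1)) (at t within X)"
    and "((\<lambda>s. f (s, t)) has_vector_derivative fderiv f (s, t) (1, 0)) (at s within X)"
proof -
  note d = smooth_on_has_derivative[OF assms]
  note lin = linear_frechet_derivative[OF smooth_on_differentiable[OF assms]]
  have "((\<lambda>t. (s, t)) has_derivative (\<lambda>v. (0, v))) (at t within X)"
    "((\<lambda>s. (s, t)) has_derivative (\<lambda>v. (v, 0))) (at s within X)"
    by (auto intro!: derivative_eq_intros)
  from this[THEN has_derivative_compose, OF d]
  show "((\<lambda>t. f (s, t)) has_vector_derivative fderiv f (s, t) (0, 1)) (at t within X)"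
    "((\<lambda>s. f (s, t)) has_vector_derivative fderiv f (s, t) (1, 0)) (at s within X)"
    unfolding has_vector_derivative_def by (simp_all flip: linear_scale[OF lin])
qed

lemma slice_smooth_into:
  fixes F :: "real \<times> real \<Rightarrow> 'm"
  assumes "smooth_into A T F" shows "smooth_into A (Pair s -` T) (\<lambda>t. F (s, t))"
proof (rule smooth_into_compose[OF assms])
  show "open (Pair s -` T)" by (rule open_vimage[OF smooth_into_open[OF assms]]) (intro continuous_intros)
  have "bounded_linear (\<lambda>t::real. (0::real, t))" by (rule bounded_linear_Pair) (auto intro: bounded_linear_intros)
  from smooth_on_add[OF \<open>open (Pair s -` T)\<close> smooth_on_const[of _ "(s, 0::real)"] smooth_on_bounded_linear[OF this]]
  show "smooth_on (Pair s -` T) (Pair s)" by simp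
qed auto

lemma slice_velocity:
  fixes F :: "real \<times> real \<Rightarrow> 'm"
  assumes F: "smooth_into A T F" and T: "\<And>t. t \<in> {0..1} \<Longrightarrow> (s, t) \<in> T" and t: "t \<in> {0..1}"
  shows "velocity A (\<lambda>t. F (s, t)) t = pushforward A F (s, t) (0, 1)"
proof
  fix \<kappa>
  show "velocity A (\<lambda>t. F (s, t)) t \<kappa> = pushforward A F (s, t) (0, 1) \<kappa>"
  proof (cases "\<kappa> \<in> A \<and> F (s, t) \<in> fst \<kappa>")
    case True
    then have "(s, t) \<in> T \<inter> F -` fst \<kappa>" using T[OF t] by simp
    from slice_has_derivative(1)[OF smooth_into_chart[OF F] this, of "{0..1}"] True
    have "((snd \<kappa> \<circ> (\<lambda>t. F (s, t))) has_vector_derivative fderiv (snd \<kappa> \<circ> F) (s, t) (0, 1)) (at t within {0..1})"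
      by (simp add: o_def)
    from vector_derivative_within_closed_interval[OF _ t this] True show ?thesis
      by (simp add: velocity_def pushforward_def)
  qed (auto simp: velocity_def pushforward_def)
qed

lemma slice_velocity_derivative:
  fixes F :: "real \<times> real \<Rightarrow> 'm"
  assumes F: "smooth_into A T F" and T: "\<And>t. t \<in> {0..1} \<Longrightarrow> (s, t) \<in> T" and t: "t \<in> {0..1}"
    and k: "\<kappa> \<in> A" "F (s, t) \<in> fst \<kappa>"
  shows "vector_derivative (\<lambda>t. velocity A (\<lambda>t. F (s, t)) t \<kappa>) (at t within {0..1})
    = fderiv (\<lambda>z. pushforward A F z (0, 1) \<kappa>) (s, t) (0, 1)"
proof (rule vector_derivative_within_closed_interval[OF _ t])
  have "(s, t) \<in> T \<inter> F -` fst \<kappa>" using T[OF t] k by simp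
  from slice_has_derivative(1)[OF pushforward_smooth_component[OF F k(1)] this, of "(0, 1)" "{0..1}"]
  show "((\<lambda>t. velocity A (\<lambda>t. F (s, t)) t \<kappa>) has_vector_derivative
      fderiv (\<lambda>z. pushforward A F z (0, 1) \<kappa>) (s, t) (0, 1)) (at t within {0..1})"
    by (rule has_vector_derivative_transform[rotated 2]) (use t slice_velocity[OF F T] in auto)
qed simp

lemma pushforward_constant_slice:
  fixes F :: "real \<times> real \<Rightarrow> 'm"
  assumes F: "smooth_into A T F" and T: "(0, t) \<in> T" and \<epsilon>: "0 < \<epsilon>"
    and const: "\<And>s. s \<in> {-\<epsilon><..<\<epsilon>} \<Longrightarrow> F (s, t) = q"
  shows "pushforward A F (0, t) (1, 0) = 0"
proof
  fix \<kappa>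
  show "pushforward A F (0, t) (1, 0) \<kappa> = 0 \<kappa>"
  proof (cases "\<kappa> \<in> A \<and> F (0, t) \<in> fst \<kappa>")
    case True
    then have "(0, t) \<in> T \<inter> F -` fst \<kappa>" using T by simp
    from slice_has_derivative(2)[OF smooth_into_chart[OF F] this, of UNIV] True
    have d1: "((\<lambda>s. (snd \<kappa> \<circ> F) (s, t)) has_vector_derivative fderiv (snd \<kappa> \<circ> F) (0, t) (1, 0)) (at 0)" by simp
    have d2: "((\<lambda>s. (snd \<kappa> \<circ> F) (s, t)) has_vector_derivative 0) (at 0)"
      by (rule has_vector_derivative_transform_within_open[OF has_vector_derivative_const[of "snd \<kappa> q"], of "{-\<epsilon><..<\<epsilon>}"])
        (use \<epsilon> const in auto)
    from vector_derivative_unique_at[OF d1 d2] show ?thesis using True by (simp add: pushforward_def)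
  qed (auto simp: pushforward_def)
qed

definition lagrangian_along :: "('m, 'e) bilin \<Rightarrow> ('m, 'e) form \<Rightarrow> (real \<times> real \<Rightarrow> 'm) \<Rightarrow> real \<times> real \<Rightarrow> real" where
  "lagrangian_along g a F z = lagrangian g a (F z) (pushforward A F z (0, 1))"

text \<open>The pairing of the momentum \<open>g(\<partial>\<^sub>tF, \<cdot>) - a\<close> with the variation field \<open>\<partial>\<^sub>sF\<close>, for a family \<open>F(s, t)\<close> of curves in \<open>t\<close>.\<close>

definition boundary_term :: "('m, 'e) bilin \<Rightarrow> ('m, 'e) form \<Rightarrow> (real \<times> real \<Rightarrow> 'm) \<Rightarrow> real \<times> real \<Rightarrow> real" where
  "boundary_term g a F z =
     g (F z) (pushforward A F z (0, 1)) (pushforward A F z (1, 0)) - a (F z) (pushforward A F z (1, 0))"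

definition variation_density :: "('m, 'e) bilin \<Rightarrow> ('m, 'e) form \<Rightarrow> (real \<times> real \<Rightarrow> 'm) \<Rightarrow> real \<Rightarrow> real" where
  "variation_density g a F t =
     fderiv (boundary_term g a F) (0, t) (0, 1) - fderiv (lagrangian_along g a F) (0, t) (1, 0)"

lemma
  assumes g: "smooth_bilin A g" and a: "smooth_form A a" and F: "smooth_into A T F"
  shows lagrangian_along_smooth: "smooth_on T (lagrangian_along g a F)"
    and boundary_term_smooth: "smooth_on T (boundary_term g a F)"
  unfolding lagrangian_along_def[abs_def] lagrangian_def boundary_term_def[abs_def]
  by (intro smooth_on_minus smooth_on_mult smooth_on_const smooth_on_bilin_pushforward[OF F g a]
      smooth_on_form_pushforward[OF F g a] smooth_into_open[OF F])+

text \<open>The left-hand side does not mention charts, so neither \<open>\<kappa>\<close> nor the way in which charts cover the curve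
  matters. In coordinates the terms with \<open>\<partial>\<^sub>s\<partial>\<^sub>tF\<close> cancel, by symmetry of second derivatives.\<close>

lemma variation_density_euler_lagrange:
  assumes g: "smooth_bilin A g" and a: "smooth_form A a" and F: "smooth_into A T F"
    and T: "\<And>t. t \<in> {0..1} \<Longrightarrow> (0, t) \<in> T" and c: "\<And>t. t \<in> {0..1} \<Longrightarrow> F (0, t) = c t"
    and t: "t \<in> {0..1}" and k: "\<kappa> \<in> A" "c t \<in> fst \<kappa>"
  shows "variation_density g a F t = euler_lagrange g a \<kappa> c t (pushforward A F (0, t) (1, 0) \<kappa>)"
proof -
  let ?ds = "(1::real, 0::real)" and ?dt = "(0::real, 1::real)" and ?z = "(0, t)"
  have k': "F ?z \<in> fst \<kappa>" using k c[OF t] by simp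
  note z = T[OF t]
  note dG = smooth_on_has_derivative[OF smooth_on_bilin_pushforward[OF F g a] z]
    and dH = smooth_on_has_derivative[OF smooth_on_form_pushforward[OF F g a] z]
  have DE: "fderiv (lagrangian_along g a F) ?z d
      = 1/2 * fderiv (\<lambda>z. g (F z) (pushforward A F z ?dt) (pushforward A F z ?dt)) ?z d
      - fderiv (\<lambda>z. a (F z) (pushforward A F z ?dt)) ?z d" for d
    unfolding lagrangian_along_def[abs_def] lagrangian_def
    by (rule frechet_eqI) (intro has_derivative_diff has_derivative_mult_right dG dH)
  have DP: "fderiv (boundary_term g a F) ?z d
      = fderiv (\<lambda>z. g (F z) (pushforward A F z ?dt) (pushforward A F z ?ds)) ?z d
      - fderiv (\<lambda>z. a (F z) (pushforward A F z ?ds)) ?z d" for d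
    unfolding boundary_term_def[abs_def]
    by (rule frechet_eqI) (intro has_derivative_diff dG dH)
  have vc: "velocity A c s = velocity A (\<lambda>t. F (0, t)) s" if "s \<in> {0..1}" for s
    using velocity_cong[of c "\<lambda>t. F (0, t)" s] c that by simp
  then have u: "velocity A c t = pushforward A F ?z ?dt"
    using slice_velocity[OF F T t] t by simp
  have "velocity_deriv \<kappa> c t
      = vector_derivative (\<lambda>s. velocity A (\<lambda>t. F (0, t)) s \<kappa>) (at t within {0..1})"
    by (rule vector_derivative_cong_eq[OF always_eventually]) (use t vc in auto)
  then have u': "velocity_deriv \<kappa> c t
      = fderiv (\<lambda>z. pushforward A F z ?dt \<kappa>) ?z ?dt"
    using slice_velocity_derivative[OF F T t k(1) k'] by simp
  show ?thesis
    unfolding variation_density_def DE DP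
      bilin_pushforward_derivative[OF F z k(1) k' g] form_pushforward_derivative[OF F z k(1) k' a]
      pushforward_derivative_symmetric[OF F z k(1) k', of ?ds ?dt]
      bilin_coord_sym[OF g k(1), of _ "fderiv (\<lambda>z. pushforward A F z ?dt \<kappa>) ?z ?ds"]
      euler_lagrange_def Let_def u u' c[OF t]
    by (simp add: field_simps)
qed

lemma continuous_on_slice:
  fixes f :: "real \<times> real \<Rightarrow> real"
  assumes "continuous_on T f" "\<And>t. t \<in> {0..1} \<Longrightarrow> (s, t) \<in> T"
  shows "continuous_on {0..1} (\<lambda>t. f (s, t))"
  by (rule continuous_on_compose2[OF assms(1)]) (use assms(2) in \<open>auto intro!: continuous_intros\<close>)

lemma variation_density_continuous:
  assumes g: "smooth_bilin A g" and a: "smooth_form A a" and F: "smooth_into A T F"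
    and T: "\<And>t. t \<in> {0..1} \<Longrightarrow> (0, t) \<in> T"
  shows "continuous_on {0..1} (\<lambda>t. fderiv (boundary_term g a F) (0, t) (0, 1))"
    and "continuous_on {0..1} (\<lambda>t. fderiv (lagrangian_along g a F) (0, t) (1, 0))"
    and "continuous_on {0..1} (variation_density g a F)"
proof -
  note s = smooth_on_continuous[OF smooth_on_frechet[OF boundary_term_smooth[OF g a F]]]
    smooth_on_continuous[OF smooth_on_frechet[OF lagrangian_along_smooth[OF g a F]]]
  show 1: "continuous_on {0..1} (\<lambda>t. fderiv (boundary_term g a F) (0, t) (0, 1))"
    and 2: "continuous_on {0..1} (\<lambda>t. fderiv (lagrangian_along g a F) (0, t) (1, 0))"
    using continuous_on_slice[OF s(1) T] continuous_on_slice[OF s(2) T] by blast+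
  show "continuous_on {0..1} (variation_density g a F)"
    unfolding variation_density_def[abs_def] by (rule continuous_on_diff[OF 1 2])
qed

text \<open>Differentiation under the integral sign, followed by integration by parts. The boundary term is globally
  defined along the curve and vanishes at the fixed endpoints, so the curve need not be subdivided into pieces
  inside of charts.\<close>

lemma first_variation:
  assumes g: "smooth_bilin A g" and a: "smooth_form A a" and F: "smooth_into A T F"
    and T: "{-\<epsilon><..<\<epsilon>} \<times> {0..1} \<subseteq> T" and \<epsilon>: "0 < \<epsilon>"
    and ends: "\<And>s. s \<in> {-\<epsilon><..<\<epsilon>} \<Longrightarrow> F (s, 0) = x \<and> F (s, 1) = y"
  shows "((\<lambda>s. action g a (\<lambda>t. F (s, t))) has_real_derivative - integral {0..1} (variation_density g a F)) (at 0)"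
proof -
  let ?E = "lagrangian_along g a F" and ?P = "boundary_term g a F"
  note sE = lagrangian_along_smooth[OF g a F] and sP = boundary_term_smooth[OF g a F]
  have zero: "0 \<in> {-\<epsilon><..<\<epsilon>}" using \<epsilon> by simp
  have inT: "(s, t) \<in> T" if "s \<in> {-\<epsilon><..<\<epsilon>}" "t \<in> {0..1}" for s t using T that by auto
  note inT0 = inT[OF zero]
  note int = variation_density_continuous(1,2)[OF g a F inT0, THEN integrable_continuous_real]
  have P0: "?P (0, t) = 0" if "pushforward A F (0, t) (1, 0) = 0" "t \<in> {0..1}" for t
  proof -
    have z: "(0::('m, 'e) tangent) \<in> tangent_space A (F (0, t))" by (rule subspace_0[OF tangent_space_subspace])
    note u = pushforward_tangent[OF F inT0[OF that(2)], of "(0, 1)"]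
    show ?thesis
      using smooth_bilin_scaleR_left[OF g u u, of 0] smooth_form_scaleR[OF a u, of 0] smooth_bilin_sym[OF g u z]
      by (simp add: boundary_term_def that(1))
  qed
  have "pushforward A F (0, t) (1, 0) = 0" if "t \<in> {0, 1}" for t
    by (rule pushforward_constant_slice[OF F inT0 \<epsilon>, of _ "if t = 0 then x else y"]) (use ends that in auto)
  then have P01: "?P (0, 0) = 0" "?P (0, 1) = 0" using P0 by auto
  have "((\<lambda>t. fderiv ?P (0, t) (0, 1)) has_integral ?P (0, 1) - ?P (0, 0)) {0..1}"
    by (rule fundamental_theorem_of_calculus[of 0 1 "\<lambda>t. ?P (0, t)"])
      (use slice_has_derivative(1)[OF sP inT0] in auto)
  then have "integral {0..1} (\<lambda>t. fderiv ?P (0, t) (0, 1)) = 0"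
    using P01 by (simp add: integral_unique)
  then have "integral {0..1} (\<lambda>t. fderiv ?E (0, t) (1, 0)) = - integral {0..1} (variation_density g a F)"
    unfolding variation_density_def[abs_def] using integral_diff[OF int] by simp
  moreover have "((\<lambda>s. integral (cbox 0 1) (\<lambda>t. ?E (s, t))) has_field_derivative
      integral (cbox 0 1) (\<lambda>t. fderiv ?E (0, t) (1, 0))) (at 0 within {-\<epsilon><..<\<epsilon>})"
  proof (rule leibniz_rule_field_derivative[where U = "{-\<epsilon><..<\<epsilon>}" and f = "\<lambda>s t. ?E (s, t)"
        and fx = "\<lambda>s t. fderiv ?E (s, t) (1, 0)"])
    show "((\<lambda>s. ?E (s, t)) has_field_derivative fderiv ?E (s, t) (1, 0)) (at s within {-\<epsilon><..<\<epsilon>})"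
      if "s \<in> {-\<epsilon><..<\<epsilon>}" "t \<in> cbox 0 1" for s t
      using slice_has_derivative(2)[OF sE inT] that by (simp add: has_real_derivative_iff_has_vector_derivative)
    show "(\<lambda>t. ?E (s, t)) integrable_on cbox 0 1" if "s \<in> {-\<epsilon><..<\<epsilon>}" for s
      using continuous_on_slice[OF smooth_on_continuous[OF sE] inT[OF that]] by (auto intro: integrable_continuous_real)
    show "continuous_on ({-\<epsilon><..<\<epsilon>} \<times> cbox 0 1) (\<lambda>(s, t). fderiv ?E (s, t) (1, 0))"
      using continuous_on_subset[OF smooth_on_continuous[OF smooth_on_frechet[OF sE]] T] by (simp add: split_beta)
  qed (use zero in auto)
  ultimately have "((\<lambda>s. integral {0..1} (\<lambda>t. ?E (s, t))) has_field_derivative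
      - integral {0..1} (variation_density g a F)) (at 0)"
    using at_within_open[OF zero open_greaterThanLessThan] by simp
  then show ?thesis
  proof (rule has_field_derivative_transform_within_open[OF _ open_greaterThanLessThan zero])
    fix s assume s: "s \<in> {-\<epsilon><..<\<epsilon>}"
    show "integral {0..1} (\<lambda>t. ?E (s, t)) = action g a (\<lambda>t. F (s, t))"
      unfolding action_def
    proof (rule integral_cong)
      fix t :: real assume "t \<in> {0..1}"
      from slice_velocity[OF F inT[OF s] this]
      show "?E (s, t) = lagrangian g a (F (s, t)) (velocity A (\<lambda>t. F (s, t)) t)"
        by (simp add: lagrangian_along_def)
    qed
  qed
qed

end

section \<open>Variations inside a chart and the Euler-Lagrange equation\<close>

context smooth_manifold begin

lemma smooth_into_cong:
  assumes "\<And>z. z \<in> T \<Longrightarrow> F z = G z" "smooth_into A T F" shows "smooth_into A T G"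
  unfolding smooth_into_def
proof (intro conjI ballI)
  show "open T" "continuous_on T G"
    using assms by (auto simp: smooth_into_def cong: continuous_on_cong)
  fix \<kappa> assume k: "\<kappa> \<in> A"
  have "T \<inter> F -` fst \<kappa> = T \<inter> G -` fst \<kappa>" using assms(1) by auto
  then show "smooth_on (T \<inter> G -` fst \<kappa>) (snd \<kappa> \<circ> G)"
    using smooth_on_cong[OF smooth_into_chart_open[OF assms(2) k] _ smooth_into_chart[OF assms(2) k], of "snd \<kappa> \<circ> G"] assms(1)
    by simp
qed

lemma smooth_into_locally:
  assumes "open T" and "\<And>z. z \<in> T \<Longrightarrow> \<exists>S. z \<in> S \<and> smooth_into A S F"
  shows "smooth_into A T F"
  unfolding smooth_into_def
proof (intro conjI ballI)
  show "open T" by fact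
  show "continuous_on T F"
  proof (rule continuous_at_imp_continuous_on, rule ballI)
    fix z assume "z \<in> T"
    then obtain S where "z \<in> S" "open S" "continuous_on S F" using assms(2) unfolding smooth_into_def by blast
    then show "isCont F z" by (simp add: continuous_on_eq_continuous_at)
  qed
  fix \<kappa> assume k: "\<kappa> \<in> A"
  show "smooth_on (T \<inter> F -` fst \<kappa>) (snd \<kappa> \<circ> F)"
  proof (rule smooth_on_locally)
    fix z assume z: "z \<in> T \<inter> F -` fst \<kappa>"
    then obtain S where "z \<in> S" "smooth_into A S F" using assms(2) by blast
    then show "\<exists>S. open S \<and> z \<in> S \<and> smooth_on S (snd \<kappa> \<circ> F)"
      using z by (intro exI[of _ "S \<inter> F -` fst \<kappa>"] conjI smooth_into_chart_open[OF _ k] smooth_into_chart[OF _ k]) auto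
  qed
qed

lemma cinv_smooth_into:
  assumes k: "\<kappa> \<in> A" shows "smooth_into A (snd \<kappa> ` fst \<kappa>) (cinv \<kappa>)"
  unfolding smooth_into_def
proof (intro conjI ballI)
  show "open (snd \<kappa> ` fst \<kappa>)" by (rule chart_image_open[OF k])
  show "continuous_on (snd \<kappa> ` fst \<kappa>) (cinv \<kappa>)"
    using chart_homeomorphism[OF k] by (simp add: homeomorphism_def)
  fix \<kappa>' assume k': "\<kappa>' \<in> A"
  show "smooth_on (snd \<kappa> ` fst \<kappa> \<inter> cinv \<kappa> -` fst \<kappa>') (snd \<kappa>' \<circ> cinv \<kappa>)"
    by (rule smooth_on_subset[OF transition_smooth[OF k k']])
      (use mem_chart_image[OF k, of _ "fst \<kappa>'"] in \<open>auto simp: Int_commute\<close>)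
qed

lemma smooth_on_fst: "smooth_on S (fst :: 'x::euclidean_space \<times> 'y::euclidean_space \<Rightarrow> 'x)"
  and smooth_on_snd: "smooth_on S (snd :: 'x::euclidean_space \<times> 'y::euclidean_space \<Rightarrow> 'y)"
  by (rule smooth_on_bounded_linear, rule bounded_linear_fst bounded_linear_snd)+

text \<open>In the coordinates of \<open>\<kappa>\<close> the variation is \<open>C(t) + s \<phi>(t) w\<close>, with a bump function \<open>\<phi>\<close> that is positive
  exactly on the interval \<open>(a, b)\<close>; elsewhere it does not depend on \<open>s\<close>.\<close>

lemma bump_variation:
  assumes C: "smooth_into A T0 C" and k: "\<kappa> \<in> A" and ab: "{a..b} \<subseteq> T0" "C ` {a..b} \<subseteq> fst \<kappa>"
  obtains \<phi> :: "real \<Rightarrow> real" and \<epsilon> and F :: "real \<times> real \<Rightarrow> 'm"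
  where "0 < \<epsilon>" and "smooth_into A ({-\<epsilon><..<\<epsilon>} \<times> T0) F"
    and "\<And>t. t \<in> {a<..<b} \<Longrightarrow> \<phi> t > 0"
    and "\<And>t. t \<in> T0 \<Longrightarrow> F (0, t) = C t"
    and "\<And>s t. t \<in> T0 \<Longrightarrow> t \<notin> {a<..<b} \<Longrightarrow> F (s, t) = C t"
    and "\<And>t. t \<in> {a<..<b} \<Longrightarrow> pushforward A F (0, t) (1, 0) \<kappa> = \<phi> t *\<^sub>R w"
    and "\<And>t. t \<in> T0 \<Longrightarrow> t \<notin> {a<..<b} \<Longrightarrow> pushforward A F (0, t) (1, 0) = 0"
proof -
  obtain \<phi> where \<phi>: "smooth_on UNIV \<phi>" "\<And>t. t \<in> {a<..<b} \<Longrightarrow> \<phi> t > 0" "\<And>t. t \<notin> {a<..<b} \<Longrightarrow> \<phi> t = (0::real)"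
    "\<And>t. 0 \<le> \<phi> t" "\<And>t. \<phi> t \<le> 1"
    using smooth_bump_exists[of a b] by blast
  let ?Och = "T0 \<inter> C -` fst \<kappa>"
  note oO = smooth_into_chart_open[OF C k]
  have sub: "{a..b} \<subseteq> ?Och" using ab by auto
  let ?K = "(snd \<kappa> \<circ> C) ` {a..b}"
  have "compact ?K"
    by (rule compact_continuous_image[OF continuous_on_subset[OF smooth_on_continuous[OF smooth_into_chart[OF C k]] sub]]) simp
  moreover have "?K \<subseteq> snd \<kappa> ` fst \<kappa>" using ab by auto
  ultimately obtain r where r: "r > 0" "(\<Union>x\<in>?K. ball x r) \<subseteq> snd \<kappa> ` fst \<kappa>"
    using compact_subset_open_imp_ball_epsilon_subset[OF _ chart_image_open[OF k]] by metis
  \<comment> \<open>As \<open>0 \<le> \<phi> \<le> 1\<close>, the displacement \<open>s \<phi>(t) w\<close> has norm less than \<open>r\<close> when \<open>\<bar>s\<bar> < \<epsilon>\<close>.\<close>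
  define \<epsilon> where "\<epsilon> = r / (norm w + 1)"
  have \<epsilon>: "\<epsilon> > 0" unfolding \<epsilon>_def using r(1) by (intro divide_pos_pos) (auto simp: add_nonneg_pos)
  define \<psi> where "\<psi> z = (snd \<kappa> \<circ> C) (snd z) + (fst z * \<phi> (snd z)) *\<^sub>R w" for z :: "real \<times> real"
  have \<psi>_img: "\<psi> (s, t) \<in> snd \<kappa> ` fst \<kappa>" if "s \<in> {-\<epsilon><..<\<epsilon>}" "t \<in> {a..b}" for s t
  proof -
    have "norm ((s * \<phi> t) *\<^sub>R w) = \<bar>s\<bar> * \<phi> t * norm w" using \<phi>(4)[of t] by (simp add: abs_mult)
    also have "\<dots> \<le> \<bar>s\<bar> * 1 * norm w" using \<phi>(5)[of t] by (intro mult_right_mono mult_left_mono) auto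
    also have "\<dots> \<le> \<bar>s\<bar> * (norm w + 1)" by (simp add: mult_left_mono)
    also have "\<dots> < \<epsilon> * (norm w + 1)" using that(1) by (intro mult_strict_right_mono) (auto simp: add_nonneg_pos)
    also have "\<dots> = r" unfolding \<epsilon>_def using norm_ge_zero[of w] by (simp add: add_nonneg_eq_0_iff)
    finally have "\<psi> (s, t) \<in> ball ((snd \<kappa> \<circ> C) t) r" by (simp add: \<psi>_def dist_norm)
    then show ?thesis using r(2) that(2) by blast
  qed
  define F where "F z = (if snd z \<in> {a<..<b} then cinv \<kappa> (\<psi> z) else C (snd z))" for z
  let ?T = "{-\<epsilon><..<\<epsilon>} \<times> T0"
  have oT: "open ?T" by (intro open_Times open_greaterThanLessThan smooth_into_open[OF C])
  let ?Ostrip = "{-\<epsilon><..<\<epsilon>} \<times> ?Och"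
  have oO0: "open ?Ostrip" by (intro open_Times open_greaterThanLessThan oO)
  have \<psi>: "smooth_on ?Ostrip \<psi>" unfolding \<psi>_def
  proof (intro smooth_on_add smooth_on_scaleR smooth_on_mult smooth_on_const smooth_on_fst oO0)
    show "smooth_on ?Ostrip (\<lambda>z. (snd \<kappa> \<circ> C) (snd z))"
      by (rule smooth_on_compose[OF oO0 _ smooth_on_snd smooth_into_chart[OF C k]]) auto
    show "smooth_on ?Ostrip (\<lambda>z. \<phi> (snd z))"
      by (rule smooth_on_compose[OF oO0 subset_UNIV smooth_on_snd \<phi>(1)])
  qed
  let ?Oin = "?Ostrip \<inter> \<psi> -` (snd \<kappa> ` fst \<kappa>)"
  have oO1: "open ?Oin"
    by (rule continuous_open_preimage[OF smooth_on_continuous[OF \<psi>] oO0 chart_image_open[OF k]])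
  have F_\<psi>: "cinv \<kappa> (\<psi> z) = F z" if "z \<in> ?Ostrip" for z
    using that \<phi>(3)[of "snd z"] cinv_chart[OF k] by (auto simp: F_def \<psi>_def)
  have F1: "smooth_into A ?Oin F"
  proof (rule smooth_into_cong)
    show "smooth_into A ?Oin (\<lambda>z. cinv \<kappa> (\<psi> z))"
      by (rule smooth_into_compose[OF cinv_smooth_into[OF k] oO1 _ smooth_on_subset[OF \<psi>]]) auto
  qed (use F_\<psi> in blast)
  let ?Oout = "{-\<epsilon><..<\<epsilon>} \<times> (T0 - {a..b})"
  have F2: "smooth_into A ?Oout F"
  proof (rule smooth_into_cong)
    have "open ?Oout" by (intro open_Times open_greaterThanLessThan open_Diff smooth_into_open[OF C] closed_atLeastAtMost)
    then show "smooth_into A ?Oout (\<lambda>z. C (snd z))"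
      by (rule smooth_into_compose[OF C _ _ smooth_on_snd]) auto
  qed (auto simp: F_def)
  have F: "smooth_into A ?T F"
  proof (rule smooth_into_locally[OF oT])
    fix z assume z: "z \<in> ?T"
    show "\<exists>S. z \<in> S \<and> smooth_into A S F"
    proof (cases "snd z \<in> {a..b}")
      case True
      then have "z \<in> ?Oin" using z sub \<psi>_img[of "fst z" "snd z"] by auto
      then show ?thesis using F1 by (intro exI[of _ ?Oin] conjI)
    next
      case False
      then have "z \<in> ?Oout" using z by auto
      then show ?thesis using F2 by (intro exI[of _ ?Oout] conjI)
    qed
  qed
  have F0: "F (0, t) = C t" if "t \<in> T0" for t
    using ab cinv_chart[OF k] by (auto simp: F_def \<psi>_def image_subset_iff)
  have Fout: "F (s, t) = C t" if "t \<notin> {a<..<b}" for s t using that by (auto simp: F_def)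
  have V: "pushforward A F (0, t) (1, 0) \<kappa> = \<phi> t *\<^sub>R w" if t: "t \<in> {a<..<b}" for t
  proof -
    have tO: "t \<in> ?Och" using t subsetD[OF sub, of t] by simp
    have z: "(0, t) \<in> ?T \<inter> F -` fst \<kappa>" using tO \<epsilon> F0[of t] by auto
    note d = slice_has_derivative(2)[OF smooth_into_chart[OF F k] z, of UNIV]
    have "((\<lambda>s. \<psi> (s, t)) has_vector_derivative \<phi> t *\<^sub>R w) (at 0)"
      unfolding \<psi>_def by (auto intro!: derivative_eq_intros simp: has_vector_derivative_def)
    then have "((\<lambda>s. (snd \<kappa> \<circ> F) (s, t)) has_vector_derivative \<phi> t *\<^sub>R w) (at 0)"
    proof (rule has_vector_derivative_transform_within_open[OF _ open_greaterThanLessThan])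
      show "0 \<in> {-\<epsilon><..<\<epsilon>}" using \<epsilon> by simp
      fix s assume s: "s \<in> {-\<epsilon><..<\<epsilon>}"
      then have "cinv \<kappa> (\<psi> (s, t)) = F (s, t)" using tO by (intro F_\<psi>) auto
      then show "\<psi> (s, t) = (snd \<kappa> \<circ> F) (s, t)"
        using chart_cinv[OF k \<psi>_img[OF s, of t]] t by simp
    qed
    from vector_derivative_unique_at[OF d this] show ?thesis using z k by (simp add: pushforward_component)
  qed
  have V0: "pushforward A F (0, t) (1, 0) = 0" if "t \<in> T0" "t \<notin> {a<..<b}" for t
    by (rule pushforward_constant_slice[OF F _ \<epsilon>]) (use that \<epsilon> Fout in auto)
  show ?thesis by (rule that[OF \<epsilon> F \<phi>(2) F0 Fout V V0])
qed

lemma linear_bilin_deriv_last: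
  assumes "smooth_bilin A g" "\<kappa> \<in> A" "p \<in> fst \<kappa>" shows "linear (bilin_deriv g \<kappa> p d e)"
  by (rule linearI)
    (simp_all add: frechet_form_expand[OF bilin_coord_linear_right[OF assms(1,2)] bilin_coord_differentiable[OF assms(1,2)]]
      assms(3) inner_add_left distrib_right sum.distrib sum_distrib_left mult.assoc)

lemma linear_form_deriv_last:
  assumes "smooth_form A a" "\<kappa> \<in> A" "p \<in> fst \<kappa>" shows "linear (form_deriv a \<kappa> p d)"
  by (rule linearI)
    (simp_all add: frechet_form_expand[OF form_coord_linear[OF assms(1,2)] form_coord_differentiable[OF assms(1,2)]]
      assms(3) inner_add_left distrib_right sum.distrib sum_distrib_left mult.assoc)

lemma euler_lagrange_linear:
  assumes "smooth_bilin A g" "smooth_form A a" "\<kappa> \<in> A" "c t \<in> fst \<kappa>"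
  shows "linear (euler_lagrange g a \<kappa> c t)"
proof -
  have img: "snd \<kappa> (c t) \<in> snd \<kappa> ` fst \<kappa>" using assms(4) by blast
  note l = linear_bilin_deriv_last[OF assms(1,3,4)] linear_form_deriv_last[OF assms(2,3,4)]
    bilin_coord_linear_right[OF assms(1,3), of "snd \<kappa> (c t)"]
    linear_frechet_derivative[OF bilin_coord_differentiable[OF assms(1,3) img]]
    linear_frechet_derivative[OF form_coord_differentiable[OF assms(2,3) img]]
  show ?thesis
    by (rule linearI) (simp_all add: euler_lagrange_def Let_def l[THEN linear_add] l[THEN linear_scale] algebra_simps)
qed

definition fixed_end_variation :: "'m \<Rightarrow> 'm \<Rightarrow> (real \<Rightarrow> 'm) \<Rightarrow> (real \<times> real \<Rightarrow> 'm) \<Rightarrow> bool" where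
  "fixed_end_variation x y c F \<longleftrightarrow>
     (\<forall>t\<in>{0..1}. F (0, t) = c t) \<and>
     (\<exists>\<epsilon>>0. smooth_map_on A ({-\<epsilon><..<\<epsilon>} \<times> {0..1}) F \<and>
        (\<forall>s\<in>{-\<epsilon><..<\<epsilon>}. F (s, 0) = x \<and> F (s, 1) = y))"

lemma action_cong: "(\<And>t. t \<in> {0..1} \<Longrightarrow> c t = c' t) \<Longrightarrow> action g a c = action g a c'"
  unfolding action_def
proof (rule integral_cong)
  fix t :: real assume *: "\<And>t. t \<in> {0..1} \<Longrightarrow> c t = c' t" and t: "t \<in> {0..1}"
  show "lagrangian g a (c t) (velocity A c t) = lagrangian g a (c' t) (velocity A c' t)"
    using velocity_cong[of c c' t] * t by simp
qed

lemma euler_lagrange_imp_critical: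
  assumes g: "smooth_bilin A g" and a: "smooth_form A a"
    and el: "\<And>t w. t \<in> {0..1} \<Longrightarrow> euler_lagrange g a (chart_at A (c t)) c t w = 0"
    and F: "fixed_end_variation x y c F"
  shows "((\<lambda>s. action g a (\<lambda>t. F (s, t))) has_real_derivative 0) (at 0)"
proof -
  obtain \<epsilon> T G where \<epsilon>: "\<epsilon> > 0" "\<And>s. s \<in> {-\<epsilon><..<\<epsilon>} \<Longrightarrow> F (s, 0) = x \<and> F (s, 1) = y"
    and G: "smooth_into A T G" "{-\<epsilon><..<\<epsilon>} \<times> {0..1} \<subseteq> T" "\<And>z. z \<in> {-\<epsilon><..<\<epsilon>} \<times> {0..1} \<Longrightarrow> G z = F z"
    using F unfolding fixed_end_variation_def smooth_map_on_iff_extension by blast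
  have zero: "0 \<in> {-\<epsilon><..<\<epsilon>}" using \<epsilon> by simp
  have T0: "(0, t) \<in> T" if "t \<in> {0..1}" for t using G(2) zero that by blast
  have c: "G (0, t) = c t" if "t \<in> {0..1}" for t
    using G(3)[of "(0, t)"] zero F that unfolding fixed_end_variation_def by auto
  have ends: "G (s, 0) = x \<and> G (s, 1) = y" if "s \<in> {-\<epsilon><..<\<epsilon>}" for s
    using G(3)[of "(s, 0)"] G(3)[of "(s, 1)"] \<epsilon>(2)[OF that] that by auto
  have "variation_density g a G t = 0" if "t \<in> {0..1}" for t
    using variation_density_euler_lagrange[OF g a G(1) T0 c that chart_at] el[OF that] by simp
  then have "integral {0..1} (variation_density g a G) = integral {0..1} (\<lambda>t::real. 0)"
    by (rule integral_cong)
  then have d': "((\<lambda>s. action g a (\<lambda>t. G (s, t))) has_real_derivative 0) (at 0)"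
    using first_variation[OF g a G(1,2) \<epsilon>(1) ends] by simp
  show ?thesis
    by (rule has_field_derivative_transform_within_open[OF d' open_greaterThanLessThan zero])
      (rule action_cong, use G(3) in auto)
qed

text \<open>The fundamental lemma of the calculus of variations. Bump variations are used twice. The variation density of
  a first one, around \<open>t0\<close>, is \<open>\<phi> h\<close>; as it is continuous, \<open>h\<close> is positive near \<open>t0\<close>. Since \<open>t0\<close> may be \<open>0\<close> or \<open>1\<close>, this
  variation may move the endpoints. A second one, supported in \<open>[0, 1]\<close> near \<open>t0\<close>, fixes them, and its variation density is
  nonnegative with integral \<open>0\<close>, but positive at some point.\<close>

lemma critical_imp_euler_lagrange:
  assumes g: "smooth_bilin A g" and a: "smooth_form A a"
    and c: "smooth_map_on A {0..1} c" "c 0 = x" "c 1 = y"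
    and crit: "\<And>F. fixed_end_variation x y c F \<Longrightarrow>
      ((\<lambda>s. action g a (\<lambda>t. F (s, t))) has_real_derivative 0) (at 0)"
    and t0: "t0 \<in> {0..1}"
  shows "euler_lagrange g a (chart_at A (c t0)) c t0 w0 = 0"
proof (rule ccontr)
  let ?\<kappa> = "chart_at A (c t0)"
  assume "euler_lagrange g a ?\<kappa> c t0 w0 \<noteq> 0"
  moreover have "euler_lagrange g a ?\<kappa> c t0 (- w0) = - euler_lagrange g a ?\<kappa> c t0 w0"
    by (rule linear_neg[OF euler_lagrange_linear[OF g a chart_at]])
  ultimately obtain w where w: "euler_lagrange g a ?\<kappa> c t0 w > 0" by (metis linorder_neqE_linordered_idom neg_0_less_iff_less)
  define h where "h t = euler_lagrange g a ?\<kappa> c t w" for t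
  obtain T0 C where C: "smooth_into A T0 C" "{0..1} \<subseteq> T0" "\<And>t. t \<in> {0..1} \<Longrightarrow> C t = c t"
    using c(1) unfolding smooth_map_on_iff_extension by blast
  note k = chart_at(1)[of "c t0"]
  have Ct: "c t \<in> fst ?\<kappa>" if "t \<in> {0..1}" "C t \<in> fst ?\<kappa>" for t using C(3) that by simp
  have "open (T0 \<inter> C -` fst ?\<kappa>)" "t0 \<in> T0 \<inter> C -` fst ?\<kappa>"
    using smooth_into_chart_open[OF C(1) k] C(2,3) t0 chart_at(2)[of "c t0"] by auto
  then obtain r where r: "r > 0" "cball t0 r \<subseteq> T0 \<inter> C -` fst ?\<kappa>" using open_contains_cball by blast
  have bump: "\<exists>\<phi> F. (\<forall>t\<in>{l<..<m}. \<phi> t > 0) \<and> continuous_on {0..1} (variation_density g a F) \<and>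
      (\<forall>t\<in>{0..1}. variation_density g a F t = (if t \<in> {l<..<m} then \<phi> t * h t else 0)) \<and>
      (0 \<le> l \<and> m \<le> 1 \<longrightarrow> integral {0..1} (variation_density g a F) = 0)"
    if lm: "{l..m} \<subseteq> cball t0 r" for l m
  proof -
    obtain \<phi> :: "real \<Rightarrow> real" and \<epsilon> and F :: "real \<times> real \<Rightarrow> 'm" where \<epsilon>: "0 < \<epsilon>"
      and F: "smooth_into A ({-\<epsilon><..<\<epsilon>} \<times> T0) F"
      and \<phi>: "\<And>t. t \<in> {l<..<m} \<Longrightarrow> \<phi> t > 0"
      and F0: "\<And>t. t \<in> T0 \<Longrightarrow> F (0, t) = C t"
      and Fout: "\<And>s t. t \<in> T0 \<Longrightarrow> t \<notin> {l<..<m} \<Longrightarrow> F (s, t) = C t"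
      and V: "\<And>t. t \<in> {l<..<m} \<Longrightarrow> pushforward A F (0, t) (1, 0) ?\<kappa> = \<phi> t *\<^sub>R w"
      and V0: "\<And>t. t \<in> T0 \<Longrightarrow> t \<notin> {l<..<m} \<Longrightarrow> pushforward A F (0, t) (1, 0) = 0"
      by (rule bump_variation[OF C(1) k, of l m w]) (use lm r in blast)+
    have in0: "(0, t) \<in> {-\<epsilon><..<\<epsilon>} \<times> T0" if "t \<in> {0..1}" for t using that C(2) \<epsilon> by auto
    have Fc: "F (0, t) = c t" if "t \<in> {0..1}" for t using F0[of t] C(2,3) that by auto
    have Q: "variation_density g a F t = euler_lagrange g a \<kappa> c t (pushforward A F (0, t) (1, 0) \<kappa>)"
      if "t \<in> {0..1}" "\<kappa> \<in> A" "c t \<in> fst \<kappa>" for t \<kappa>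
      by (rule variation_density_euler_lagrange[OF g a F in0 Fc that])
    have Qh: "variation_density g a F t = (if t \<in> {l<..<m} then \<phi> t * h t else 0)" if t: "t \<in> {0..1}" for t
    proof (cases "t \<in> {l<..<m}")
      case True
      then have "t \<in> cball t0 r" using subsetD[OF lm, of t] by simp
      then have "c t \<in> fst ?\<kappa>" using Ct[OF t] r(2) by auto
      then show ?thesis
        using Q[OF t k] V[OF True] True linear_scale[OF euler_lagrange_linear[OF g a k]] by (simp add: h_def)
    next
      case False
      then have "pushforward A F (0, t) (1, 0) = 0" using V0 C(2) t by blast
      then show ?thesis
        using Q[OF t chart_at] False linear_0[OF euler_lagrange_linear[OF g a chart_at]] by auto
    qed
    have "integral {0..1} (variation_density g a F) = 0" if "0 \<le> l" "m \<le> 1"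
    proof -
      have ends: "F (s, 0) = x \<and> F (s, 1) = y" for s
        using Fout[of 0 s] Fout[of 1 s] subsetD[OF C(2), of 0] subsetD[OF C(2), of 1] C(3)[of 0] C(3)[of 1] c(2,3) that
        by simp
      have sub: "{-\<epsilon><..<\<epsilon>} \<times> {0..1} \<subseteq> {-\<epsilon><..<\<epsilon>} \<times> T0" using C(2) by auto
      have "smooth_map_on A ({-\<epsilon><..<\<epsilon>} \<times> {0..1}) F"
        unfolding smooth_map_on_iff_extension using F sub by blast
      then have "fixed_end_variation x y c F"
        unfolding fixed_end_variation_def using \<epsilon> Fc ends by blast
      from DERIV_unique[OF first_variation[OF g a F sub \<epsilon> ends] crit[OF this]] show ?thesis by simp
    qed
    then show ?thesis using \<phi> variation_density_continuous(3)[OF g a F in0] Qh by blast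
  qed
  have "{t0 - r..t0 + r} \<subseteq> cball t0 r" by (auto simp: dist_real_def)
  from bump[OF this] obtain \<phi> F where \<phi>: "\<forall>t\<in>{t0 - r<..<t0 + r}. \<phi> t > 0"
    and Q: "continuous_on {0..1} (variation_density g a F)"
    and Qh: "\<forall>t\<in>{0..1}. variation_density g a F t = (if t \<in> {t0 - r<..<t0 + r} then \<phi> t * h t else 0)"
    by (elim exE conjE) (rule that)
  let ?Q = "variation_density g a F"
  have "?Q t0 > 0" using bspec[OF Qh t0] bspec[OF \<phi>, of t0] w r(1) by (simp add: h_def)
  then obtain \<delta> where \<delta>: "\<delta> > 0" "\<And>t. t \<in> {0..1} \<Longrightarrow> dist t t0 < \<delta> \<Longrightarrow> dist (?Q t) (?Q t0) < ?Q t0"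
    using Q t0 unfolding continuous_on_iff by blast
  have hpos: "h t > 0" if "t \<in> {0..1}" "\<bar>t - t0\<bar> < \<delta>" "\<bar>t - t0\<bar> < r" for t
  proof -
    have "?Q t > 0" using \<delta>(2)[of t] that by (auto simp: dist_real_def abs_less_iff)
    then show ?thesis using bspec[OF Qh that(1)] bspec[OF \<phi>, of t] that(3) by (auto simp: zero_less_mult_iff abs_less_iff split: if_splits)
  qed
  define lo where "lo = Max {0, t0 - r, t0 - \<delta>}"
  define hi where "hi = Min {1, t0 + r, t0 + \<delta>}"
  have lh: "lo < hi" "0 \<le> lo" "hi \<le> 1" "t0 - r \<le> lo" "hi \<le> t0 + r" "t0 - \<delta> \<le> lo" "hi \<le> t0 + \<delta>"
    using t0 r(1) \<delta>(1) by (auto simp: lo_def hi_def)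
  have "{lo..hi} \<subseteq> cball t0 r" using lh by (auto simp: dist_real_def abs_le_iff)
  from bump[OF this] obtain \<phi>' F' where \<phi>': "\<forall>t\<in>{lo<..<hi}. \<phi>' t > 0"
    and Q': "continuous_on {0..1} (variation_density g a F')"
    and Qh': "\<forall>t\<in>{0..1}. variation_density g a F' t = (if t \<in> {lo<..<hi} then \<phi>' t * h t else 0)"
    and I: "0 \<le> lo \<and> hi \<le> 1 \<longrightarrow> integral {0..1} (variation_density g a F') = 0"
    by (elim exE conjE) (rule that)
  have h': "h t > 0" if "t \<in> {lo<..<hi}" for t using that lh by (intro hpos) (auto simp: abs_less_iff)
  have "variation_density g a F' t \<ge> 0" if "t \<in> {0..1}" for t
    using bspec[OF Qh' that] bspec[OF \<phi>', of t] h'[of t] by (cases "t \<in> {lo<..<hi}") (auto simp: less_imp_le)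
  then have "\<forall>t\<in>{0..1}. variation_density g a F' t = 0" using integral_eq_0_iff[OF Q'] I lh by simp
  moreover have mid: "(lo + hi) / 2 \<in> {lo<..<hi}" "(lo + hi) / 2 \<in> {0..1}" using lh by auto
  ultimately show False
    using bspec[OF Qh' mid(2)] bspec[OF \<phi>' mid(1)] h'[OF mid(1)] mid by simp
qed

end

section \<open>Representing linear functionals by a definite form\<close>

text \<open>The fibres of \<open>H\<close> are subspaces of a function space that is only a real vector space. So the representation
  theorem of Riesz is proved algebraically, by Gram-Schmidt orthogonalization along a finite spanning set.\<close>

lemma definite_form_representation:
  fixes b :: "'v::real_vector \<Rightarrow> 'v \<Rightarrow> real"
  assumes "finite B" "span B \<subseteq> S"
    and add: "\<And>u v w. u \<in> S \<Longrightarrow> v \<in> S \<Longrightarrow> w \<in> S \<Longrightarrow> b (u + v) w = b u w + b v w"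
    and scale: "\<And>u w r. u \<in> S \<Longrightarrow> w \<in> S \<Longrightarrow> b (r *\<^sub>R u) w = r * b u w"
    and sym: "\<And>u w. u \<in> S \<Longrightarrow> w \<in> S \<Longrightarrow> b u w = b w u"
    and pos: "\<And>u. u \<in> S \<Longrightarrow> u \<noteq> 0 \<Longrightarrow> b u u > 0"
    and "\<And>u v. u \<in> span B \<Longrightarrow> v \<in> span B \<Longrightarrow> \<beta> (u + v) = \<beta> u + \<beta> v"
    and "\<And>u r. u \<in> span B \<Longrightarrow> \<beta> (r *\<^sub>R u) = r * \<beta> u"
  shows "\<exists>w\<in>span B. \<forall>y\<in>span B. b w y = (\<beta> y :: real)"
  using assms(1,2,7,8)
proof (induction B arbitrary: \<beta>)
  case empty
  then have "0 \<in> S" by simp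
  then show ?case using empty.prems(3)[of 0 0] scale[of 0 0 0] by simp
next
  case (insert x B)
  have sub: "span B \<subseteq> span (insert x B)" by (rule span_mono) auto
  then have BS: "span B \<subseteq> S" using insert.prems(1) by blast
  have xI: "x \<in> span (insert x B)" by (rule span_base) simp
  then have xS: "x \<in> S" using insert.prems(1) by blast
  have add': "b w (u + v) = b w u + b w v" if "u \<in> span B" "v \<in> span B" "w \<in> S" for u v w
    using add[of u v w] sym[of w] that BS span_add[OF that(1,2)] by (auto simp: subset_iff)
  have scale': "b w (r *\<^sub>R u) = r * b w u" if "u \<in> span B" "w \<in> S" for u w r
    using scale[of u w r] sym[of w] that BS span_scale[OF that(1), of r] by (auto simp: subset_iff)
  obtain x0 where x0: "x0 \<in> span B" "\<And>y. y \<in> span B \<Longrightarrow> b x0 y = b x y"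
    using insert.IH[OF BS, of "b x"] add'[OF _ _ xS] scale'[OF _ xS] by blast
  obtain w0 where w0: "w0 \<in> span B" "\<And>y. y \<in> span B \<Longrightarrow> b w0 y = \<beta> y"
    using insert.IH[OF BS, of \<beta>] insert.prems(2,3) sub by blast
  define x' where "x' = x - x0"
  have x'I: "x' \<in> span (insert x B)" unfolding x'_def using xI x0(1) sub by (blast intro: span_diff)
  then have x'S: "x' \<in> S" using insert.prems(1) by blast
  have x0S: "x0 \<in> S" and w0S: "w0 \<in> S" using x0(1) w0(1) BS by auto
  have orth: "b x' y = 0" if y: "y \<in> span B" for y
  proof -
    have "y \<in> S" using y BS by blast
    have "b x y = b (x' + x0) y" by (simp add: x'_def)
    also have "\<dots> = b x' y + b x0 y" by (rule add[OF x'S x0S \<open>y \<in> S\<close>])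
    finally show ?thesis using x0(2)[OF y] by simp
  qed
  show ?case
  proof (cases "x' = 0")
    case True
    then have "x \<in> span B" using x0(1) by (simp add: x'_def)
    then have "span (insert x B) = span B" by (simp add: span_redundant)
    then show ?thesis using w0 by blast
  next
    case False
    then have p: "b x' x' > 0" by (rule pos[OF x'S])
    define k where "k = \<beta> x' / b x' x'"
    have kI: "k *\<^sub>R x' \<in> span (insert x B)" by (rule span_scale[OF x'I])
    then have kS: "k *\<^sub>R x' \<in> S" using insert.prems(1) by blast
    have w0I: "w0 \<in> span (insert x B)" using w0(1) sub by blast
    have "b (w0 + k *\<^sub>R x') y = \<beta> y" if y: "y \<in> span (insert x B)" for y
    proof -
      obtain l where l: "y - l *\<^sub>R x \<in> span B" using y by (auto simp: span_insert)
      define z where "z = y - l *\<^sub>R x'"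
      have z_eq: "z = (y - l *\<^sub>R x) + l *\<^sub>R x0" by (simp add: z_def x'_def algebra_simps)
      have z: "z \<in> span B" unfolding z_eq by (intro span_add l span_scale x0(1))
      have zS: "z \<in> S" and zI: "z \<in> span (insert x B)" using z BS sub by auto
      have lI: "l *\<^sub>R x' \<in> span (insert x B)" by (rule span_scale[OF x'I])
      then have lS: "l *\<^sub>R x' \<in> S" using insert.prems(1) by blast
      have yz: "y = z + l *\<^sub>R x'" by (simp add: z_def)
      have yS: "y \<in> S" using y insert.prems(1) by blast
      have "b (w0 + k *\<^sub>R x') y = b w0 y + k * b x' y"
        using add[OF w0S kS yS] scale[OF x'S yS, of k] by simp
      also have "b w0 y = \<beta> z"
        using add[OF zS lS w0S] scale[OF x'S w0S, of l] sym[OF w0S yS] sym[OF w0S zS] orth[OF w0(1)] w0(2)[OF z] yz by simp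
      also have "b x' y = l * b x' x'"
        using add[OF zS lS x'S] scale[OF x'S x'S, of l] sym[OF x'S yS] sym[OF x'S zS] orth[OF z] yz by simp
      also have "\<beta> z + k * (l * b x' x') = \<beta> z + \<beta> (l *\<^sub>R x')"
        using insert.prems(3)[OF x'I, of l] p by (simp add: k_def)
      also have "\<dots> = \<beta> y" using insert.prems(2)[OF zI lI] yz by simp
      finally show ?thesis .
    qed
    then show ?thesis using span_add[OF w0I kI] by blast
  qed
qed

section \<open>Witt structures\<close>

locale witt_structure =
  fixes M :: "('m::{t2_space, second_countable_topology}, 'e::euclidean_space) witt"
  assumes witt: "lorentzian_witt M"

sublocale witt_structure \<subseteq> smooth_manifold "atlas M"
  using witt by unfold_locales (simp add: lorentzian_witt_def)

context witt_structure begin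

abbreviation "A \<equiv> atlas M"
abbreviation "g \<equiv> wmetric M"
abbreviation "\<nu> \<equiv> nu M"
abbreviation "\<nu>s \<equiv> nus M"
abbreviation "\<sigma> \<equiv> wsigma M"
abbreviation "\<sigma>s \<equiv> wsigmas M"

lemma metric_smooth: "smooth_bilin A g"
proof -
  have "lorentzian A g" using witt by (simp add: lorentzian_witt_def)
  then show ?thesis
    unfolding lorentzian_def smooth_bilin_def by (elim conjE) (intro conjI, assumption+)
qed

lemma nu_field: "\<nu> \<in> vector_fields A UNIV" and nus_field: "\<nu>s \<in> vector_fields A UNIV"
  and nu_mem: "\<nu> p \<in> Vp M p" and nus_mem: "\<nu>s p \<in> Vps M p"
  and nu_nonzero: "\<nu> p \<noteq> 0" and nus_nonzero: "\<nu>s p \<noteq> 0"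
  and g_nu_nus: "g p (\<nu> p) (\<nu>s p) = 1"
  and Vp_Vq_orthogonal: "a \<in> Vp M p \<Longrightarrow> w \<in> Vq M p \<Longrightarrow> g p a w = 0"
  and Vps_Vq_orthogonal: "b \<in> Vps M p \<Longrightarrow> w \<in> Vq M p \<Longrightarrow> g p b w = 0"
  and Vp_null: "a \<in> Vp M p \<Longrightarrow> g p a a = 0" and Vps_null: "b \<in> Vps M p \<Longrightarrow> g p b b = 0"
  and Vq_positive: "w \<in> Vq M p \<Longrightarrow> w \<noteq> 0 \<Longrightarrow> g p w w > 0"
  using witt unfolding lorentzian_witt_def sections_def by blast+

lemma Witt_decomposition:
  "v \<in> tangent_space A p \<Longrightarrow> \<exists>a\<in>Vp M p. \<exists>b\<in>Vps M p. \<exists>w\<in>Vq M p. v = a + b + w"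
proof -
  assume v: "v \<in> tangent_space A p"
  have "\<forall>p. \<forall>v\<in>tangent_space A p.
        \<exists>!(a, b, w). a \<in> Vp M p \<and> b \<in> Vps M p \<and> w \<in> Vq M p \<and> v = a + b + w"
    using witt unfolding lorentzian_witt_def by (elim conjE) assumption
  from ex1_implies_ex[OF bspec[OF spec[OF this] v]] show ?thesis by auto
qed

lemma frame_bundle:
  "smooth_subbundle A 1 (Vp M)" "smooth_subbundle A 1 (Vps M)" "smooth_subbundle A (DIM('e) - 2) (Vq M)"
  using witt unfolding lorentzian_witt_def by blast+

lemma nu_tangent: "\<nu> p \<in> tangent_space A p" and nus_tangent: "\<nu>s p \<in> tangent_space A p"
  using nu_field nus_field by (auto simp: vector_fields_def)

lemma subbundle_line:
  assumes V: "smooth_subbundle A 1 V" and n: "n \<in> V p" "n \<noteq> 0" and v: "v \<in> V p"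
  shows "\<exists>r. v = r *\<^sub>R n"
proof -
  obtain X where "span ((\<lambda>i. X i p) ` {..<(1::nat)}) = V p" using V unfolding smooth_subbundle_def by metis
  moreover have "{..<(1::nat)} = {0}" by auto
  ultimately have X: "V p = span {X 0 p}" by simp
  obtain k where k: "n = k *\<^sub>R X 0 p" using n(1) X by (auto simp: span_singleton)
  obtain l where l: "v = l *\<^sub>R X 0 p" using v X by (auto simp: span_singleton)
  have "k \<noteq> 0" using k n(2) by auto
  then show ?thesis using k l by (intro exI[of _ "l / k"]) simp
qed

lemma Vq_subspace: "subspace (Vq M p)" and Vq_tangent: "w \<in> Vq M p \<Longrightarrow> w \<in> tangent_space A p"
  and Vq_finite_span: "\<exists>B. finite B \<and> Vq M p = span B"
proof -
  let ?r = "DIM('e) - 2"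
  obtain W X where WX: "p \<in> W" "\<And>i. i < ?r \<Longrightarrow> X i \<in> vector_fields A W" "span ((\<lambda>i. X i p) ` {..<?r}) = Vq M p"
    using frame_bundle(3) unfolding smooth_subbundle_def by metis
  show "subspace (Vq M p)" using subspace_span[of "(\<lambda>i. X i p) ` {..<?r}"] WX(3) by simp
  have "span ((\<lambda>i. X i p) ` {..<?r}) \<subseteq> tangent_space A p"
    by (rule span_minimal[OF _ tangent_space_subspace]) (use WX vector_field_tangent in blast)
  then show "w \<in> Vq M p \<Longrightarrow> w \<in> tangent_space A p" using WX(3) by blast
  show "\<exists>B. finite B \<and> Vq M p = span B"
    using WX(3) by (intro exI[of _ "(\<lambda>i. X i p) ` {..<?r}"]) simp
qed

lemma vector_fields_zero: "(\<lambda>q. 0) \<in> vector_fields A W"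
  by (simp add: vector_fields_def subspace_0[OF tangent_space_subspace] smooth_on_const)

text \<open>The values at \<open>p\<close> of the sections over \<open>W\<close> form a subspace that contains a basis of the fibre, the
  values of a local frame.\<close>

lemma Vq_extension:
  obtains W where "open W" "p \<in> W" "\<And>u. u \<in> Vq M p \<Longrightarrow> \<exists>X\<in>sections A (Vq M) W. X p = u"
proof -
  let ?r = "DIM('e) - 2"
  obtain W E where W: "open W" "p \<in> W" and E: "\<And>i. i < ?r \<Longrightarrow> E i \<in> vector_fields A W"
    "\<And>q. q \<in> W \<Longrightarrow> span ((\<lambda>i. E i q) ` {..<?r}) = Vq M q"
    using frame_bundle(3) unfolding smooth_subbundle_def by metis
  let ?S = "{X p | X. X \<in> sections A (Vq M) W}"
  have "subspace ?S"
  proof (rule subspaceI)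
    show "0 \<in> ?S"
      using vector_fields_zero[of W] subspace_0[OF Vq_subspace] by (auto simp: sections_def intro!: exI[of _ "\<lambda>q. 0"])
  next
    fix u v assume "u \<in> ?S" "v \<in> ?S"
    then obtain X Y where XY: "X \<in> sections A (Vq M) W" "Y \<in> sections A (Vq M) W" "u = X p" "v = Y p" by blast
    then have "(\<lambda>q. X q + Y q) \<in> sections A (Vq M) W"
      using vector_fields_add[OF W(1)] subspace_add[OF Vq_subspace] by (auto simp: sections_def)
    then show "u + v \<in> ?S" using XY by (intro CollectI exI[of _ "\<lambda>q. X q + Y q"]) simp
  next
    fix r :: real and u assume "u \<in> ?S"
    then obtain X where X: "X \<in> sections A (Vq M) W" "u = X p" by blast
    then have "(\<lambda>q. r *\<^sub>R X q) \<in> sections A (Vq M) W"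
      using vector_fields_scaleR[OF W(1) _ smooth_function_const] subspace_mul[OF Vq_subspace] by (auto simp: sections_def)
    then show "r *\<^sub>R u \<in> ?S" using X by (intro CollectI exI[of _ "\<lambda>q. r *\<^sub>R X q"]) simp
  qed
  moreover have "E i p \<in> ?S" if "i < ?r" for i
  proof -
    have "E i q \<in> Vq M q" if "q \<in> W" for q
      using E(2)[OF that] \<open>i < ?r\<close> span_base[of "E i q" "(\<lambda>i. E i q) ` {..<?r}"] by auto
    then have "E i \<in> sections A (Vq M) W" using E(1)[OF that] by (simp add: sections_def)
    then show ?thesis by (intro CollectI exI[of _ "E i"]) simp
  qed
  ultimately have "span ((\<lambda>i. E i p) ` {..<?r}) \<subseteq> ?S" by (intro span_minimal) auto
  then have "Vq M p \<subseteq> ?S" using E(2)[OF W(2)] by simp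
  then have "\<And>u. u \<in> Vq M p \<Longrightarrow> \<exists>X\<in>sections A (Vq M) W. X p = u" by blast
  then show ?thesis by (rule that[OF W])
qed

lemma g_add_left: "u \<in> tangent_space A p \<Longrightarrow> v \<in> tangent_space A p \<Longrightarrow> w \<in> tangent_space A p \<Longrightarrow>
    g p (u + v) w = g p u w + g p v w"
  and g_scaleR_left: "u \<in> tangent_space A p \<Longrightarrow> w \<in> tangent_space A p \<Longrightarrow> g p (r *\<^sub>R u) w = r * g p u w"
  and g_sym: "u \<in> tangent_space A p \<Longrightarrow> w \<in> tangent_space A p \<Longrightarrow> g p u w = g p w u"
  using smooth_bilin_add_left[OF metric_smooth] smooth_bilin_scaleR_left[OF metric_smooth] smooth_bilin_sym[OF metric_smooth]
  by blast+

lemma g_diff_left: "u \<in> tangent_space A p \<Longrightarrow> v \<in> tangent_space A p \<Longrightarrow> w \<in> tangent_space A p \<Longrightarrow>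
    g p (u - v) w = g p u w - g p v w"
  using g_add_left[of "u - v" p v w] subspace_diff[OF tangent_space_subspace] by simp

lemma g_add_right: "u \<in> tangent_space A p \<Longrightarrow> v \<in> tangent_space A p \<Longrightarrow> w \<in> tangent_space A p \<Longrightarrow>
    g p w (u + v) = g p w u + g p w v"
  using g_add_left[of u p v w] g_sym[of w p] subspace_add[OF tangent_space_subspace] by simp

lemma g_scaleR_right: "u \<in> tangent_space A p \<Longrightarrow> w \<in> tangent_space A p \<Longrightarrow> g p w (r *\<^sub>R u) = r * g p w u"
  using g_scaleR_left[of u p w r] g_sym[of w p] subspace_mul[OF tangent_space_subspace] by simp

lemma g_diff_right: "u \<in> tangent_space A p \<Longrightarrow> v \<in> tangent_space A p \<Longrightarrow> w \<in> tangent_space A p \<Longrightarrow>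
    g p w (u - v) = g p w u - g p w v"
  using g_diff_left[of u p v w] g_sym[of w p] subspace_diff[OF tangent_space_subspace] by simp

lemma Vq_orthogonal: "w \<in> Vq M p \<Longrightarrow> g p w (\<nu> p) = 0" "w \<in> Vq M p \<Longrightarrow> g p w (\<nu>s p) = 0"
  "w \<in> Vq M p \<Longrightarrow> g p (\<nu> p) w = 0" "w \<in> Vq M p \<Longrightarrow> g p (\<nu>s p) w = 0"
  using Vp_Vq_orthogonal[OF nu_mem] Vps_Vq_orthogonal[OF nus_mem] g_sym[OF Vq_tangent nu_tangent] g_sym[OF Vq_tangent nus_tangent]
  by simp_all

lemma frame_decomposition:
  assumes "v \<in> tangent_space A p"
  shows "\<exists>r s. \<exists>w\<in>Vq M p. v = r *\<^sub>R \<nu> p + s *\<^sub>R \<nu>s p + w"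
proof -
  obtain a b w where "a \<in> Vp M p" "b \<in> Vps M p" "w \<in> Vq M p" "v = a + b + w"
    using Witt_decomposition[OF assms] by blast
  then show ?thesis
    using subbundle_line[OF frame_bundle(1) nu_mem nu_nonzero] subbundle_line[OF frame_bundle(2) nus_mem nus_nonzero] by metis
qed

lemma mem_Vq_if_orthogonal:
  assumes v: "v \<in> tangent_space A p" and "g p v (\<nu> p) = 0" "g p v (\<nu>s p) = 0"
  shows "v \<in> Vq M p"
proof -
  obtain r s w where w: "w \<in> Vq M p" "v = r *\<^sub>R \<nu> p + s *\<^sub>R \<nu>s p + w" using frame_decomposition[OF v] by blast
  note t = nu_tangent nus_tangent Vq_tangent[OF w(1)] subspace_mul[OF tangent_space_subspace nu_tangent]
    subspace_mul[OF tangent_space_subspace nus_tangent]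
    subspace_add[OF tangent_space_subspace subspace_mul[OF tangent_space_subspace nu_tangent] subspace_mul[OF tangent_space_subspace nus_tangent]]
  have "g p v (\<nu> p) = s" "g p v (\<nu>s p) = r"
    using w(1) by (simp_all add: w(2) g_add_left g_scaleR_left t Vp_null[OF nu_mem] Vps_null[OF nus_mem] Vq_orthogonal
      g_nu_nus g_sym[OF nus_tangent nu_tangent])
  then show ?thesis using w assms by simp
qed

lemma Vq_eqI:
  assumes "v \<in> Vq M p" "w \<in> Vq M p" "\<And>y. y \<in> Vq M p \<Longrightarrow> g p v y = g p w y"
  shows "v = w"
proof (rule ccontr)
  assume "v \<noteq> w"
  have d: "v - w \<in> Vq M p" by (rule subspace_diff[OF Vq_subspace assms(1,2)])
  then have "g p (v - w) (v - w) > 0" using Vq_positive \<open>v \<noteq> w\<close> by simp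
  moreover have "g p (v - w) (v - w) = 0"
    using g_diff_left[OF Vq_tangent Vq_tangent Vq_tangent, OF assms(1,2) d] assms(3)[OF d] by simp
  ultimately show False by simp
qed

lemma sharp_H_works:
  assumes "\<And>u v. u \<in> Vq M p \<Longrightarrow> v \<in> Vq M p \<Longrightarrow> \<beta> (u + v) = \<beta> u + \<beta> v"
    and "\<And>u r. u \<in> Vq M p \<Longrightarrow> \<beta> (r *\<^sub>R u) = r * \<beta> u"
  shows "sharp_H M p \<beta> \<in> Vq M p" and "y \<in> Vq M p \<Longrightarrow> g p (sharp_H M p \<beta>) y = \<beta> y"
proof -
  obtain B where B: "finite B" "Vq M p = span B" using Vq_finite_span by blast
  have "\<exists>w\<in>span B. \<forall>y\<in>span B. g p w y = \<beta> y"
  proof (rule definite_form_representation[OF B(1) order_refl])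
    fix u v w :: "('m, 'e) tangent" and r :: real assume *: "u \<in> span B" "w \<in> span B"
    then have t: "u \<in> tangent_space A p" "w \<in> tangent_space A p" using Vq_tangent B(2) by auto
    show "g p (r *\<^sub>R u) w = r * g p u w" "g p u w = g p w u" using g_scaleR_left[OF t] g_sym[OF t] by auto
    show "g p (u + v) w = g p u w + g p v w" if "v \<in> span B"
      using g_add_left[OF t(1) _ t(2), of v] Vq_tangent[of v p] that B(2) by auto
  qed (use assms B(2) Vq_positive in auto)
  then obtain w where w: "w \<in> Vq M p" "\<And>y. y \<in> Vq M p \<Longrightarrow> g p w y = \<beta> y" using B(2) by auto
  have uniq: "w' = w" if w': "w' \<in> Vq M p \<and> (\<forall>y\<in>Vq M p. g p w' y = \<beta> y)" for w'
    by (rule Vq_eqI[of _ p]) (use w w' in auto)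
  have "sharp_H M p \<beta> \<in> Vq M p \<and> (\<forall>y\<in>Vq M p. g p (sharp_H M p \<beta>) y = \<beta> y)"
    unfolding sharp_H_def by (rule theI[of _ w]) (use w uniq in auto)
  then show "sharp_H M p \<beta> \<in> Vq M p" and "y \<in> Vq M p \<Longrightarrow> g p (sharp_H M p \<beta>) y = \<beta> y" by auto
qed

end

section \<open>The canonical Witt connection\<close>

locale canonical_witt = witt_structure M
  for M :: "('m::{t2_space, second_countable_topology}, 'e::euclidean_space) witt" +
  fixes D :: "('m \<Rightarrow> ('m, 'e) tangent) \<Rightarrow> ('m \<Rightarrow> ('m, 'e) tangent) \<Rightarrow> 'm \<Rightarrow> ('m, 'e) tangent"
  assumes canonical: "canonical_witt_connection M D"

sublocale canonical_witt \<subseteq> connection "atlas M" D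
  using canonical by unfold_locales (simp add: canonical_witt_connection_def)

context canonical_witt begin

lemma metric_connection: "metric_connection A g D"
  using canonical by (simp add: canonical_witt_connection_def)

lemma torsion_horizontal:
  "open W \<Longrightarrow> X \<in> sections A (Vq M) W \<Longrightarrow> Y \<in> sections A (Vq M) W \<Longrightarrow> p \<in> W \<Longrightarrow>
    torsion A D X Y p = ext_deriv A \<sigma> X Y p *\<^sub>R \<nu> p + ext_deriv A \<sigma>s X Y p *\<^sub>R \<nu>s p"
  using canonical unfolding canonical_witt_connection_def by blast

lemma torsion_nu:
  "open W \<Longrightarrow> X \<in> sections A (Vq M) W \<Longrightarrow> p \<in> W \<Longrightarrow> torsion A D \<nu> X p =
     ext_deriv A \<sigma>s \<nu> X p *\<^sub>R \<nu>s p - (1/2 * lie_bilin A X g \<nu> \<nu>s p) *\<^sub>R \<nu> p + torsion_Vq M \<nu> X p"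
  and torsion_nus:
  "open W \<Longrightarrow> X \<in> sections A (Vq M) W \<Longrightarrow> p \<in> W \<Longrightarrow> torsion A D \<nu>s X p =
     ext_deriv A \<sigma> \<nu>s X p *\<^sub>R \<nu> p - (1/2 * lie_bilin A X g \<nu> \<nu>s p) *\<^sub>R \<nu>s p + torsion_Vq M \<nu>s X p"
  using canonical unfolding canonical_witt_connection_def by blast+

text \<open>The torsion of two horizontal vector fields is a combination of \<open>\<nu>\<close> and \<open>\<nu>\<^sup>*\<close>.\<close>

lemma g_torsion_christoffel:
  assumes "u \<in> Vq M p" "v \<in> Vq M p" "w \<in> Vq M p"
  shows "g p w (christoffel p u v - christoffel p v u) = 0"
proof -
  obtain W where W: "open W" "p \<in> W" "\<And>u. u \<in> Vq M p \<Longrightarrow> \<exists>X\<in>sections A (Vq M) W. X p = u"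
    using Vq_extension by blast
  obtain X Y where XY: "X \<in> sections A (Vq M) W" "Y \<in> sections A (Vq M) W" "X p = u" "Y p = v"
    using W(3) assms by metis
  then have f: "X \<in> vector_fields A W" "Y \<in> vector_fields A W" by (auto simp: sections_def)
  note t = nu_tangent nus_tangent Vq_tangent[OF assms(3)] subspace_mul[OF tangent_space_subspace nu_tangent]
    subspace_mul[OF tangent_space_subspace nus_tangent]
  have eq: "christoffel p u v - christoffel p v u = ext_deriv A \<sigma> X Y p *\<^sub>R \<nu> p + ext_deriv A \<sigma>s X Y p *\<^sub>R \<nu>s p"
    using torsion_coord[OF W(1,2) f] torsion_horizontal[OF W(1) XY(1,2) W(2)] XY(3,4) by simp
  show ?thesis
    unfolding eq by (simp add: g_add_right t g_scaleR_right Vq_orthogonal[OF assms(3)])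
qed

text \<open>The \<open>Vq\<close>-component of the torsion is defined with constant extensions, which are not sections of \<open>Vq\<close>. By
  tensoriality of the Lie derivative they can be replaced by sections.\<close>

lemma g_torsion_Vq:
  assumes W: "open W" "p \<in> W" and N: "N \<in> vector_fields A UNIV" and X: "X \<in> sections A (Vq M) W"
  shows "torsion_Vq M N X p \<in> Vq M p"
    and "g p (torsion_Vq M N X p) (X p) = 1/2 * lie_bilin A N g X X p"
proof -
  let ?\<kappa> = "chart_at A p"
  have Xf: "X \<in> vector_fields A W" and Xp: "X p \<in> Vq M p" using X W(2) by (auto simp: sections_def)
  have W': "open (W \<inter> fst ?\<kappa>)" "p \<in> W \<inter> fst ?\<kappa>" using W chart_open[OF chart_at(1)] chart_at(2) by auto
  have Nf: "N \<in> vector_fields A W" by (rule vector_fields_mono[OF N]) simp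
  have lie: "lie_bilin A N g X (const_ext A p y) p = bilin_deriv g ?\<kappa> p (N p ?\<kappa>) (X p ?\<kappa>) (y ?\<kappa>)
    + bilin_coord A g ?\<kappa> (snd ?\<kappa> p) (comp_deriv ?\<kappa> p N (X p ?\<kappa>)) (y ?\<kappa>)
    + bilin_coord A g ?\<kappa> (snd ?\<kappa> p) (X p ?\<kappa>) (comp_deriv ?\<kappa> p N (y ?\<kappa>))" if "y \<in> Vq M p" for y
    using lie_bilin_coord[OF metric_smooth W' vector_fields_mono[OF N subset_UNIV] vector_fields_mono[OF Xf Int_lower1] const_ext_on[OF W(2)]]
      const_ext_at[OF Vq_tangent[OF that]] by simp
  note lin = linear_bilin_deriv_last[OF metric_smooth chart_at] bilin_coord_linear_right[OF metric_smooth chart_at(1), of p "snd ?\<kappa> p"]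
    has_derivative_linear[OF vector_field_has_derivative[OF Nf chart_at(1) W(2) chart_at(2)]]
  have add: "1/2 * lie_bilin A N g X (const_ext A p (u + v)) p
      = 1/2 * lie_bilin A N g X (const_ext A p u) p + 1/2 * lie_bilin A N g X (const_ext A p v) p"
    if "u \<in> Vq M p" "v \<in> Vq M p" for u v
    using that subspace_add[OF Vq_subspace that]
    by (simp add: lie lin[THEN linear_add] algebra_simps add_divide_distrib)
  have scale: "1/2 * lie_bilin A N g X (const_ext A p (r *\<^sub>R u)) p = r * (1/2 * lie_bilin A N g X (const_ext A p u) p)"
    if "u \<in> Vq M p" for u r
    using that subspace_mul[OF Vq_subspace that, of r]
    by (simp add: lie lin[THEN linear_scale] scaleR_fun_def algebra_simps add_divide_distrib)
  show "torsion_Vq M N X p \<in> Vq M p"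
    unfolding torsion_Vq_def by (rule sharp_H_works(1)[OF add scale])
  have "g p (torsion_Vq M N X p) (X p) = 1/2 * lie_bilin A N g X (const_ext A p (X p)) p"
    unfolding torsion_Vq_def by (rule sharp_H_works(2)[OF add scale Xp])
  then show "g p (torsion_Vq M N X p) (X p) = 1/2 * lie_bilin A N g X X p"
    using lie[OF Xp] lie_bilin_coord[OF metric_smooth W Nf Xf Xf] by simp
qed

text \<open>For \<open>N = \<nu>\<close> or \<open>\<nu>\<^sup>*\<close> one has \<open>\<nabla>\<^sub>X N = \<nabla>\<^sub>N X - T(N, X) - [N, X]\<close>. Paired with \<open>X\<close>, the first and last terms give
  \<open>1/2 (\<L>\<^sub>N g)(X, X)\<close>, which is what the torsion was chosen to cancel. So \<open>\<nabla>\<^sub>X X\<close> stays in \<open>H\<close>.\<close>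

lemma g_conn_frame:
  assumes W: "open W" "p \<in> W" and N: "N = \<nu> \<or> N = \<nu>s" and X: "X \<in> sections A (Vq M) W"
  shows "g p (X p) (D X N p) = 0"
proof -
  have Xf: "X \<in> vector_fields A W" and Xp: "X p \<in> Vq M p" using X W(2) by (auto simp: sections_def)
  have NU: "N \<in> vector_fields A UNIV" using N nu_field nus_field by blast
  have Nf: "N \<in> vector_fields A W" by (rule vector_fields_mono[OF NU]) simp
  note Xt = Vq_tangent[OF Xp]
  note Tt = Vq_tangent[OF g_torsion_Vq(1)[OF W NU X]]
  note Lt = lie_bracket_tangent[OF W Nf Xf]
  note Dt = vector_field_tangent[OF conn_field[OF W Nf Xf] W(2)]
  note t = nu_tangent[of p] nus_tangent[of p] subspace_mul[OF tangent_space_subspace nu_tangent[of p]]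
    subspace_mul[OF tangent_space_subspace nus_tangent[of p]]
  have "torsion A D N X p \<in> tangent_space A p \<and> g p (X p) (torsion A D N X p) = g p (X p) (torsion_Vq M N X p)"
  proof (cases "N = \<nu>")
    case True
    note eq = torsion_nu[OF W(1) X W(2)]
    note [simp] = t Tt[unfolded True] Xt
    show ?thesis unfolding True eq
      by (simp add: subspace_add[OF tangent_space_subspace] subspace_diff[OF tangent_space_subspace]
        g_add_right g_diff_right g_scaleR_right Vq_orthogonal[OF Xp])
  next
    case False
    then have N': "N = \<nu>s" using N by simp
    note eq = torsion_nus[OF W(1) X W(2)]
    note [simp] = t Tt[unfolded N'] Xt
    show ?thesis unfolding N' eq
      by (simp add: subspace_add[OF tangent_space_subspace] subspace_diff[OF tangent_space_subspace]
        g_add_right g_diff_right g_scaleR_right Vq_orthogonal[OF Xp])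
  qed
  then have tor: "torsion A D N X p \<in> tangent_space A p"
    "g p (X p) (torsion A D N X p) = 1/2 * lie_bilin A N g X X p"
    using g_torsion_Vq(2)[OF W NU X] g_sym[OF Xt Tt] by auto
  have "D X N p = D N X p - torsion A D N X p - lie_bracket A N X p"
    by (simp add: torsion_def)
  then have "g p (X p) (D X N p) = g p (X p) (D N X p) - 1/2 * lie_bilin A N g X X p - g p (X p) (lie_bracket A N X p)"
    using tor Xt Lt Dt by (simp add: g_diff_right subspace_diff[OF tangent_space_subspace])
  moreover have "dir_deriv A (\<lambda>q. g q (X q) (X q)) p (N p) = g p (D N X p) (X p) + g p (X p) (D N X p)"
    by (rule metric_connection[unfolded metric_connection_def, rule_format, OF W(1) Nf Xf Xf W(2)])
  ultimately show ?thesis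
    using g_sym[OF Xt Dt] g_sym[OF Xt Lt] by (simp add: lie_bilin_def field_simps)
qed

text \<open>This is \<open>g(u, \<nabla>\<^sub>u N) = 0\<close>, for a single vector \<open>u\<close> and in coordinates.\<close>

lemma g_christoffel_frame:
  assumes N: "N = \<nu> \<or> N = \<nu>s" and u: "u \<in> Vq M p"
  defines "\<kappa> \<equiv> chart_at A p"
  shows "bilin_coord A g \<kappa> (snd \<kappa> p) (u \<kappa>) (comp_deriv \<kappa> p N (u \<kappa>)) + g p u (christoffel p u (N p)) = 0"
proof -
  have k: "\<kappa> \<in> A" "p \<in> fst \<kappa>" by (simp_all add: \<kappa>_def chart_at)
  obtain W where W: "open W" "p \<in> W" "\<And>u. u \<in> Vq M p \<Longrightarrow> \<exists>X\<in>sections A (Vq M) W. X p = u"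
    using Vq_extension by blast
  obtain X where X: "X \<in> sections A (Vq M) W" "X p = u" using W(3) u by blast
  have Xf: "X \<in> vector_fields A W" using X by (auto simp: sections_def)
  have Nf: "N \<in> vector_fields A W" by (rule vector_fields_mono[of _ UNIV]) (use N nu_field nus_field in auto)
  note ut = Vq_tangent[OF u]
  note ct = coord_vec_tangent[OF k, of "comp_deriv \<kappa> p N (u \<kappa>)"]
  have "0 = g p u (coord_vec A \<kappa> p (comp_deriv \<kappa> p N (u \<kappa>)) + christoffel p u (N p))"
    using g_conn_frame[OF W(1,2) N X(1)] conn_coord[OF W(1,2) Xf Nf] by (simp add: X(2) \<kappa>_def)
  also have "\<dots> = g p u (coord_vec A \<kappa> p (comp_deriv \<kappa> p N (u \<kappa>))) + g p u (christoffel p u (N p))"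
    by (rule g_add_right[OF ct christoffel_tangent ut])
  also have "g p u (coord_vec A \<kappa> p (comp_deriv \<kappa> p N (u \<kappa>)))
      = bilin_coord A g \<kappa> (snd \<kappa> p) (u \<kappa>) (comp_deriv \<kappa> p N (u \<kappa>))"
    using bilin_coord_eval[OF k ut ct, of g] by (simp add: coord_vec_same[OF k])
  finally show ?thesis by simp
qed

section \<open>The Euler-Lagrange equation of a horizontal curve\<close>

definition multiplier_form :: "('m \<Rightarrow> real^2) \<Rightarrow> ('m, 'e) form" where
  "multiplier_form L p v = L p $ 1 * \<sigma> p v + L p $ 2 * \<sigma>s p v"

lemma sigma_smooth: "smooth_form A \<sigma>" and sigmas_smooth: "smooth_form A \<sigma>s"
  using smooth_bilin_form[OF metric_smooth nus_field] smooth_bilin_form[OF metric_smooth nu_field]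
  by (simp_all add: wsigma_def[abs_def] wsigmas_def[abs_def])

lemma multiplier_form_smooth:
  assumes L: "smooth_function A UNIV L" shows "smooth_form A (multiplier_form L)"
  unfolding smooth_form_def
proof (intro conjI allI ballI impI)
  fix p u v and r :: real assume t: "u \<in> tangent_space A p" "v \<in> tangent_space A p"
  show "multiplier_form L p (u + v) = multiplier_form L p u + multiplier_form L p v"
    "multiplier_form L p (r *\<^sub>R u) = r * multiplier_form L p u"
    unfolding multiplier_form_def smooth_form_add[OF sigma_smooth t] smooth_form_add[OF sigmas_smooth t]
      smooth_form_scaleR[OF sigma_smooth t(1)] smooth_form_scaleR[OF sigmas_smooth t(1)]
    by (simp_all add: algebra_simps)
next
  fix W X assume W: "open W" and X: "X \<in> vector_fields A W"
  show "smooth_function A W (\<lambda>q. multiplier_form L q (X q))"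
    unfolding smooth_function_def
  proof
    fix \<kappa> assume k: "\<kappa> \<in> A"
    note o = chart_image_Int_open[OF k W]
    have "smooth_on (snd \<kappa> ` (UNIV \<inter> fst \<kappa>)) (L \<circ> cinv \<kappa>)" using L k unfolding smooth_function_def by blast
    then have "smooth_on (snd \<kappa> ` (W \<inter> fst \<kappa>)) (L \<circ> cinv \<kappa>)" by (rule smooth_on_subset) auto
    then have Li: "smooth_on (snd \<kappa> ` (W \<inter> fst \<kappa>)) (\<lambda>x. (L \<circ> cinv \<kappa>) x $ i)" for i
      by (rule smooth_on_linear_image[OF o bounded_linear_vec_nth])
    have s: "smooth_on (snd \<kappa> ` (W \<inter> fst \<kappa>)) ((\<lambda>q. \<sigma> q (X q)) \<circ> cinv \<kappa>)"
      "smooth_on (snd \<kappa> ` (W \<inter> fst \<kappa>)) ((\<lambda>q. \<sigma>s q (X q)) \<circ> cinv \<kappa>)"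
      using smooth_form_function[OF sigma_smooth W X] smooth_form_function[OF sigmas_smooth W X] k
      unfolding smooth_function_def by blast+
    show "smooth_on (snd \<kappa> ` (W \<inter> fst \<kappa>)) ((\<lambda>q. multiplier_form L q (X q)) \<circ> cinv \<kappa>)"
      using smooth_on_add[OF o smooth_on_mult[OF o Li[of 1] s(1)] smooth_on_mult[OF o Li[of 2] s(2)]]
      by (simp add: multiplier_form_def o_def)
  qed
qed

lemma multiplier_form_deriv:
  assumes L: "smooth_function A UNIV L" and k: "\<kappa> \<in> A" "p \<in> fst \<kappa>"
  shows "((L \<circ> cinv \<kappa>) has_derivative fderiv (L \<circ> cinv \<kappa>) (snd \<kappa> p)) (at (snd \<kappa> p))"
    and "form_deriv (multiplier_form L) \<kappa> p d e =
      L p $ 1 * form_deriv \<sigma> \<kappa> p d e + fderiv (L \<circ> cinv \<kappa>) (snd \<kappa> p) d $ 1 * form_coord A \<sigma> \<kappa> (snd \<kappa> p) e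
    + (L p $ 2 * form_deriv \<sigma>s \<kappa> p d e + fderiv (L \<circ> cinv \<kappa>) (snd \<kappa> p) d $ 2 * form_coord A \<sigma>s \<kappa> (snd \<kappa> p) e)"
proof -
  let ?x = "snd \<kappa> p"
  have x: "?x \<in> snd \<kappa> ` fst \<kappa>" using k by blast
  have "smooth_on (snd \<kappa> ` (UNIV \<inter> fst \<kappa>)) (L \<circ> cinv \<kappa>)" using L k unfolding smooth_function_def by blast
  then show d: "((L \<circ> cinv \<kappa>) has_derivative fderiv (L \<circ> cinv \<kappa>) ?x) (at ?x)"
    by (rule smooth_on_has_derivative) (use k in auto)
  note di = bounded_linear.has_derivative[OF bounded_linear_vec_nth d]
  have f: "((\<lambda>x. form_coord A s \<kappa> x e) has_derivative (\<lambda>d. form_deriv s \<kappa> p d e)) (at ?x)" if "smooth_form A s" for s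
    using form_coord_differentiable[OF that k(1) x] by (rule frechet_derivative_works[THEN iffD1])
  have "((\<lambda>x. (L \<circ> cinv \<kappa>) x $ 1 * form_coord A \<sigma> \<kappa> x e + (L \<circ> cinv \<kappa>) x $ 2 * form_coord A \<sigma>s \<kappa> x e) has_derivative
    (\<lambda>d. (L \<circ> cinv \<kappa>) ?x $ 1 * form_deriv \<sigma> \<kappa> p d e + fderiv (L \<circ> cinv \<kappa>) ?x d $ 1 * form_coord A \<sigma> \<kappa> ?x e
    + ((L \<circ> cinv \<kappa>) ?x $ 2 * form_deriv \<sigma>s \<kappa> p d e + fderiv (L \<circ> cinv \<kappa>) ?x d $ 2 * form_coord A \<sigma>s \<kappa> ?x e))) (at ?x)"
    by (intro has_derivative_add has_derivative_mult di f sigma_smooth sigmas_smooth)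
  then have "((\<lambda>x. form_coord A (multiplier_form L) \<kappa> x e) has_derivative
    (\<lambda>d. (L \<circ> cinv \<kappa>) ?x $ 1 * form_deriv \<sigma> \<kappa> p d e + fderiv (L \<circ> cinv \<kappa>) ?x d $ 1 * form_coord A \<sigma> \<kappa> ?x e
    + ((L \<circ> cinv \<kappa>) ?x $ 2 * form_deriv \<sigma>s \<kappa> p d e + fderiv (L \<circ> cinv \<kappa>) ?x d $ 2 * form_coord A \<sigma>s \<kappa> ?x e))) (at ?x)"
    by (rule has_derivative_transform_within_open[OF _ chart_image_open[OF k(1)] x])
      (simp add: form_coord_def multiplier_form_def)
  from frechet_eqI[OF this, of d] show "form_deriv (multiplier_form L) \<kappa> p d e =
      L p $ 1 * form_deriv \<sigma> \<kappa> p d e + fderiv (L \<circ> cinv \<kappa>) ?x d $ 1 * form_coord A \<sigma> \<kappa> ?x e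
    + (L p $ 2 * form_deriv \<sigma>s \<kappa> p d e + fderiv (L \<circ> cinv \<kappa>) ?x d $ 2 * form_coord A \<sigma>s \<kappa> ?x e)"
    by (simp add: cinv_chart k)
qed

lemma sigma_values: "\<sigma> p (\<nu> p) = 1" "\<sigma> p (\<nu>s p) = 0" "\<sigma>s p (\<nu> p) = 0" "\<sigma>s p (\<nu>s p) = 1"
  "w \<in> Vq M p \<Longrightarrow> \<sigma> p w = 0" "w \<in> Vq M p \<Longrightarrow> \<sigma>s p w = 0"
  using g_nu_nus g_sym[OF nus_tangent nu_tangent] Vp_null[OF nu_mem] Vps_null[OF nus_mem] Vq_orthogonal
  by (simp_all add: wsigma_def wsigmas_def)

text \<open>The derivative of the constant function \<open>s(N)\<close> along \<open>u\<close> vanishes.\<close>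

lemma sigma_frame_derivative:
  fixes p :: 'm
  assumes "smooth_form A s" "N \<in> vector_fields A UNIV" "\<And>q. s q (N q) = k"
  defines "\<kappa> \<equiv> chart_at A p"
  shows "form_deriv s \<kappa> p (u \<kappa>) (N p \<kappa>) = - form_coord A s \<kappa> (snd \<kappa> p) (comp_deriv \<kappa> p N (u \<kappa>))"
  using dir_deriv_form[OF assms(1) open_UNIV UNIV_I assms(2), of p u] dir_deriv_locally_const[where W = UNIV and p = p and f = "\<lambda>q. s q (N q)" and c = k and v = u] assms(3)
  unfolding \<kappa>_def by simp

lemma covariant_deriv_coord:
  fixes c :: "real \<Rightarrow> 'm" and t :: real
  defines "\<kappa> \<equiv> chart_at A (c t)" and "u \<equiv> velocity A c t"
  shows "covariant_deriv A D c (velocity A c) t =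
    coord_vec A \<kappa> (c t) (velocity_deriv \<kappa> c t) + christoffel (c t) u u"
  by (simp add: covariant_deriv_def christoffel_def \<kappa>_def u_def Let_def)

lemma horizontal_extension:
  assumes "c \<in> horizontal_curves M x y"
  obtains T C where "smooth_into A T C" "{0..1} \<subseteq> T" "\<And>t. t \<in> {0..1} \<Longrightarrow> C t = c t"
  using assms unfolding horizontal_curves_def curves_def smooth_map_on_iff_extension by blast

lemma horizontal_velocity: "c \<in> horizontal_curves M x y \<Longrightarrow> t \<in> {0..1} \<Longrightarrow> velocity A c t \<in> Vq M (c t)"
  by (simp add: horizontal_curves_def)

lemma
  assumes c: "c \<in> horizontal_curves M x y" and t: "t \<in> {0..1}" and k: "\<kappa> \<in> A" "c t \<in> fst \<kappa>"
  shows curve_near: "\<exists>d>0. \<forall>s\<in>{0..1}. dist s t < d \<longrightarrow> c s \<in> fst \<kappa>"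
    and curve_component_derivative: "((snd \<kappa> \<circ> c) has_vector_derivative velocity A c t \<kappa>) (at t within {0..1})"
    and velocity_component_derivative: "((\<lambda>s. velocity A c s \<kappa>) has_vector_derivative
      velocity_deriv \<kappa> c t) (at t within {0..1})"
proof -
  obtain T C where C: "smooth_into A T C" "{0..1} \<subseteq> T" "\<And>t. t \<in> {0..1} \<Longrightarrow> C t = c t"
    using horizontal_extension[OF c] by blast
  have "open (T \<inter> C -` fst \<kappa>)" "t \<in> T \<inter> C -` fst \<kappa>"
    using smooth_into_chart_open[OF C(1) k(1)] C(2,3) t k by auto
  then obtain d where d: "d > 0" "ball t d \<subseteq> T \<inter> C -` fst \<kappa>" using openE by blast
  have "c s \<in> fst \<kappa>" if "s \<in> {0..1}" "dist s t < d" for s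
  proof -
    have "s \<in> ball t d" using that by (simp add: dist_commute)
    then show ?thesis using d(2) C(3)[OF that(1)] by auto
  qed
  then show "\<exists>d>0. \<forall>s\<in>{0..1}. dist s t < d \<longrightarrow> c s \<in> fst \<kappa>" using d(1) by blast
  show "((snd \<kappa> \<circ> c) has_vector_derivative velocity A c t \<kappa>) (at t within {0..1})"
    by (rule curve_has_vector_derivative[OF C t k])
  note v = velocity_has_vector_derivative[OF C t k]
  show "((\<lambda>s. velocity A c s \<kappa>) has_vector_derivative
      velocity_deriv \<kappa> c t) (at t within {0..1})"
    using vector_derivative_within_closed_interval[OF _ t v] v by simp
qed

lemma curve_chain:
  assumes c: "c \<in> horizontal_curves M x y" and t: "t \<in> {0..1}" and k: "\<kappa> \<in> A" "c t \<in> fst \<kappa>"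
    and f: "((\<lambda>x. f (cinv \<kappa> x)) has_derivative f') (at (snd \<kappa> (c t)))"
  shows "((\<lambda>s. f (c s)) has_vector_derivative f' (velocity A c t \<kappa>)) (at t within {0..1})"
proof -
  obtain d where d: "d > 0" "\<And>s. s \<in> {0..1} \<Longrightarrow> dist s t < d \<Longrightarrow> c s \<in> fst \<kappa>"
    using curve_near[OF c t k] by blast
  have "((\<lambda>s. f (cinv \<kappa> ((snd \<kappa> \<circ> c) s))) has_derivative (\<lambda>r. f' (r *\<^sub>R velocity A c t \<kappa>))) (at t within {0..1})"
    using has_derivative_compose[OF curve_component_derivative[OF c t k, unfolded has_vector_derivative_def], of "\<lambda>x. f (cinv \<kappa> x)"] f
    by simp
  then have "((\<lambda>s. f (cinv \<kappa> ((snd \<kappa> \<circ> c) s))) has_vector_derivative f' (velocity A c t \<kappa>)) (at t within {0..1})"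
    unfolding has_vector_derivative_def by (simp add: linear_scale[OF has_derivative_linear[OF f]])
  then show ?thesis
    by (rule has_vector_derivative_transform_within[OF _ d(1) t]) (simp add: d(2) cinv_chart[OF k(1)])
qed

text \<open>This is the derivative of \<open>g(u, N) = 0\<close> along a horizontal curve.\<close>

lemma horizontal_frame_derivative:
  assumes c: "c \<in> horizontal_curves M x y" and t: "t \<in> {0..1}" and N: "N = \<nu> \<or> N = \<nu>s"
    and k: "\<kappa> \<in> A" "c t \<in> fst \<kappa>"
  defines "u \<equiv> velocity A c t"
  shows "bilin_deriv g \<kappa> (c t) (u \<kappa>) (u \<kappa>) (N (c t) \<kappa>)
    + bilin_coord A g \<kappa> (snd \<kappa> (c t)) (velocity_deriv \<kappa> c t) (N (c t) \<kappa>)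
    + bilin_coord A g \<kappa> (snd \<kappa> (c t)) (u \<kappa>) (comp_deriv \<kappa> (c t) N (u \<kappa>)) = 0" (is "?R = 0")
proof -
  have NU: "N \<in> vector_fields A UNIV" using N nu_field nus_field by blast
  have img: "(snd \<kappa> \<circ> c) t \<in> snd \<kappa> ` fst \<kappa>" using k by auto
  obtain d where d: "d > 0" "\<And>s. s \<in> {0..1} \<Longrightarrow> dist s t < d \<Longrightarrow> c s \<in> fst \<kappa>"
    using curve_near[OF c t k] by blast
  have Nc: "((\<lambda>s. N (c s) \<kappa>) has_vector_derivative comp_deriv \<kappa> (c t) N (u \<kappa>)) (at t within {0..1})"
    unfolding u_def by (rule curve_chain[OF c t k vector_field_has_derivative[OF NU k(1) UNIV_I k(2)]])
  have "((\<lambda>s. bilin_coord A g \<kappa> ((snd \<kappa> \<circ> c) s) (velocity A c s \<kappa>) (N (c s) \<kappa>)) has_derivative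
    (\<lambda>r. fderiv (\<lambda>x. bilin_coord A g \<kappa> x (velocity A c t \<kappa>) (N (c t) \<kappa>)) ((snd \<kappa> \<circ> c) t) (r *\<^sub>R velocity A c t \<kappa>)
    + bilin_coord A g \<kappa> ((snd \<kappa> \<circ> c) t) (r *\<^sub>R velocity_deriv \<kappa> c t) (N (c t) \<kappa>)
    + bilin_coord A g \<kappa> ((snd \<kappa> \<circ> c) t) (velocity A c t \<kappa>) (r *\<^sub>R comp_deriv \<kappa> (c t) N (u \<kappa>)))) (at t within {0..1})"
    by (rule bilin_along_has_derivative[OF bilin_coord_linear_right[OF metric_smooth k(1)] bilin_coord_linear_left[OF metric_smooth k(1)]
        bilin_coord_differentiable[OF metric_smooth k(1) img]
        curve_component_derivative[OF c t k, unfolded has_vector_derivative_def]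
        velocity_component_derivative[OF c t k, unfolded has_vector_derivative_def]
        Nc[unfolded has_vector_derivative_def]])
  then have d1: "((\<lambda>s. bilin_coord A g \<kappa> ((snd \<kappa> \<circ> c) s) (velocity A c s \<kappa>) (N (c s) \<kappa>)) has_vector_derivative ?R) (at t within {0..1})"
    using bilin_coord_differentiable[OF metric_smooth k(1) img, THEN linear_frechet_derivative]
    by (simp add: has_vector_derivative_def u_def distrib_left linear_scale[OF bilin_coord_linear_right[OF metric_smooth k(1)]]
        linear_scale[OF bilin_coord_linear_left[OF metric_smooth k(1)]] linear_scale)
  have d2: "((\<lambda>s. bilin_coord A g \<kappa> ((snd \<kappa> \<circ> c) s) (velocity A c s \<kappa>) (N (c s) \<kappa>)) has_vector_derivative 0) (at t within {0..1})"
  proof (rule has_vector_derivative_transform_within[OF has_vector_derivative_const[of 0] d(1) t])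
    fix s assume s: "s \<in> {0..1}" "dist s t < d"
    note h = horizontal_velocity[OF c s(1)]
    have "N (c s) \<in> tangent_space A (c s)" using N nu_tangent nus_tangent by blast
    from bilin_coord_eval[OF k(1) d(2)[OF s] Vq_tangent[OF h] this, of g]
    show "0 = bilin_coord A g \<kappa> ((snd \<kappa> \<circ> c) s) (velocity A c s \<kappa>) (N (c s) \<kappa>)"
      using N Vq_orthogonal[OF h] by auto
  qed
  show ?thesis
    using vector_derivative_within_closed_interval[OF _ t d1] vector_derivative_within_closed_interval[OF _ t d2] by simp
qed

text \<open>Differentiating \<open>g(u, N) = 0\<close> along the curve gives \<open>g(\<nabla>\<^sub>u u, N) = - g(u, \<nabla>\<^sub>u N) = 0\<close> for both null fields \<open>N\<close>.\<close>

lemma covariant_deriv_horizontal: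
  assumes c: "c \<in> horizontal_curves M x y" and t: "t \<in> {0..1}"
  shows "covariant_deriv A D c (velocity A c) t \<in> Vq M (c t)"
proof -
  let ?p = "c t" and ?u = "velocity A c t"
  let ?\<kappa> = "chart_at A ?p"
  let ?u' = "velocity_deriv ?\<kappa> c t"
  note k = chart_at[of ?p]
  note u = horizontal_velocity[OF c t]
  note ut = Vq_tangent[OF u]
  note at = coord_vec_tangent[OF k, of ?u'] christoffel_tangent[of ?p ?u ?u]
  have z: "g ?p (covariant_deriv A D c (velocity A c) t) (N ?p) = 0" if N: "N = \<nu> \<or> N = \<nu>s" for N
  proof -
    have Nt: "N ?p \<in> tangent_space A ?p" using N nu_tangent nus_tangent by blast
    have "g ?p (covariant_deriv A D c (velocity A c) t) (N ?p)
       = bilin_coord A g ?\<kappa> (snd ?\<kappa> ?p) ?u' (N ?p ?\<kappa>) + g ?p (christoffel ?p ?u ?u) (N ?p)"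
      using bilin_coord_eval[OF k at(1) Nt, of g] g_add_left[OF at Nt]
      by (simp add: covariant_deriv_coord coord_vec_same[OF k])
    then show ?thesis
      using horizontal_frame_derivative[OF c t N k] g_christoffel_frame[OF N u]
        metric_christoffel[OF metric_smooth metric_connection ut ut Nt] by simp
  qed
  show ?thesis
    by (rule mem_Vq_if_orthogonal) (use z at in \<open>auto simp: covariant_deriv_coord intro: subspace_add[OF tangent_space_subspace]\<close>)
qed

text \<open>The metric terms combine to \<open>g(\<nabla>\<^sub>u u, w) + g(u, T(u, w))\<close>. The derivatives of the multipliers drop out
  because \<open>\<sigma>\<close> and \<open>\<sigma>\<^sup>*\<close> vanish on \<open>H\<close>.\<close>

lemma euler_lagrange_horizontal:
  assumes c: "c \<in> horizontal_curves M x y" and t: "t \<in> {0..1}" and L: "smooth_function A UNIV L"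
    and w: "w \<in> Vq M (c t)"
  defines "\<kappa> \<equiv> chart_at A (c t)" and "u \<equiv> velocity A c t"
  shows "euler_lagrange g (multiplier_form L) \<kappa> c t (w \<kappa>) =
    g (c t) (covariant_deriv A D c (velocity A c) t) w
    - (L (c t) $ 1 * ext_deriv_at A \<sigma> (c t) u w + L (c t) $ 2 * ext_deriv_at A \<sigma>s (c t) u w)"
proof -
  let ?p = "c t"
  let ?u' = "velocity_deriv \<kappa> c t"
  have k: "\<kappa> \<in> A" "?p \<in> fst \<kappa>" by (simp_all add: \<kappa>_def chart_at)
  have u: "u \<in> Vq M ?p" unfolding u_def by (rule horizontal_velocity[OF c t])
  note ut = Vq_tangent[OF u] and wt = Vq_tangent[OF w]
  note at = coord_vec_tangent[OF k, of ?u'] christoffel_tangent[of ?p]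
  have cov: "g ?p (covariant_deriv A D c (velocity A c) t) w = bilin_coord A g \<kappa> (snd \<kappa> ?p) ?u' (w \<kappa>) + g ?p (christoffel ?p u u) w"
    using bilin_coord_eval[OF k at(1) wt, of g] g_add_left[OF at wt]
    by (simp add: covariant_deriv_coord coord_vec_same[OF k] flip: \<kappa>_def u_def)
  have s0: "form_coord A \<sigma> \<kappa> (snd \<kappa> ?p) (v \<kappa>) = 0" "form_coord A \<sigma>s \<kappa> (snd \<kappa> ?p) (v \<kappa>) = 0" if "v \<in> Vq M ?p" for v
    using form_coord_eval[OF k Vq_tangent[OF that]] sigma_values that by simp_all
  have tor: "g ?p u (christoffel ?p u w) - g ?p (christoffel ?p w u) u = 0"
    using g_torsion_christoffel[OF u w u] g_diff_right[OF at(2) at(2) ut] g_sym[OF ut at(2)] by simp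
  note mc = metric_christoffel[OF metric_smooth metric_connection, of _ ?p, folded \<kappa>_def]
  have "bilin_deriv g \<kappa> ?p (u \<kappa>) (u \<kappa>) (w \<kappa>) = g ?p (christoffel ?p u u) w + g ?p u (christoffel ?p u w)"
    by (rule mc[OF ut ut wt])
  moreover have "bilin_deriv g \<kappa> ?p (w \<kappa>) (u \<kappa>) (u \<kappa>) = 2 * g ?p (christoffel ?p w u) u"
    using mc[OF wt ut ut] g_sym[OF ut at(2)] by simp
  ultimately show ?thesis
    using tor unfolding euler_lagrange_def Let_def u_def[symmetric] cov
      ext_deriv_at_coord[OF sigma_smooth ut wt, folded \<kappa>_def] ext_deriv_at_coord[OF sigmas_smooth ut wt, folded \<kappa>_def]
      multiplier_form_deriv(2)[OF L k] s0[OF u] s0[OF w]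
    by (simp add: algebra_simps)
qed

text \<open>The derivatives of \<open>g(u, N)\<close> along the curve and of \<open>\<sigma>(N)\<close>, \<open>\<sigma>\<^sup>*(N)\<close> vanish. This replaces the terms with the
  acceleration and with derivatives of \<open>g\<close> and \<open>\<sigma>\<close> along \<open>u\<close> by terms with the derivative of \<open>N\<close>, which
  complete the derivatives along \<open>N\<close> to Lie derivatives.\<close>

lemma euler_lagrange_frame:
  assumes c: "c \<in> horizontal_curves M x y" and t: "t \<in> {0..1}" and L: "smooth_function A UNIV L"
    and N: "N = \<nu> \<or> N = \<nu>s"
  defines "\<kappa> \<equiv> chart_at A (c t)" and "u \<equiv> velocity A c t"
  defines "L' \<equiv> fderiv (L \<circ> cinv \<kappa>) (snd \<kappa> (c t)) (u \<kappa>)"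
  shows "euler_lagrange g (multiplier_form L) \<kappa> c t (N (c t) \<kappa>) =
    L (c t) $ 1 * lie_form_at A N \<sigma> (c t) u + L (c t) $ 2 * lie_form_at A N \<sigma>s (c t) u
    - 1/2 * lie_bilin_at A N g (c t) u u
    - (L' $ 1 * \<sigma> (c t) (N (c t)) + L' $ 2 * \<sigma>s (c t) (N (c t)))"
proof -
  let ?p = "c t"
  have k: "\<kappa> \<in> A" "?p \<in> fst \<kappa>" by (simp_all add: \<kappa>_def chart_at)
  have u: "u \<in> Vq M ?p" unfolding u_def by (rule horizontal_velocity[OF c t])
  note ut = Vq_tangent[OF u]
  have Nt: "N ?p \<in> tangent_space A ?p" using N nu_tangent nus_tangent by blast
  have NU: "N \<in> vector_fields A UNIV" using N nu_field nus_field by blast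
  have s0: "form_coord A \<sigma> \<kappa> (snd \<kappa> ?p) (u \<kappa>) = 0" "form_coord A \<sigma>s \<kappa> (snd \<kappa> ?p) (u \<kappa>) = 0"
    using form_coord_eval[OF k ut] sigma_values u by simp_all
  have sN: "form_coord A \<sigma> \<kappa> (snd \<kappa> ?p) (N ?p \<kappa>) = \<sigma> ?p (N ?p)" "form_coord A \<sigma>s \<kappa> (snd \<kappa> ?p) (N ?p \<kappa>) = \<sigma>s ?p (N ?p)"
    using form_coord_eval[OF k Nt] by simp_all
  obtain r r' where r: "\<And>q. \<sigma> q (N q) = r" "\<And>q. \<sigma>s q (N q) = r'"
    using N sigma_values by (metis (full_types))
  note lie = lie_form_at_coord[OF sigma_smooth open_UNIV UNIV_I NU ut, folded \<kappa>_def]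
    lie_form_at_coord[OF sigmas_smooth open_UNIV UNIV_I NU ut, folded \<kappa>_def]
    lie_bilin_at_coord[OF metric_smooth open_UNIV UNIV_I NU ut ut, folded \<kappa>_def]
  note const = sigma_frame_derivative[OF sigma_smooth NU r(1), of ?p u, folded \<kappa>_def]
    sigma_frame_derivative[OF sigmas_smooth NU r(2), of ?p u, folded \<kappa>_def]
  note frame = horizontal_frame_derivative[OF c t N k, folded u_def]
  note sym = bilin_coord_sym[OF metric_smooth k(1), of "snd \<kappa> ?p" "comp_deriv \<kappa> ?p N (u \<kappa>)" "u \<kappa>"]
  show ?thesis
    using frame unfolding euler_lagrange_def Let_def u_def[symmetric] lie multiplier_form_deriv(2)[OF L k] const s0 sN sym
      L'_def
    by (simp add: algebra_simps)
qed

text \<open>The Euler-Lagrange covector is tested on \<open>H\<close>, where it gives the equation for \<open>\<nabla>\<^sub>u u\<close>, and on \<open>\<nu>\<close> and \<open>\<nu>\<^sup>*\<close>, where it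
  gives the two components of the equation for the multipliers.\<close>

lemma euler_lagrange_iff:
  assumes c: "c \<in> horizontal_curves M x y" and t: "t \<in> {0..1}" and L: "smooth_function A UNIV L"
  defines "p \<equiv> c t" and "u \<equiv> velocity A c t"
  shows "(\<forall>w. euler_lagrange g (multiplier_form L) (chart_at A p) c t w = 0) \<longleftrightarrow>
    covariant_deriv A D c (velocity A c) t =
      L p $ 1 *\<^sub>R sharp_H M p (\<lambda>w. ext_deriv_at A \<sigma> p u w) + L p $ 2 *\<^sub>R sharp_H M p (\<lambda>w. ext_deriv_at A \<sigma>s p u w) \<and>
    ((\<lambda>s. L (c s)) has_vector_derivative
       vector [vector [lie_form_at A \<nu> \<sigma> p u, lie_form_at A \<nu> \<sigma>s p u],
               vector [lie_form_at A \<nu>s \<sigma> p u, lie_form_at A \<nu>s \<sigma>s p u]] *v L p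
       - (1/2) *\<^sub>R vector [lie_bilin_at A \<nu> g p u u, lie_bilin_at A \<nu>s g p u u]) (at t within {0..1})"
    (is "?EL \<longleftrightarrow> ?cov \<and> ?ode")
proof -
  let ?\<kappa> = "chart_at A p"
  let ?el = "euler_lagrange g (multiplier_form L) ?\<kappa> c t"
  let ?C = "covariant_deriv A D c (velocity A c) t"
  let ?s1 = "sharp_H M p (\<lambda>w. ext_deriv_at A \<sigma> p u w)" and ?s2 = "sharp_H M p (\<lambda>w. ext_deriv_at A \<sigma>s p u w)"
  note k = chart_at[of p]
  have u: "u \<in> Vq M p" unfolding u_def p_def by (rule horizontal_velocity[OF c t])
  have lin: "linear ?el"
    by (rule euler_lagrange_linear[OF metric_smooth multiplier_form_smooth[OF L] k(1)]) (use k(2) in \<open>simp add: p_def\<close>)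
  have C: "?C \<in> Vq M p" unfolding p_def by (rule covariant_deriv_horizontal[OF c t])
  have img: "snd ?\<kappa> p \<in> snd ?\<kappa> ` fst ?\<kappa>" using k by blast
  have ext_add: "ext_deriv_at A s p u (v + w) = ext_deriv_at A s p u v + ext_deriv_at A s p u w"
    if s: "smooth_form A s" and vw: "v \<in> Vq M p" "w \<in> Vq M p" for s v w
    using Vq_tangent[OF u] vw[THEN Vq_tangent] subspace_add[OF tangent_space_subspace vw[THEN Vq_tangent]]
    by (simp add: ext_deriv_at_coord[OF s] linear_add[OF linear_form_deriv_last[OF s k]]
        linear_add[OF linear_frechet_derivative[OF form_coord_differentiable[OF s k(1) img]]])
  have ext_scale: "ext_deriv_at A s p u (r *\<^sub>R v) = r * ext_deriv_at A s p u v"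
    if s: "smooth_form A s" and v: "v \<in> Vq M p" for s v r
    using Vq_tangent[OF u] Vq_tangent[OF v] subspace_mul[OF tangent_space_subspace Vq_tangent[OF v]]
    by (simp add: ext_deriv_at_coord[OF s] scaleR_fun_def linear_scale[OF linear_form_deriv_last[OF s k]]
        linear_scale[OF linear_frechet_derivative[OF form_coord_differentiable[OF s k(1) img]]] algebra_simps)
  note sharp1 = sharp_H_works[OF ext_add[OF sigma_smooth] ext_scale[OF sigma_smooth]]
  note sharp2 = sharp_H_works[OF ext_add[OF sigmas_smooth] ext_scale[OF sigmas_smooth]]
  have S: "L p $ 1 *\<^sub>R ?s1 + L p $ 2 *\<^sub>R ?s2 \<in> Vq M p"
    by (intro subspace_add[OF Vq_subspace] subspace_mul[OF Vq_subspace] sharp1(1) sharp2(1))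
  have gS: "g p (L p $ 1 *\<^sub>R ?s1 + L p $ 2 *\<^sub>R ?s2) w = L p $ 1 * ext_deriv_at A \<sigma> p u w + L p $ 2 * ext_deriv_at A \<sigma>s p u w"
    if w: "w \<in> Vq M p" for w
  proof -
    note t = Vq_tangent[OF sharp1(1)] Vq_tangent[OF sharp2(1)] Vq_tangent[OF w]
    show ?thesis
      using sharp1(2)[OF _ _ _ w] sharp2(2)[OF _ _ _ w]
      by (simp add: g_add_left g_scaleR_left t subspace_mul[OF tangent_space_subspace])
  qed
  have el_H: "?el (w ?\<kappa>) = g p ?C w - g p (L p $ 1 *\<^sub>R ?s1 + L p $ 2 *\<^sub>R ?s2) w" if "w \<in> Vq M p" for w
    using euler_lagrange_horizontal[OF c t L that[unfolded p_def]] gS[OF that] by (simp add: p_def u_def)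
  have cov: "?cov \<longleftrightarrow> (\<forall>w\<in>Vq M p. ?el (w ?\<kappa>) = 0)"
    using Vq_eqI[OF C S] by (auto simp: el_H)
  let ?L' = "fderiv (L \<circ> cinv ?\<kappa>) (snd ?\<kappa> p) (u ?\<kappa>)"
  have dL: "((\<lambda>s. L (c s)) has_vector_derivative ?L') (at t within {0..1})"
    unfolding u_def using curve_chain[OF c t, of ?\<kappa> L] multiplier_form_deriv(1)[OF L k] k by (simp add: p_def o_def)
  have "((\<lambda>s. L (c s)) has_vector_derivative R) (at t within {0..1}) \<longleftrightarrow> R = ?L'" for R
    using vector_derivative_within_closed_interval[OF _ t dL] vector_derivative_within_closed_interval[OF _ t, of "\<lambda>s. L (c s)" R] dL
    by auto
  then have ode: "?ode \<longleftrightarrow> ?el (\<nu> p ?\<kappa>) = 0 \<and> ?el (\<nu>s p ?\<kappa>) = 0"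
    using euler_lagrange_frame[OF c t L, of \<nu>] euler_lagrange_frame[OF c t L, of \<nu>s]
    by (auto simp: p_def u_def sigma_values vec_eq_iff forall_2 matrix_vector_mult_def sum_2 vector_2 algebra_simps)
  have "?el w = 0" if H: "\<forall>w\<in>Vq M p. ?el (w ?\<kappa>) = 0" and f: "?el (\<nu> p ?\<kappa>) = 0" "?el (\<nu>s p ?\<kappa>) = 0" for w
  proof -
    obtain r s v where v: "v \<in> Vq M p" "coord_vec A ?\<kappa> p w = r *\<^sub>R \<nu> p + s *\<^sub>R \<nu>s p + v"
      using frame_decomposition[OF coord_vec_tangent[OF k]] by blast
    have "w = r *\<^sub>R \<nu> p ?\<kappa> + s *\<^sub>R \<nu>s p ?\<kappa> + v ?\<kappa>"
      using fun_cong[OF v(2), of ?\<kappa>] by (simp add: coord_vec_same[OF k] scaleR_fun_def)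
    then show ?thesis using H f v(1) by (simp add: linear_add[OF lin] linear_scale[OF lin])
  qed
  then show ?thesis using cov ode by blast
qed

section \<open>Normal geodesics\<close>

text \<open>The integrands are continuous on the unit interval, so the difference of the two integrals is the integral
  of the difference.\<close>

lemma energy_eq_action:
  assumes "smooth_map_on A {0..1} c" and L: "smooth_function A UNIV L"
  shows "energy M L c = action g (multiplier_form L) c"
proof -
  obtain T C where C: "smooth_into A T C" "{0..1} \<subseteq> T" "\<And>t. t \<in> {0..1} \<Longrightarrow> C t = c t"
    using assms(1) unfolding smooth_map_on_iff_extension by blast
  have v: "velocity A c t = pushforward A C t 1" if "t \<in> {0..1}" for t
    using velocity_extension[OF C that] .
  have "continuous_on {0..1} (\<lambda>t. g (C t) (pushforward A C t 1) (pushforward A C t 1))"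
    "continuous_on {0..1} (\<lambda>t. multiplier_form L (C t) (pushforward A C t 1))"
    using smooth_on_continuous[OF smooth_on_bilin_pushforward[OF C(1) metric_smooth multiplier_form_smooth[OF L]]]
      smooth_on_continuous[OF smooth_on_form_pushforward[OF C(1) metric_smooth multiplier_form_smooth[OF L]]]
      C(2) continuous_on_subset by blast+
  then have "continuous_on {0..1} (\<lambda>t. g (c t) (velocity A c t) (velocity A c t))"
    "continuous_on {0..1} (\<lambda>t. multiplier_form L (c t) (velocity A c t))"
    by - (rule continuous_on_eq, assumption, simp add: C(3) v)+
  then have "(\<lambda>t. g (c t) (velocity A c t) (velocity A c t)) integrable_on {0..1}"
    "(\<lambda>t. multiplier_form L (c t) (velocity A c t)) integrable_on {0..1}"
    by (auto intro: integrable_continuous_real)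
  then show ?thesis
    unfolding energy_def action_def lagrangian_def multiplier_form_def[symmetric]
    by (subst integral_diff) (auto intro: integrable_on_cmult_left)
qed

lemma variation_iff: "variation M x y c F \<longleftrightarrow> fixed_end_variation x y c F"
  by (simp add: variation_def fixed_end_variation_def)

lemma energy_derivative_iff:
  assumes F: "fixed_end_variation x y c F" and L: "smooth_function A UNIV L"
  shows "((\<lambda>s. energy M L (\<lambda>t. F (s, t))) has_real_derivative d) (at 0) \<longleftrightarrow>
    ((\<lambda>s. action g (multiplier_form L) (\<lambda>t. F (s, t))) has_real_derivative d) (at 0)"
proof -
  obtain \<epsilon> T G where \<epsilon>: "\<epsilon> > 0" and G: "smooth_into A T G" "{-\<epsilon><..<\<epsilon>} \<times> {0..1} \<subseteq> T" "\<And>z. z \<in> {-\<epsilon><..<\<epsilon>} \<times> {0..1} \<Longrightarrow> G z = F z"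
    using F unfolding fixed_end_variation_def smooth_map_on_iff_extension by blast
  have "energy M L (\<lambda>t. F (s, t)) = action g (multiplier_form L) (\<lambda>t. F (s, t))" if "s \<in> {-\<epsilon><..<\<epsilon>}" for s
  proof (rule energy_eq_action[OF _ L])
    show "smooth_map_on A {0..1} (\<lambda>t. F (s, t))"
      unfolding smooth_map_on_iff_extension
      using slice_smooth_into[OF G(1), of s] subsetD[OF G(2), of "(s, _)"] G(3) that
      by (intro exI[of _ "Pair s -` T"] exI[of _ "\<lambda>t. G (s, t)"]) auto
  qed
  then have "\<forall>\<^sub>F s in nhds 0. energy M L (\<lambda>t. F (s, t)) = action g (multiplier_form L) (\<lambda>t. F (s, t))"
    using \<epsilon> by (intro eventually_nhds_in_open[THEN eventually_mono, of "{-\<epsilon><..<\<epsilon>}"]) auto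
  then show ?thesis by (rule DERIV_cong_ev[OF refl _ refl])
qed

lemma critical_iff_euler_lagrange:
  assumes c: "c \<in> horizontal_curves M x y" and L: "smooth_function A UNIV L"
  shows "(\<forall>F. variation M x y c F \<longrightarrow> ((\<lambda>s. energy M L (\<lambda>t. F (s, t))) has_real_derivative 0) (at 0)) \<longleftrightarrow>
    (\<forall>t\<in>{0..1}. \<forall>w. euler_lagrange g (multiplier_form L) (chart_at A (c t)) c t w = 0)"
proof -
  note a = metric_smooth multiplier_form_smooth[OF L]
  have c': "smooth_map_on A {0..1} c" "c 0 = x" "c 1 = y"
    using c by (auto simp: horizontal_curves_def curves_def)
  show ?thesis
    using euler_lagrange_imp_critical[OF a] critical_imp_euler_lagrange[OF a c'] energy_derivative_iff[OF _ L]
    unfolding variation_iff by blast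
qed

end

theorem corollary4p1:
  fixes M :: "('m::{t2_space, second_countable_topology}, 'e::euclidean_space) witt"
    and D :: "('m \<Rightarrow> ('m, 'e) tangent) \<Rightarrow> ('m \<Rightarrow> ('m, 'e) tangent) \<Rightarrow> 'm \<Rightarrow> ('m, 'e) tangent"
    and x y :: 'm and c :: "real \<Rightarrow> 'm"
  assumes "lorentzian_witt M"
    and "canonical_witt_connection M D"
    and "c \<in> horizontal_curves M x y"
  shows "normal_geodesic M x y c \<longleftrightarrow>
    (\<exists>L::'m \<Rightarrow> real^2. smooth_function (atlas M) UNIV L \<and>
       (\<forall>t\<in>{0..1}.
          let A = atlas M; g = wmetric M; p = c t; u = velocity A c t in
          covariant_deriv A D c (velocity A c) t =
            L p $ 1 *\<^sub>R sharp_H M p (\<lambda>w. ext_deriv_at A (wsigma M) p u w)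
            + L p $ 2 *\<^sub>R sharp_H M p (\<lambda>w. ext_deriv_at A (wsigmas M) p u w) \<and>
          ((\<lambda>s. L (c s)) has_vector_derivative
             vector [vector [lie_form_at A (nu M) (wsigma M) p u, lie_form_at A (nu M) (wsigmas M) p u],
                     vector [lie_form_at A (nus M) (wsigma M) p u, lie_form_at A (nus M) (wsigmas M) p u]]
               *v L p
             - (1/2) *\<^sub>R vector [lie_bilin_at A (nu M) g p u u, lie_bilin_at A (nus M) g p u u])
            (at t within {0..1})))"
proof -
  interpret canonical_witt M D
    using assms(1,2) by unfold_locales
  \<comment> \<open>One and the same multiplier serves in both directions.\<close>
  show ?thesis
    unfolding normal_geodesic_def Let_def
    using assms(3) critical_iff_euler_lagrange[OF assms(3)] euler_lagrange_iff[OF assms(3)]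
    by (intro iffI) (elim conjE exE, blast)+
qed

end
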